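(* Let $(B,H)$ be a matched pair of Hopf algebras over $k$. If $H$ and $B$ have invertible antipodes, then the double crossproduct $B\bowtie H$ is a strong smash product algebra of $B$ and $H$, i.e. there is a bijective, quasitriangular and normal linear map $R:H\otimes B\to B\otimes H$ such that $B\bowtie H=B\#_R H$ as algebras. In particular, for every matched pair of groups $(G,K)$, the group algebra $k[G\bowtie K]$ of the bismash product is a strong smash product algebra (of $k[G]$ and $k[K]$).
   Context: $k$ is a field containing $\mathbb{Q}$, $\otimes=\otimes_k$; algebras are unital and associative over $k$; Sweedler notation $\Delta(h)=h_{(1)}\otimes h_{(2)}$ is used. Smash products. Let $A,B$ be algebras, with multiplications denoted $m$. A linear map $R:B\otimes A\to A\otimes B$ is quasitriangular if $R\circ(m\otimes id)=(id\otimes m)R_{12}R_{23}$ on $B\otimes B\otimes A$ and $R\circ(id\otimes m)=(m\otimes id)R_{23}R_{12}$ on $B\otimes A\otimes A$ ($R_{12}=R\otimes id$, $R_{23}=id\otimes R$); it is normal if $R(1\otimes a)=a\otimes1$ and $R(b\otimes1)=1\otimes b$ for all $a\in A,b\in B$. Then the smash product algebra $A\#_RB$ is $A\otimes B$ with product $(a\otimes b)(a'\otimes b')=aR(b\otimes a')b'$; it is called strong if $R$ is bijective. Matched pairs of Hopf algebras. A pair $(B,H)$ of Hopf algebras is matched if $B$ is a left $H$-module coalgebra via $h\otimes b\mapsto h\rhd b\in B$ and $H$ is a right $B$-module coalgebra via $h\otimes b\mapsto h\lhd b\in H$, such that for all $b,c\in B$, $h,g\in H$: $h\rhd1_B=\varepsilon_H(h)1_B$;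 $h\rhd(bc)=(h_{(1)}\rhd b_{(1)})\big((h_{(2)}\lhd b_{(2)})\rhd c\big)$; $1_H\lhd b=1_H\varepsilon_B(b)$; $(hg)\lhd b=\big(h\lhd(g_{(1)}\rhd b_{(1)})\big)(g_{(2)}\lhd b_{(2)})$; $h_{(1)}\lhd b_{(1)}\otimes h_{(2)}\rhd b_{(2)}=h_{(2)}\lhd b_{(2)}\otimes h_{(1)}\rhd b_{(1)}$. The double crossproduct $B\bowtie H$ is the Hopf algebra on $B\otimes H$ with product $(b\otimes h)(c\otimes g)=b(h_{(1)}\rhd c_{(1)})\otimes(h_{(2)}\lhd c_{(2)})g$, unit $1_B\otimes 1_H$, the tensor product coalgebra structure, and antipode $S(b\otimes h)=(1\otimes S_Hh)(S_Bb\otimes1)$. Matched pairs of groups. $(G,K)$ is a matched pair of groups if $K$ acts on the set $G$ from the left, $(x,g)\mapsto x\rhd g$, and $G$ acts on the set $K$ from the right, $(x,g)\mapsto x\lhd g$, with $x\rhd(gg')=(x\rhd g)((x\lhd g)\rhd g')$ and $(xx')\lhd g=(x\lhd(x'\rhd g))(x'\lhd g)$. The bismash product $G\bowtie K$ is the group $G\times K$ with product $(g,x)(g',x')=(g(x\rhd g'),(x\lhd g')x')$. *)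

theory Defs
  imports "HOL-Algebra.Algebra" "HOL-Algebra.Algebraic_Closure_Type"
begin

section \<open>Linear and bilinear maps\<close>

text \<open>
  Vector spaces over a field \<open>K\<close> are modules in the sense of \<^locale>\<open>module\<close>. Maps are only
  looked at on the carriers of their domains; nothing is required of them elsewhere.
\<close>

definition linear_maps ::
  "('k, 'm) ring_scheme \<Rightarrow> ('k, 'v, 'n) module_scheme \<Rightarrow> ('k, 'w, 'p) module_scheme \<Rightarrow> ('v \<Rightarrow> 'w) set"
  where "linear_maps K V W =
    {f \<in> carrier V \<rightarrow> carrier W.
       (\<forall>x \<in> carrier V. \<forall>y \<in> carrier V. f (x \<oplus>\<^bsub>V\<^esub> y) = f x \<oplus>\<^bsub>W\<^esub> f y) \<and>
       (\<forall>c \<in> carrier K. \<forall>x \<in> carrier V. f (c \<odot>\<^bsub>V\<^esub> x) = c \<odot>\<^bsub>W\<^esub> f x)}"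

definition bilinear_maps ::
  "('k, 'm) ring_scheme \<Rightarrow> ('k, 'v, 'n) module_scheme \<Rightarrow> ('k, 'w, 'p) module_scheme \<Rightarrow>
   ('k, 'u, 'q) module_scheme \<Rightarrow> ('v \<Rightarrow> 'w \<Rightarrow> 'u) set"
  where "bilinear_maps K V W U =
    {f. (\<forall>v \<in> carrier V. f v \<in> linear_maps K W U) \<and>
        (\<forall>w \<in> carrier W. (\<lambda>v. f v w) \<in> linear_maps K V U)}"

definition self_module :: "('k, 'm) ring_scheme \<Rightarrow> ('k, 'k) module"
  where "self_module K =
    \<lparr>carrier = carrier K, monoid.mult = (\<otimes>\<^bsub>K\<^esub>), one = \<one>\<^bsub>K\<^esub>,
     ring.zero = \<zero>\<^bsub>K\<^esub>, ring.add = (\<oplus>\<^bsub>K\<^esub>), module.smult = (\<otimes>\<^bsub>K\<^esub>)\<rparr>"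


section \<open>Tensor products\<close>

text \<open>
  The free module on a set \<open>S\<close> consists of the finitely supported functions on \<open>S\<close>, extended by
  zero. The ring multiplication and unit are irrelevant fields of the record here.
\<close>

definition free_module :: "('k, 'm) ring_scheme \<Rightarrow> 's set \<Rightarrow> ('k, 's \<Rightarrow> 'k) module"
  where "free_module K S =
    \<lparr>carrier = {f. (\<forall>s \<in> S. f s \<in> carrier K) \<and> (\<forall>s. s \<notin> S \<longrightarrow> f s = \<zero>\<^bsub>K\<^esub>) \<and>
                   finite {s. f s \<noteq> \<zero>\<^bsub>K\<^esub>}},
     monoid.mult = undefined, one = undefined,
     ring.zero = (\<lambda>s. \<zero>\<^bsub>K\<^esub>), ring.add = (\<lambda>f g s. f s \<oplus>\<^bsub>K\<^esub> g s), module.smult = (\<lambda>c f s. c \<otimes>\<^bsub>K\<^esub> f s)\<rparr>"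

definition delta :: "('k, 'm) ring_scheme \<Rightarrow> 's \<Rightarrow> 's \<Rightarrow> 'k"
  where "delta K s = (\<lambda>t. if t = s then \<one>\<^bsub>K\<^esub> else \<zero>\<^bsub>K\<^esub>)"

definition tensor_gens ::
  "('k, 'm) ring_scheme \<Rightarrow> ('k, 'v, 'n) module_scheme \<Rightarrow> ('k, 'w, 'p) module_scheme \<Rightarrow>
   ('v \<times> 'w \<Rightarrow> 'k) set"
  where "tensor_gens K V W =
    (let F = free_module K (carrier V \<times> carrier W) in
      {delta K (v \<oplus>\<^bsub>V\<^esub> v', w) \<ominus>\<^bsub>F\<^esub> (delta K (v, w) \<oplus>\<^bsub>F\<^esub> delta K (v', w)) | v v' w.
         v \<in> carrier V \<and> v' \<in> carrier V \<and> w \<in> carrier W} \<union>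
      {delta K (v, w \<oplus>\<^bsub>W\<^esub> w') \<ominus>\<^bsub>F\<^esub> (delta K (v, w) \<oplus>\<^bsub>F\<^esub> delta K (v, w')) | v w w'.
         v \<in> carrier V \<and> w \<in> carrier W \<and> w' \<in> carrier W} \<union>
      {delta K (c \<odot>\<^bsub>V\<^esub> v, w) \<ominus>\<^bsub>F\<^esub> (c \<odot>\<^bsub>F\<^esub> delta K (v, w)) | c v w.
         c \<in> carrier K \<and> v \<in> carrier V \<and> w \<in> carrier W} \<union>
      {delta K (v, c \<odot>\<^bsub>W\<^esub> w) \<ominus>\<^bsub>F\<^esub> (c \<odot>\<^bsub>F\<^esub> delta K (v, w)) | c v w.
         c \<in> carrier K \<and> v \<in> carrier V \<and> w \<in> carrier W})"

definition tensor_rel ::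
  "('k, 'm) ring_scheme \<Rightarrow> ('k, 'v, 'n) module_scheme \<Rightarrow> ('k, 'w, 'p) module_scheme \<Rightarrow>
   ('v \<times> 'w \<Rightarrow> 'k) set"
  where "tensor_rel K V W =
    \<Inter>{N. submodule N K (free_module K (carrier V \<times> carrier W)) \<and> tensor_gens K V W \<subseteq> N}"

text \<open>
  The tensor product is the quotient of the free module on the pairs by the bilinearity relations;
  its elements are cosets. As before, multiplication and unit are irrelevant.
\<close>

definition tensor ::
  "('k, 'm) ring_scheme \<Rightarrow> ('k, 'v, 'n) module_scheme \<Rightarrow> ('k, 'w, 'p) module_scheme \<Rightarrow>
   ('k, ('v \<times> 'w \<Rightarrow> 'k) set) module"
  where "tensor K V W =
    (let F = free_module K (carrier V \<times> carrier W); N = tensor_rel K V W in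
      \<lparr>carrier = a_rcosets\<^bsub>F\<^esub> N,
       monoid.mult = undefined, one = undefined,
       ring.zero = N, ring.add = (\<lambda>s t. s <+>\<^bsub>F\<^esub> t),
       module.smult = (\<lambda>c s. \<Union>x \<in> s. N +>\<^bsub>F\<^esub> (c \<odot>\<^bsub>F\<^esub> x))\<rparr>)"

definition pure ::
  "('k, 'm) ring_scheme \<Rightarrow> ('k, 'v, 'n) module_scheme \<Rightarrow> ('k, 'w, 'p) module_scheme \<Rightarrow>
   'v \<Rightarrow> 'w \<Rightarrow> ('v \<times> 'w \<Rightarrow> 'k) set"
  where "pure K V W v w =
    tensor_rel K V W +>\<^bsub>free_module K (carrier V \<times> carrier W)\<^esub> delta K (v, w)"

text \<open>
  \<open>tensor_lift K U f\<close> is the linear map on a tensor product with values in \<open>U\<close> induced by the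
  bilinear map \<open>f\<close>, that is, \<open>v \<otimes> w \<mapsto> f v w\<close>. It is computed on an arbitrary representative
  of the coset, the choice of which does not matter when \<open>f\<close> is bilinear.
\<close>

definition tensor_lift ::
  "('k, 'm) ring_scheme \<Rightarrow> ('k, 'u, 'q) module_scheme \<Rightarrow> ('v \<Rightarrow> 'w \<Rightarrow> 'u) \<Rightarrow>
   ('v \<times> 'w \<Rightarrow> 'k) set \<Rightarrow> 'u"
  where "tensor_lift K U f s =
    (let p = (SOME p. p \<in> s) in
      \<Oplus>\<^bsub>U\<^esub>z \<in> {z. p z \<noteq> \<zero>\<^bsub>K\<^esub>}. p z \<odot>\<^bsub>U\<^esub> f (fst z) (snd z))"

text \<open>\<open>tensor_map K V' W' f g\<close> is \<open>f \<otimes> g\<close> for linear \<open>f\<close>, \<open>g\<close> with codomains \<open>V'\<close>, \<open>W'\<close>.\<close>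

definition tensor_map ::
  "('k, 'm) ring_scheme \<Rightarrow> ('k, 'c, 'n) module_scheme \<Rightarrow> ('k, 'd, 'p) module_scheme \<Rightarrow>
   ('v \<Rightarrow> 'c) \<Rightarrow> ('w \<Rightarrow> 'd) \<Rightarrow> ('v \<times> 'w \<Rightarrow> 'k) set \<Rightarrow> ('c \<times> 'd \<Rightarrow> 'k) set"
  where "tensor_map K V' W' f g =
    tensor_lift K (tensor K V' W') (\<lambda>v w. pure K V' W' (f v) (g w))"

definition assoc_right ::
  "('k, 'm) ring_scheme \<Rightarrow> ('k, 'u, 'n) module_scheme \<Rightarrow> ('k, 'v, 'p) module_scheme \<Rightarrow>
   ('k, 'w, 'q) module_scheme \<Rightarrow>
   (('u \<times> 'v \<Rightarrow> 'k) set \<times> 'w \<Rightarrow> 'k) set \<Rightarrow> ('u \<times> ('v \<times> 'w \<Rightarrow> 'k) set \<Rightarrow> 'k) set"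
  where "assoc_right K U V W =
    (let T = tensor K U (tensor K V W) in
      tensor_lift K T (\<lambda>x w. tensor_lift K T
        (\<lambda>u v. pure K U (tensor K V W) u (pure K V W v w)) x))"

definition assoc_left ::
  "('k, 'm) ring_scheme \<Rightarrow> ('k, 'u, 'n) module_scheme \<Rightarrow> ('k, 'v, 'p) module_scheme \<Rightarrow>
   ('k, 'w, 'q) module_scheme \<Rightarrow>
   ('u \<times> ('v \<times> 'w \<Rightarrow> 'k) set \<Rightarrow> 'k) set \<Rightarrow> (('u \<times> 'v \<Rightarrow> 'k) set \<times> 'w \<Rightarrow> 'k) set"
  where "assoc_left K U V W =
    (let T = tensor K (tensor K U V) W in
      tensor_lift K T (\<lambda>u y. tensor_lift K T
        (\<lambda>v w. pure K (tensor K U V) W (pure K U V u v) w) y))"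


section \<open>Algebras and smash products\<close>

text \<open>The locale \<^locale>\<open>algebra\<close> is restricted to commutative algebras.\<close>

locale assoc_algebra = module K A + ring A for K and A (structure) +
  assumes smult_mult_left:
      "\<lbrakk>c \<in> carrier K; x \<in> carrier A; y \<in> carrier A\<rbrakk> \<Longrightarrow> (c \<odot> x) \<otimes> y = c \<odot> (x \<otimes> y)"
    and smult_mult_right:
      "\<lbrakk>c \<in> carrier K; x \<in> carrier A; y \<in> carrier A\<rbrakk> \<Longrightarrow> x \<otimes> (c \<odot> y) = c \<odot> (x \<otimes> y)"

definition mult_map ::
  "('k, 'm) ring_scheme \<Rightarrow> ('k, 'a, 'n) module_scheme \<Rightarrow> ('a \<times> 'a \<Rightarrow> 'k) set \<Rightarrow> 'a"
  where "mult_map K A = tensor_lift K A (\<lambda>x y. x \<otimes>\<^bsub>A\<^esub> y)"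

definition algebra_iso ::
  "('k, 'm) ring_scheme \<Rightarrow> ('k, 'a, 'n) module_scheme \<Rightarrow> ('k, 'c, 'p) module_scheme \<Rightarrow> ('a \<Rightarrow> 'c) set"
  where "algebra_iso K A C = ring_iso A C \<inter> linear_maps K A C"

text \<open>
  Equality as algebras. Equality of records would also compare the operations outside the carrier,
  and does not make sense when one side carries additional structure.
\<close>

definition same_algebra ::
  "('k, 'm) ring_scheme \<Rightarrow> ('k, 'a, 'n) module_scheme \<Rightarrow> ('k, 'a, 'p) module_scheme \<Rightarrow> bool"
  where "same_algebra K A C \<longleftrightarrow>
    carrier A = carrier C \<and> \<zero>\<^bsub>A\<^esub> = \<zero>\<^bsub>C\<^esub> \<and> \<one>\<^bsub>A\<^esub> = \<one>\<^bsub>C\<^esub> \<and>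
    (\<forall>x \<in> carrier A. \<forall>y \<in> carrier A. x \<oplus>\<^bsub>A\<^esub> y = x \<oplus>\<^bsub>C\<^esub> y) \<and>
    (\<forall>x \<in> carrier A. \<forall>y \<in> carrier A. x \<otimes>\<^bsub>A\<^esub> y = x \<otimes>\<^bsub>C\<^esub> y) \<and>
    (\<forall>c \<in> carrier K. \<forall>x \<in> carrier A. c \<odot>\<^bsub>A\<^esub> x = c \<odot>\<^bsub>C\<^esub> x)"

text \<open>The componentwise product \<open>(a \<otimes> b)(a' \<otimes> b') = aa' \<otimes> bb'\<close> on \<open>A \<otimes> B\<close>.\<close>

definition tensor_alg ::
  "('k, 'm) ring_scheme \<Rightarrow> ('k, 'a, 'n) module_scheme \<Rightarrow> ('k, 'b, 'p) module_scheme \<Rightarrow>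
   ('k, ('a \<times> 'b \<Rightarrow> 'k) set) module"
  where "tensor_alg K A B =
    (let T = tensor K A B in
      T\<lparr>monoid.mult := (\<lambda>s t.
          tensor_lift K T (\<lambda>a b. tensor_lift K T (\<lambda>a' b'.
            pure K A B (a \<otimes>\<^bsub>A\<^esub> a') (b \<otimes>\<^bsub>B\<^esub> b')) t) s),
        one := pure K A B \<one>\<^bsub>A\<^esub> \<one>\<^bsub>B\<^esub>\<rparr>)"

text \<open>
  Both sides of the two identities for \<open>R : B \<otimes> A \<rightarrow> A \<otimes> B\<close> are compared on \<open>(B \<otimes> B) \<otimes> A\<close> and
  \<open>(B \<otimes> A) \<otimes> A\<close>, respectively; the right-hand sides are
  \<open>(id \<otimes> m) R\<^sub>1\<^sub>2 R\<^sub>2\<^sub>3\<close> and \<open>(m \<otimes> id) R\<^sub>2\<^sub>3 R\<^sub>1\<^sub>2\<close> with the associativity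
  isomorphisms made explicit.
\<close>

definition quasitriangular ::
  "('k, 'm) ring_scheme \<Rightarrow> ('k, 'a, 'n) module_scheme \<Rightarrow> ('k, 'b, 'p) module_scheme \<Rightarrow>
   (('b \<times> 'a \<Rightarrow> 'k) set \<Rightarrow> ('a \<times> 'b \<Rightarrow> 'k) set) \<Rightarrow> bool"
  where "quasitriangular K A B R \<longleftrightarrow>
    (\<forall>x \<in> carrier (tensor K (tensor K B B) A).
       R (tensor_map K B A (mult_map K B) id x) =
       (tensor_map K A B id (mult_map K B) \<circ> assoc_right K A B B \<circ>
        tensor_map K (tensor K A B) B R id \<circ> assoc_left K B A B \<circ>
        tensor_map K B (tensor K A B) id R \<circ> assoc_right K B B A) x) \<and>
    (\<forall>x \<in> carrier (tensor K (tensor K B A) A).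
       R (tensor_map K B A id (mult_map K A) (assoc_right K B A A x)) =
       (tensor_map K A B (mult_map K A) id \<circ> assoc_left K A A B \<circ>
        tensor_map K A (tensor K A B) id R \<circ> assoc_right K A B A \<circ>
        tensor_map K (tensor K A B) A R id) x)"

definition normal_map ::
  "('k, 'm) ring_scheme \<Rightarrow> ('k, 'a, 'n) module_scheme \<Rightarrow> ('k, 'b, 'p) module_scheme \<Rightarrow>
   (('b \<times> 'a \<Rightarrow> 'k) set \<Rightarrow> ('a \<times> 'b \<Rightarrow> 'k) set) \<Rightarrow> bool"
  where "normal_map K A B R \<longleftrightarrow>
    (\<forall>a \<in> carrier A. R (pure K B A \<one>\<^bsub>B\<^esub> a) = pure K A B a \<one>\<^bsub>B\<^esub>) \<and>
    (\<forall>b \<in> carrier B. R (pure K B A b \<one>\<^bsub>A\<^esub>) = pure K A B \<one>\<^bsub>A\<^esub> b)"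

text \<open>
  \<open>(a \<otimes> b)(a' \<otimes> b') = a R(b \<otimes> a') b'\<close>, where \<open>a (u \<otimes> v) b' = au \<otimes> vb'\<close>.
\<close>

definition smash_product ::
  "('k, 'm) ring_scheme \<Rightarrow> ('k, 'a, 'n) module_scheme \<Rightarrow> ('k, 'b, 'p) module_scheme \<Rightarrow>
   (('b \<times> 'a \<Rightarrow> 'k) set \<Rightarrow> ('a \<times> 'b \<Rightarrow> 'k) set) \<Rightarrow> ('k, ('a \<times> 'b \<Rightarrow> 'k) set) module"
  where "smash_product K A B R =
    (let T = tensor K A B in
      T\<lparr>monoid.mult := (\<lambda>s t.
          tensor_lift K T (\<lambda>a b. tensor_lift K T (\<lambda>a' b'.
            tensor_lift K T (\<lambda>u v. pure K A B (a \<otimes>\<^bsub>A\<^esub> u) (v \<otimes>\<^bsub>B\<^esub> b'))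
              (R (pure K B A b a'))) t) s),
        one := pure K A B \<one>\<^bsub>A\<^esub> \<one>\<^bsub>B\<^esub>\<rparr>)"

definition strong_smash_map ::
  "('k, 'm) ring_scheme \<Rightarrow> ('k, 'a, 'n) module_scheme \<Rightarrow> ('k, 'b, 'p) module_scheme \<Rightarrow>
   (('b \<times> 'a \<Rightarrow> 'k) set \<Rightarrow> ('a \<times> 'b \<Rightarrow> 'k) set) \<Rightarrow> bool"
  where "strong_smash_map K A B R \<longleftrightarrow>
    R \<in> linear_maps K (tensor K B A) (tensor K A B) \<and>
    bij_betw R (carrier (tensor K B A)) (carrier (tensor K A B)) \<and>
    quasitriangular K A B R \<and> normal_map K A B R"


section \<open>Hopf algebras\<close>

record ('k, 'h) hopf = "('k, 'h) module" +
  comult :: "'h \<Rightarrow> ('h \<times> 'h \<Rightarrow> 'k) set"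
  counit :: "'h \<Rightarrow> 'k"
  antipode :: "'h \<Rightarrow> 'h"

text \<open>
  \<open>sweedler K C U f h\<close> is the Sweedler expression \<open>f(h\<^sub>(\<^sub>1\<^sub>), h\<^sub>(\<^sub>2\<^sub>))\<close> with values in \<open>U\<close>.
\<close>

definition sweedler ::
  "('k, 'm) ring_scheme \<Rightarrow> ('k, 'c, 'n) hopf_scheme \<Rightarrow> ('k, 'u, 'q) module_scheme \<Rightarrow>
   ('c \<Rightarrow> 'c \<Rightarrow> 'u) \<Rightarrow> 'c \<Rightarrow> 'u"
  where "sweedler K C U f h = tensor_lift K U f (comult C h)"

locale coalgebra = module K C
  for K and C :: "('k, 'c, 'n) hopf_scheme" (structure) +
  assumes comult_linear: "comult C \<in> linear_maps K C (tensor K C C)"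
    and counit_linear: "counit C \<in> linear_maps K C (self_module K)"
    and coassoc: "x \<in> carrier C \<Longrightarrow>
      assoc_right K C C C (tensor_map K (tensor K C C) C (comult C) id (comult C x)) =
      tensor_map K C (tensor K C C) id (comult C) (comult C x)"
    and counit_left: "x \<in> carrier C \<Longrightarrow> sweedler K C C (\<lambda>y z. counit C y \<odot> z) x = x"
    and counit_right: "x \<in> carrier C \<Longrightarrow> sweedler K C C (\<lambda>y z. counit C z \<odot> y) x = x"

locale bialgebra = assoc_algebra K H + coalgebra K H
  for K and H :: "('k, 'h, 'n) hopf_scheme" (structure) +
  assumes comult_mult: "\<lbrakk>x \<in> carrier H; y \<in> carrier H\<rbrakk> \<Longrightarrow>
      comult H (x \<otimes> y) = comult H x \<otimes>\<^bsub>tensor_alg K H H\<^esub> comult H y"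
    and comult_one: "comult H \<one> = \<one>\<^bsub>tensor_alg K H H\<^esub>"
    and counit_mult: "\<lbrakk>x \<in> carrier H; y \<in> carrier H\<rbrakk> \<Longrightarrow>
      counit H (x \<otimes> y) = counit H x \<otimes>\<^bsub>K\<^esub> counit H y"
    and counit_one: "counit H \<one> = \<one>\<^bsub>K\<^esub>"

locale hopf_algebra = bialgebra K H
  for K and H :: "('k, 'h, 'n) hopf_scheme" (structure) +
  assumes antipode_linear: "antipode H \<in> linear_maps K H H"
    and antipode_left: "x \<in> carrier H \<Longrightarrow>
      sweedler K H H (\<lambda>y z. antipode H y \<otimes> z) x = counit H x \<odot> \<one>"
    and antipode_right: "x \<in> carrier H \<Longrightarrow>
      sweedler K H H (\<lambda>y z. y \<otimes> antipode H z) x = counit H x \<odot> \<one>"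

definition invertible_antipode :: "('k, 'h, 'n) hopf_scheme \<Rightarrow> bool"
  where "invertible_antipode H \<longleftrightarrow> bij_betw (antipode H) (carrier H) (carrier H)"


section \<open>Matched pairs of Hopf algebras\<close>

text \<open>
  The actions \<open>H \<otimes> B \<rightarrow> B\<close> and \<open>H \<otimes> B \<rightarrow> H\<close> are given by the corresponding bilinear maps.
  In both module coalgebra locales the last two assumptions say that the action is a morphism
  of coalgebras.
\<close>

locale left_module_coalgebra = H: bialgebra K H + C: coalgebra K C
  for K and H :: "('k, 'h, 'n) hopf_scheme" and C :: "('k, 'c, 'p) hopf_scheme" +
  fixes lact :: "'h \<Rightarrow> 'c \<Rightarrow> 'c" (infixr \<open>\<triangleright>\<close> 75)
  assumes lact_bilinear: "(\<triangleright>) \<in> bilinear_maps K H C C"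
    and lact_one: "c \<in> carrier C \<Longrightarrow> \<one>\<^bsub>H\<^esub> \<triangleright> c = c"
    and lact_mult: "\<lbrakk>h \<in> carrier H; g \<in> carrier H; c \<in> carrier C\<rbrakk> \<Longrightarrow>
      (h \<otimes>\<^bsub>H\<^esub> g) \<triangleright> c = h \<triangleright> (g \<triangleright> c)"
    and lact_comult: "\<lbrakk>h \<in> carrier H; c \<in> carrier C\<rbrakk> \<Longrightarrow>
      comult C (h \<triangleright> c) =
      sweedler K H (tensor K C C) (\<lambda>h1 h2.
        sweedler K C (tensor K C C) (\<lambda>c1 c2. pure K C C (h1 \<triangleright> c1) (h2 \<triangleright> c2)) c) h"
    and lact_counit: "\<lbrakk>h \<in> carrier H; c \<in> carrier C\<rbrakk> \<Longrightarrow>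
      counit C (h \<triangleright> c) = counit H h \<otimes>\<^bsub>K\<^esub> counit C c"

locale right_module_coalgebra = C: coalgebra K C + B: bialgebra K B
  for K and C :: "('k, 'c, 'n) hopf_scheme" and B :: "('k, 'b, 'p) hopf_scheme" +
  fixes ract :: "'c \<Rightarrow> 'b \<Rightarrow> 'c" (infixl \<open>\<triangleleft>\<close> 75)
  assumes ract_bilinear: "(\<triangleleft>) \<in> bilinear_maps K C B C"
    and ract_one: "c \<in> carrier C \<Longrightarrow> c \<triangleleft> \<one>\<^bsub>B\<^esub> = c"
    and ract_mult: "\<lbrakk>c \<in> carrier C; a \<in> carrier B; b \<in> carrier B\<rbrakk> \<Longrightarrow>
      c \<triangleleft> (a \<otimes>\<^bsub>B\<^esub> b) = (c \<triangleleft> a) \<triangleleft> b"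
    and ract_comult: "\<lbrakk>c \<in> carrier C; b \<in> carrier B\<rbrakk> \<Longrightarrow>
      comult C (c \<triangleleft> b) =
      sweedler K C (tensor K C C) (\<lambda>c1 c2.
        sweedler K B (tensor K C C) (\<lambda>b1 b2. pure K C C (c1 \<triangleleft> b1) (c2 \<triangleleft> b2)) b) c"
    and ract_counit: "\<lbrakk>c \<in> carrier C; b \<in> carrier B\<rbrakk> \<Longrightarrow>
      counit C (c \<triangleleft> b) = counit C c \<otimes>\<^bsub>K\<^esub> counit B b"

locale matched_pair_hopf =
  B: hopf_algebra K B + H: hopf_algebra K H +
  L: left_module_coalgebra K H B lact + R: right_module_coalgebra K H B ract
  for K and B :: "('k, 'b, 'n) hopf_scheme" and H :: "('k, 'h, 'p) hopf_scheme"
    and lact :: "'h \<Rightarrow> 'b \<Rightarrow> 'b" (infixr \<open>\<triangleright>\<close> 75)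
    and ract :: "'h \<Rightarrow> 'b \<Rightarrow> 'h" (infixl \<open>\<triangleleft>\<close> 75) +
  assumes lact_unit: "h \<in> carrier H \<Longrightarrow> h \<triangleright> \<one>\<^bsub>B\<^esub> = counit H h \<odot>\<^bsub>B\<^esub> \<one>\<^bsub>B\<^esub>"
    and lact_prod: "\<lbrakk>h \<in> carrier H; b \<in> carrier B; c \<in> carrier B\<rbrakk> \<Longrightarrow>
      h \<triangleright> (b \<otimes>\<^bsub>B\<^esub> c) =
      sweedler K H B (\<lambda>h1 h2. sweedler K B B (\<lambda>b1 b2.
        (h1 \<triangleright> b1) \<otimes>\<^bsub>B\<^esub> ((h2 \<triangleleft> b2) \<triangleright> c)) b) h"
    and ract_unit: "b \<in> carrier B \<Longrightarrow> \<one>\<^bsub>H\<^esub> \<triangleleft> b = counit B b \<odot>\<^bsub>H\<^esub> \<one>\<^bsub>H\<^esub>"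
    and ract_prod: "\<lbrakk>h \<in> carrier H; g \<in> carrier H; b \<in> carrier B\<rbrakk> \<Longrightarrow>
      (h \<otimes>\<^bsub>H\<^esub> g) \<triangleleft> b =
      sweedler K H H (\<lambda>g1 g2. sweedler K B H (\<lambda>b1 b2.
        (h \<triangleleft> (g1 \<triangleright> b1)) \<otimes>\<^bsub>H\<^esub> (g2 \<triangleleft> b2)) b) g"
    and act_exchange: "\<lbrakk>h \<in> carrier H; b \<in> carrier B\<rbrakk> \<Longrightarrow>
      sweedler K H (tensor K H B) (\<lambda>h1 h2. sweedler K B (tensor K H B) (\<lambda>b1 b2.
        pure K H B (h1 \<triangleleft> b1) (h2 \<triangleright> b2)) b) h =
      sweedler K H (tensor K H B) (\<lambda>h1 h2. sweedler K B (tensor K H B) (\<lambda>b1 b2.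
        pure K H B (h2 \<triangleleft> b2) (h1 \<triangleright> b1)) b) h"

text \<open>\<open>(b \<otimes> h)(c \<otimes> g) = b(h\<^sub>(\<^sub>1\<^sub>) \<triangleright> c\<^sub>(\<^sub>1\<^sub>)) \<otimes> (h\<^sub>(\<^sub>2\<^sub>) \<triangleleft> c\<^sub>(\<^sub>2\<^sub>))g\<close>\<close>

definition double_cross_mult ::
  "('k, 'm) ring_scheme \<Rightarrow> ('k, 'b, 'n) hopf_scheme \<Rightarrow> ('k, 'h, 'p) hopf_scheme \<Rightarrow>
   ('h \<Rightarrow> 'b \<Rightarrow> 'b) \<Rightarrow> ('h \<Rightarrow> 'b \<Rightarrow> 'h) \<Rightarrow>
   ('b \<times> 'h \<Rightarrow> 'k) set \<Rightarrow> ('b \<times> 'h \<Rightarrow> 'k) set \<Rightarrow> ('b \<times> 'h \<Rightarrow> 'k) set"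
  where "double_cross_mult K B H lact ract s t =
    (let T = tensor K B H in
      tensor_lift K T (\<lambda>b h. tensor_lift K T (\<lambda>c g.
        sweedler K H T (\<lambda>h1 h2. sweedler K B T (\<lambda>c1 c2.
          pure K B H (b \<otimes>\<^bsub>B\<^esub> lact h1 c1) (ract h2 c2 \<otimes>\<^bsub>H\<^esub> g)) c) h) t) s)"

definition double_crossproduct ::
  "('k, 'm) ring_scheme \<Rightarrow> ('k, 'b, 'n) hopf_scheme \<Rightarrow> ('k, 'h, 'p) hopf_scheme \<Rightarrow>
   ('h \<Rightarrow> 'b \<Rightarrow> 'b) \<Rightarrow> ('h \<Rightarrow> 'b \<Rightarrow> 'h) \<Rightarrow> ('k, ('b \<times> 'h \<Rightarrow> 'k) set) hopf"
  where "double_crossproduct K B H lact ract =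
    (let T = tensor K B H; TT = tensor K T T in
      \<lparr>carrier = carrier T,
       monoid.mult = double_cross_mult K B H lact ract,
       one = pure K B H \<one>\<^bsub>B\<^esub> \<one>\<^bsub>H\<^esub>,
       ring.zero = \<zero>\<^bsub>T\<^esub>,
       ring.add = (\<oplus>\<^bsub>T\<^esub>),
       module.smult = (\<odot>\<^bsub>T\<^esub>),
       comult = tensor_lift K TT (\<lambda>b h.
         sweedler K B TT (\<lambda>b1 b2. sweedler K H TT (\<lambda>h1 h2.
           pure K T T (pure K B H b1 h1) (pure K B H b2 h2)) h) b),
       counit = tensor_lift K (self_module K) (\<lambda>b h. counit B b \<otimes>\<^bsub>K\<^esub> counit H h),
       antipode = tensor_lift K T (\<lambda>b h.
         double_cross_mult K B H lact ract
           (pure K B H \<one>\<^bsub>B\<^esub> (antipode H h)) (pure K B H (antipode B b) \<one>\<^bsub>H\<^esub>))\<rparr>)"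


section \<open>Matched pairs of groups\<close>

text \<open>
  The actions are not required to be extensional, which is why \<^locale>\<open>group_action\<close> is not used.
\<close>

locale matched_pair_group = G: group G + L: group L
  for G :: "('g, 'n) monoid_scheme" and L :: "('l, 'p) monoid_scheme" +
  fixes lact :: "'l \<Rightarrow> 'g \<Rightarrow> 'g" (infixr \<open>\<triangleright>\<close> 75)
    and ract :: "'l \<Rightarrow> 'g \<Rightarrow> 'l" (infixl \<open>\<triangleleft>\<close> 75)
  assumes lact_closed: "\<lbrakk>x \<in> carrier L; g \<in> carrier G\<rbrakk> \<Longrightarrow> x \<triangleright> g \<in> carrier G"
    and lact_one: "g \<in> carrier G \<Longrightarrow> \<one>\<^bsub>L\<^esub> \<triangleright> g = g"
    and lact_mult: "\<lbrakk>x \<in> carrier L; y \<in> carrier L; g \<in> carrier G\<rbrakk> \<Longrightarrow>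
      (x \<otimes>\<^bsub>L\<^esub> y) \<triangleright> g = x \<triangleright> (y \<triangleright> g)"
    and ract_closed: "\<lbrakk>x \<in> carrier L; g \<in> carrier G\<rbrakk> \<Longrightarrow> x \<triangleleft> g \<in> carrier L"
    and ract_one: "x \<in> carrier L \<Longrightarrow> x \<triangleleft> \<one>\<^bsub>G\<^esub> = x"
    and ract_mult: "\<lbrakk>x \<in> carrier L; g \<in> carrier G; g' \<in> carrier G\<rbrakk> \<Longrightarrow>
      x \<triangleleft> (g \<otimes>\<^bsub>G\<^esub> g') = (x \<triangleleft> g) \<triangleleft> g'"
    and lact_prod: "\<lbrakk>x \<in> carrier L; g \<in> carrier G; g' \<in> carrier G\<rbrakk> \<Longrightarrow>
      x \<triangleright> (g \<otimes>\<^bsub>G\<^esub> g') = (x \<triangleright> g) \<otimes>\<^bsub>G\<^esub> ((x \<triangleleft> g) \<triangleright> g')"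
    and ract_prod: "\<lbrakk>x \<in> carrier L; x' \<in> carrier L; g \<in> carrier G\<rbrakk> \<Longrightarrow>
      (x \<otimes>\<^bsub>L\<^esub> x') \<triangleleft> g = (x \<triangleleft> (x' \<triangleright> g)) \<otimes>\<^bsub>L\<^esub> (x' \<triangleleft> g)"

definition bismash_product ::
  "('g, 'n) monoid_scheme \<Rightarrow> ('l, 'p) monoid_scheme \<Rightarrow> ('l \<Rightarrow> 'g \<Rightarrow> 'g) \<Rightarrow> ('l \<Rightarrow> 'g \<Rightarrow> 'l) \<Rightarrow>
   ('g \<times> 'l) monoid"
  where "bismash_product G L lact ract =
    \<lparr>carrier = carrier G \<times> carrier L,
     monoid.mult = (\<lambda>(g, x) (g', x'). (g \<otimes>\<^bsub>G\<^esub> lact x g', ract x g' \<otimes>\<^bsub>L\<^esub> x')),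
     one = (\<one>\<^bsub>G\<^esub>, \<one>\<^bsub>L\<^esub>)\<rparr>"

definition group_algebra ::
  "('k, 'm) ring_scheme \<Rightarrow> ('g, 'n) monoid_scheme \<Rightarrow> ('k, 'g \<Rightarrow> 'k) module"
  where "group_algebra K G =
    (free_module K (carrier G))
      \<lparr>monoid.mult := (\<lambda>f f' z.
          \<Oplus>\<^bsub>K\<^esub>p \<in> {(x, y). f x \<noteq> \<zero>\<^bsub>K\<^esub> \<and> f' y \<noteq> \<zero>\<^bsub>K\<^esub> \<and> x \<otimes>\<^bsub>G\<^esub> y = z}.
            f (fst p) \<otimes>\<^bsub>K\<^esub> f' (snd p)),
       one := delta K \<one>\<^bsub>G\<^esub>\<rparr>"

text \<open>
  The canonical linear map from the tensor product of the group algebras of \<open>G\<close> and \<open>L\<close> to the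
  functions on pairs, which sends \<open>g \<otimes> x\<close> to \<open>(g, x)\<close> for group elements \<open>g\<close> and \<open>x\<close>.
\<close>

definition group_algebra_pairing ::
  "('k, 'm) ring_scheme \<Rightarrow> ('g, 'n) monoid_scheme \<Rightarrow> ('l, 'p) monoid_scheme \<Rightarrow>
   (('g \<Rightarrow> 'k) \<times> ('l \<Rightarrow> 'k) \<Rightarrow> 'k) set \<Rightarrow> 'g \<times> 'l \<Rightarrow> 'k"
  where "group_algebra_pairing K G L =
    tensor_lift K (free_module K (carrier G \<times> carrier L)) (\<lambda>f f' (g, x). f g \<otimes>\<^bsub>K\<^esub> f' x)"

end

theory Submission
  imports Defs
begin

text \<open>
  In the double crossproduct every element is a sum of products \<open>bh\<close> with \<open>b\<close> in \<open>B\<close> and \<open>h\<close> in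
  \<open>H\<close>, and the multiplication is determined by how \<open>h\<close> moves past \<open>b\<close>:
  \<open>hb = (h\<^sub>1 \<triangleright> b\<^sub>1)(h\<^sub>2 \<triangleleft> b\<^sub>2)\<close>. So \<open>R(h \<otimes> b) = h\<^sub>1 \<triangleright> b\<^sub>1 \<otimes> h\<^sub>2 \<triangleleft> b\<^sub>2\<close> is the only candidate, and with
  it the two multiplications agree term by term.

  Quasitriangularity says that a product \<open>hg\<close> may be moved past \<open>b\<close>, and \<open>h\<close> past a product \<open>ab\<close>,
  one factor at a time. This follows from the product rules of a matched pair, the fact that the
  actions are morphisms of coalgebras, and coassociativity (\<open>cross_mult_left\<close>,
  \<open>cross_mult_right\<close>). Normality follows from the unit and counit laws.

  Bijectivity rests on the identity \<open>R(\<sigma>(R(h \<otimes> b))) = S(b) \<otimes> S(h)\<close> with \<open>\<sigma>(c \<otimes> g) = S(g) \<otimes> S(c)\<close>, which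
  expresses that the antipode of the double crossproduct maps \<open>hb\<close> to \<open>S(b)S(h)\<close>. When both antipodes
  are bijective, the right side is a bijective function of \<open>h \<otimes> b\<close>, so \<open>R\<close> is injective as the first
  and surjective as the last map of the composition. The identity itself
  (\<open>antipode_cross_eq_antipodes\<close>) is the uniqueness of convolution inverses: as functions of
  \<open>h \<otimes> b\<close>, the left side is a left inverse and the right side a right inverse of \<open>hb\<close>. The
  exchange law enters in the first of these. Products in the double crossproduct are handled as
  compositions of the right multiplications by elements of \<open>B\<close> and of \<open>H\<close>.

  For a matched pair of groups \<open>R\<close> maps the basis vector \<open>x \<otimes> g\<close> to \<open>(x \<triangleright> g) \<otimes> (x \<triangleleft> g)\<close>. All the maps are
  multilinear, so all claims can be checked on group elements, where they are the axioms of a matched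
  pair; bijectivity holds because \<open>(x, g) \<mapsto> (x \<triangleright> g, x \<triangleleft> g)\<close> is a bijection, by inversion in the bismash
  product (\<open>act_bij\<close>).

  Tensor products are cosets in a free module. They are made usable by the universal property
  (\<open>tensor_ext\<close>, \<open>tensor_lift_linear\<close>, \<open>tensor_lift_pure\<close>), and Sweedler expressions by laws for
  moving linear maps into them, interchanging them and regrouping them (\<open>sweedler_coassoc\<close>,
  \<open>sweedler2_coassoc\<close>).
\<close>

section \<open>Linear maps\<close>

lemma linear_mapsI:
  assumes "\<And>x. x \<in> carrier V \<Longrightarrow> f x \<in> carrier W"
    and "\<And>x y. \<lbrakk>x \<in> carrier V; y \<in> carrier V\<rbrakk> \<Longrightarrow> f (x \<oplus>\<^bsub>V\<^esub> y) = f x \<oplus>\<^bsub>W\<^esub> f y"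
    and "\<And>c x. \<lbrakk>c \<in> carrier K; x \<in> carrier V\<rbrakk> \<Longrightarrow> f (c \<odot>\<^bsub>V\<^esub> x) = c \<odot>\<^bsub>W\<^esub> f x"
  shows "f \<in> linear_maps K V W"
  using assms by (auto simp: linear_maps_def)

lemma lin_closed: "\<lbrakk>f \<in> linear_maps K V W; x \<in> carrier V\<rbrakk> \<Longrightarrow> f x \<in> carrier W"
  by (auto simp: linear_maps_def)

lemma lin_add:
  "\<lbrakk>f \<in> linear_maps K V W; x \<in> carrier V; y \<in> carrier V\<rbrakk> \<Longrightarrow> f (x \<oplus>\<^bsub>V\<^esub> y) = f x \<oplus>\<^bsub>W\<^esub> f y"
  by (auto simp: linear_maps_def)

lemma lin_smult:
  "\<lbrakk>f \<in> linear_maps K V W; c \<in> carrier K; x \<in> carrier V\<rbrakk> \<Longrightarrow> f (c \<odot>\<^bsub>V\<^esub> x) = c \<odot>\<^bsub>W\<^esub> f x"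
  by (auto simp: linear_maps_def)

lemma module_cring: "module K V \<Longrightarrow> cring K"
  by (simp add: module_def)

lemma module_abelian_group: "module K V \<Longrightarrow> abelian_group V"
  by (simp add: module_def)

lemma lin_zero:
  assumes "module K V" "module K W" "f \<in> linear_maps K V W"
  shows "f \<zero>\<^bsub>V\<^esub> = \<zero>\<^bsub>W\<^esub>"
proof -
  interpret V: module K V by fact
  interpret W: module K W by fact
  have "f (\<zero>\<^bsub>K\<^esub> \<odot>\<^bsub>V\<^esub> \<zero>\<^bsub>V\<^esub>) = \<zero>\<^bsub>K\<^esub> \<odot>\<^bsub>W\<^esub> f \<zero>\<^bsub>V\<^esub>"
    using assms(3) by (intro lin_smult) auto
  then show ?thesis using lin_closed[OF assms(3), of "\<zero>\<^bsub>V\<^esub>"] by simp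
qed

lemma lin_id: "(\<lambda>x. x) \<in> linear_maps K V V"
  by (auto simp: linear_maps_def)

lemma lin_compose:
  "\<lbrakk>f \<in> linear_maps K V W; g \<in> linear_maps K U V\<rbrakk> \<Longrightarrow> (\<lambda>x. f (g x)) \<in> linear_maps K U W"
  by (auto simp: linear_maps_def Pi_def)

lemma lin_scale:
  assumes "module K W" "c \<in> carrier K" "f \<in> linear_maps K V W"
  shows "(\<lambda>x. c \<odot>\<^bsub>W\<^esub> f x) \<in> linear_maps K V W"
proof -
  interpret W: module K W by fact
  show ?thesis
    using assms(2,3)
    by (intro linear_mapsI)
       (auto simp: lin_closed[OF assms(3)] lin_add[OF assms(3)]
          lin_smult[OF assms(3)] W.smult_r_distr W.smult_assoc1[symmetric] W.R.m_comm)
qed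

lemma linear_maps_finsum_param:
  assumes "module K W" "\<And>i. i \<in> I \<Longrightarrow> (\<lambda>x. g x i) \<in> linear_maps K V W" "finite I"
  shows "(\<lambda>x. \<Oplus>\<^bsub>W\<^esub>i \<in> I. g x i) \<in> linear_maps K V W"
proof -
  interpret W: module K W by fact
  have cl: "g x i \<in> carrier W" if "i \<in> I" "x \<in> carrier V" for i x
    using lin_closed[OF assms(2)[OF that(1)] that(2)] .
  show ?thesis
  proof (rule linear_mapsI)
    fix x y assume "x \<in> carrier V" "y \<in> carrier V"
    then have "(\<Oplus>\<^bsub>W\<^esub>i \<in> I. g (x \<oplus>\<^bsub>V\<^esub> y) i) = (\<Oplus>\<^bsub>W\<^esub>i \<in> I. g x i \<oplus>\<^bsub>W\<^esub> g y i)"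
      using cl by (intro W.finsum_cong') (auto simp: lin_add[OF assms(2)])
    also have "\<dots> = (\<Oplus>\<^bsub>W\<^esub>i \<in> I. g x i) \<oplus>\<^bsub>W\<^esub> (\<Oplus>\<^bsub>W\<^esub>i \<in> I. g y i)"
      using cl \<open>x \<in> carrier V\<close> \<open>y \<in> carrier V\<close> by (intro W.finsum_addf) auto
    finally show "(\<Oplus>\<^bsub>W\<^esub>i \<in> I. g (x \<oplus>\<^bsub>V\<^esub> y) i) = (\<Oplus>\<^bsub>W\<^esub>i \<in> I. g x i) \<oplus>\<^bsub>W\<^esub> (\<Oplus>\<^bsub>W\<^esub>i \<in> I. g y i)" .
  next
    fix c x assume "c \<in> carrier K" "x \<in> carrier V"
    then show "(\<Oplus>\<^bsub>W\<^esub>i \<in> I. g (c \<odot>\<^bsub>V\<^esub> x) i) = c \<odot>\<^bsub>W\<^esub> (\<Oplus>\<^bsub>W\<^esub>i \<in> I. g x i)"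
      using cl lin_smult[OF assms(2)] assms(3)
      by (subst W.finsum_smult_ldistr) (auto intro!: W.finsum_cong')
  qed (use cl in auto)
qed

lemma bilinear_mapsI:
  assumes "\<And>v. v \<in> carrier V \<Longrightarrow> (\<lambda>w. f v w) \<in> linear_maps K W U"
    and "\<And>w. w \<in> carrier W \<Longrightarrow> (\<lambda>v. f v w) \<in> linear_maps K V U"
  shows "f \<in> bilinear_maps K V W U"
  using assms by (auto simp: bilinear_maps_def)

lemma bilin_right:
  "\<lbrakk>f \<in> bilinear_maps K V W U; v \<in> carrier V; g \<in> linear_maps K Y W\<rbrakk> \<Longrightarrow>
    (\<lambda>x. f v (g x)) \<in> linear_maps K Y U"
  unfolding bilinear_maps_def by (auto intro: lin_compose)

lemma bilin_left:
  "\<lbrakk>f \<in> bilinear_maps K V W U; w \<in> carrier W; g \<in> linear_maps K Y V\<rbrakk> \<Longrightarrow>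
    (\<lambda>x. f (g x) w) \<in> linear_maps K Y U"
  unfolding bilinear_maps_def
  using lin_compose[of "\<lambda>v. f v w" K V U g Y] by auto

lemma bilin_closed:
  "\<lbrakk>f \<in> bilinear_maps K V W U; v \<in> carrier V; w \<in> carrier W\<rbrakk> \<Longrightarrow> f v w \<in> carrier U"
  unfolding bilinear_maps_def by (auto intro: lin_closed)

section \<open>Free modules\<close>

text \<open>
  The locale of modules constrains only the carrier and the additive and scalar operations, so a
  module structure carries over to records with other multiplications, such as group algebras.
\<close>

lemma module_if_same_operations:
  fixes V V' :: "('k, 'v, 'n) module_scheme"
  assumes "module K V" "carrier V' = carrier V" "\<zero>\<^bsub>V'\<^esub> = \<zero>\<^bsub>V\<^esub>" "(\<oplus>\<^bsub>V'\<^esub>) = (\<oplus>\<^bsub>V\<^esub>)"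
    "(\<odot>\<^bsub>V'\<^esub>) = (\<odot>\<^bsub>V\<^esub>)"
  shows "module K V'"
proof -
  have "add_monoid V' = add_monoid V" using assms by simp
  then have "abelian_group V'" using assms(1)
    by (metis abelian_group_def abelian_group_axioms_def abelian_monoid_def module_abelian_group)
  then show ?thesis using assms unfolding module_def module_axioms_def by simp
qed

lemma free_module_sel [simp]:
  "carrier (free_module K S) = {f. (\<forall>s \<in> S. f s \<in> carrier K) \<and> (\<forall>s. s \<notin> S \<longrightarrow> f s = \<zero>\<^bsub>K\<^esub>) \<and>
                   finite {s. f s \<noteq> \<zero>\<^bsub>K\<^esub>}}"
  "\<zero>\<^bsub>free_module K S\<^esub> = (\<lambda>s. \<zero>\<^bsub>K\<^esub>)"
  "f \<oplus>\<^bsub>free_module K S\<^esub> g = (\<lambda>s. f s \<oplus>\<^bsub>K\<^esub> g s)"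
  "c \<odot>\<^bsub>free_module K S\<^esub> f = (\<lambda>s. c \<otimes>\<^bsub>K\<^esub> f s)"
  by (simp_all add: free_module_def)

lemma free_module_in_carrier:
  "\<lbrakk>cring K; f \<in> carrier (free_module K S)\<rbrakk> \<Longrightarrow> f s \<in> carrier K"
  by (cases "s \<in> S") (auto simp: cring_def ring.ring_simprules)

lemma free_moduleI:
  assumes "\<And>s. s \<in> S \<Longrightarrow> f s \<in> carrier K" "\<And>s. f s \<noteq> \<zero>\<^bsub>K\<^esub> \<Longrightarrow> s \<in> T" "finite T" "T \<subseteq> S"
  shows "f \<in> carrier (free_module K S)"
proof -
  have "finite {s. f s \<noteq> \<zero>\<^bsub>K\<^esub>}" by (rule finite_subset[OF _ assms(3)]) (use assms(2) in auto)
  then show ?thesis using assms by auto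
qed

lemma free_module_finite_support:
  "f \<in> carrier (free_module K S) \<Longrightarrow> finite {s. f s \<noteq> \<zero>\<^bsub>K\<^esub>}"
  "f \<in> carrier (free_module K S) \<Longrightarrow> {s. f s \<noteq> \<zero>\<^bsub>K\<^esub>} \<subseteq> S"
  by auto

lemma module_free_module:
  assumes "cring K" shows "module K (free_module K S)"
proof -
  interpret K: cring K by fact
  let ?F = "free_module K S" and ?C = "carrier (free_module K S)"
  note val = free_module_in_carrier[OF assms]
  note supp = free_module_finite_support
  have add: "(\<lambda>s. f s \<oplus>\<^bsub>K\<^esub> g s) \<in> ?C" if "f \<in> ?C" "g \<in> ?C" for f g
    by (rule free_moduleI[of _ _ _ "{s. f s \<noteq> \<zero>\<^bsub>K\<^esub>} \<union> {s. g s \<noteq> \<zero>\<^bsub>K\<^esub>}"])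
       (use val[OF that(1)] val[OF that(2)] supp[OF that(1)] supp[OF that(2)] in auto)
  have smult: "(\<lambda>s. c \<otimes>\<^bsub>K\<^esub> f s) \<in> ?C" if "c \<in> carrier K" "f \<in> ?C" for c f
    by (rule free_moduleI[of _ _ _ "{s. f s \<noteq> \<zero>\<^bsub>K\<^esub>}"])
       (use val[OF that(2)] supp[OF that(2)] that(1) in auto)
  have "abelian_group ?F"
  proof (rule abelian_groupI)
    fix f assume f: "f \<in> ?C"
    have "(\<lambda>s. \<ominus>\<^bsub>K\<^esub> \<one>\<^bsub>K\<^esub> \<otimes>\<^bsub>K\<^esub> f s) \<in> ?C" using f by (intro smult) simp_all
    moreover have "(\<lambda>s. \<ominus>\<^bsub>K\<^esub> \<one>\<^bsub>K\<^esub> \<otimes>\<^bsub>K\<^esub> f s) \<oplus>\<^bsub>?F\<^esub> f = \<zero>\<^bsub>?F\<^esub>"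
      unfolding free_module_sel(2,3) using val[OF f] by (intro ext) (simp add: K.l_neg K.l_minus)
    ultimately show "\<exists>g \<in> ?C. g \<oplus>\<^bsub>?F\<^esub> f = \<zero>\<^bsub>?F\<^esub>" by blast
  next
    show "f \<oplus>\<^bsub>?F\<^esub> g \<in> ?C" if "f \<in> ?C" "g \<in> ?C" for f g
      unfolding free_module_sel(3) by (rule add[OF that])
    show "f \<oplus>\<^bsub>?F\<^esub> g = g \<oplus>\<^bsub>?F\<^esub> f" if "f \<in> ?C" "g \<in> ?C" for f g
      unfolding free_module_sel(3) using val[OF that(1)] val[OF that(2)] by (intro ext) (rule K.a_comm)
    show "\<zero>\<^bsub>?F\<^esub> \<oplus>\<^bsub>?F\<^esub> f = f" if "f \<in> ?C" for f
      unfolding free_module_sel(2,3) using val[OF that] by (intro ext) simp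
    show "f \<oplus>\<^bsub>?F\<^esub> g \<oplus>\<^bsub>?F\<^esub> h =
        f \<oplus>\<^bsub>?F\<^esub> (g \<oplus>\<^bsub>?F\<^esub> h)" if "f \<in> ?C" "g \<in> ?C" "h \<in> ?C" for f g h
      unfolding free_module_sel(3) using val[OF that(1)] val[OF that(2)] val[OF that(3)]
      by (intro ext) (rule K.a_assoc)
    show "\<zero>\<^bsub>?F\<^esub> \<in> ?C" by simp
  qed
  then show ?thesis
  proof (rule moduleI[OF assms])
    show "a \<odot>\<^bsub>?F\<^esub> f \<in> ?C" if "a \<in> carrier K" "f \<in> ?C" for a f
      unfolding free_module_sel(4) by (rule smult[OF that])
    show "(a \<oplus>\<^bsub>K\<^esub> b) \<odot>\<^bsub>?F\<^esub> f =
        a \<odot>\<^bsub>?F\<^esub> f \<oplus>\<^bsub>?F\<^esub> b \<odot>\<^bsub>?F\<^esub> f"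
      if "a \<in> carrier K" "b \<in> carrier K" "f \<in> ?C" for a b f
      unfolding free_module_sel(3,4) using that(1,2) val[OF that(3)]
      by (intro ext) (simp add: K.l_distr)
    show "a \<odot>\<^bsub>?F\<^esub> (f \<oplus>\<^bsub>?F\<^esub> g) =
        a \<odot>\<^bsub>?F\<^esub> f \<oplus>\<^bsub>?F\<^esub> a \<odot>\<^bsub>?F\<^esub> g"
      if "a \<in> carrier K" "f \<in> ?C" "g \<in> ?C" for a f g
      unfolding free_module_sel(3,4) using that(1) val[OF that(2)] val[OF that(3)]
      by (intro ext) (simp add: K.r_distr)
    show "(a \<otimes>\<^bsub>K\<^esub> b) \<odot>\<^bsub>?F\<^esub> f = a \<odot>\<^bsub>?F\<^esub> (b \<odot>\<^bsub>?F\<^esub> f)"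
      if "a \<in> carrier K" "b \<in> carrier K" "f \<in> ?C" for a b f
      unfolding free_module_sel(4) using that(1,2) val[OF that(3)]
      by (intro ext) (simp add: K.m_assoc)
    show "\<one>\<^bsub>K\<^esub> \<odot>\<^bsub>?F\<^esub> f = f" if "f \<in> ?C" for f
      unfolding free_module_sel(4) using val[OF that] by (intro ext) simp
  qed
qed

lemma delta_closed [simp]: "\<lbrakk>cring K; s \<in> S\<rbrakk> \<Longrightarrow> delta K s \<in> carrier (free_module K S)"
proof -
  assume K: "cring K" and s: "s \<in> S"
  interpret cring K by fact
  have "{t. delta K s t \<noteq> \<zero>\<^bsub>K\<^esub>} \<subseteq> {s}" by (auto simp: delta_def)
  then have "finite {t. delta K s t \<noteq> \<zero>\<^bsub>K\<^esub>}" by (rule finite_subset) simp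
  then show ?thesis using s by (auto simp: delta_def)
qed

text \<open>
  Every element is a finite linear combination of basis vectors; the induction is over the support.
\<close>

lemma free_module_induct:
  fixes K :: "('k, 'm) ring_scheme" and p :: "'s \<Rightarrow> 'k"
  assumes "cring K" "p \<in> carrier (free_module K S)"
    and zero: "P (\<lambda>s. \<zero>\<^bsub>K\<^esub>)"
    and step: "\<And>(p :: 's \<Rightarrow> 'k) c s. \<lbrakk>p \<in> carrier (free_module K S); c \<in> carrier K; s \<in> S; P p\<rbrakk> \<Longrightarrow>
      P (p \<oplus>\<^bsub>free_module K S\<^esub> (c \<odot>\<^bsub>free_module K S\<^esub> delta K s))"
  shows "P p"
proof -
  let ?F = "free_module K S"
  interpret K: cring K by fact
  have "\<forall>p. p \<in> carrier ?F \<longrightarrow> {s. p s \<noteq> \<zero>\<^bsub>K\<^esub>} \<subseteq> T \<longrightarrow> P p" if "finite T" for T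
    using that
  proof (induction T)
    case empty
    show ?case
    proof (intro allI impI)
      fix p :: "'s \<Rightarrow> 'k" assume "{s. p s \<noteq> \<zero>\<^bsub>K\<^esub>} \<subseteq> {}"
      then have "p = (\<lambda>s. \<zero>\<^bsub>K\<^esub>)" by auto
      then show "P p" using zero by simp
    qed
  next
    case (insert t T)
    show ?case
    proof (intro allI impI)
      fix p assume p: "p \<in> carrier ?F" and sub: "{s. p s \<noteq> \<zero>\<^bsub>K\<^esub>} \<subseteq> insert t T"
      show "P p"
      proof (cases "p t = \<zero>\<^bsub>K\<^esub>")
        case True
        then have "{s. p s \<noteq> \<zero>\<^bsub>K\<^esub>} \<subseteq> T" using sub by auto
        then show ?thesis using insert.IH p by blast
      next
        case False
        then have t: "t \<in> S" using p by auto
        let ?q = "p(t := \<zero>\<^bsub>K\<^esub>)"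
        have "{s. ?q s \<noteq> \<zero>\<^bsub>K\<^esub>} \<subseteq> {s. p s \<noteq> \<zero>\<^bsub>K\<^esub>}" by auto
        then have "finite {s. ?q s \<noteq> \<zero>\<^bsub>K\<^esub>}" by (rule finite_subset) (use p in auto)
        then have q: "?q \<in> carrier ?F" using p t by auto
        have "{s. ?q s \<noteq> \<zero>\<^bsub>K\<^esub>} \<subseteq> T" using sub by auto
        then have "P ?q" using insert.IH q by blast
        then have "P (?q \<oplus>\<^bsub>?F\<^esub> (p t \<odot>\<^bsub>?F\<^esub> delta K t))"
          using q t p by (intro step) auto
        also have "?q \<oplus>\<^bsub>?F\<^esub> (p t \<odot>\<^bsub>?F\<^esub> delta K t) = p"
          using free_module_in_carrier[OF assms(1) p]
          by (auto simp: fun_eq_iff delta_def simp del: free_module_sel(1))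
        finally show ?thesis .
      qed
    qed
  qed
  from this[of "{s. p s \<noteq> \<zero>\<^bsub>K\<^esub>}"] assms(2) show ?thesis by simp
qed

lemma free_module_ext:
  assumes "module K U" "f \<in> linear_maps K (free_module K S) U" "g \<in> linear_maps K (free_module K S) U"
    and "\<And>s. s \<in> S \<Longrightarrow> f (delta K s) = g (delta K s)" "p \<in> carrier (free_module K S)"
  shows "f p = g p"
proof -
  let ?F = "free_module K S"
  have K: "cring K" using module_cring assms(1) .
  interpret F: module K "?F" using module_free_module[OF K] .
  show ?thesis
  proof (rule free_module_induct[OF K assms(5), of "\<lambda>p. f p = g p"])
    show "f (\<lambda>s. \<zero>\<^bsub>K\<^esub>) = g (\<lambda>s. \<zero>\<^bsub>K\<^esub>)"
      using lin_zero[OF F.module_axioms assms(1,2)] lin_zero[OF F.module_axioms assms(1,3)]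
      by simp
  next
    fix p c s assume "p \<in> carrier ?F" "c \<in> carrier K" "s \<in> S" "f p = g p"
    note p = this
    have d: "delta K s \<in> carrier ?F" using delta_closed[OF K p(3)] .
    have cd: "c \<odot>\<^bsub>?F\<^esub> delta K s \<in> carrier ?F"
      by (rule F.smult_closed[OF p(2) d])
    show "f (p \<oplus>\<^bsub>?F\<^esub> (c \<odot>\<^bsub>?F\<^esub> delta K s)) =
      g (p \<oplus>\<^bsub>?F\<^esub> (c \<odot>\<^bsub>?F\<^esub> delta K s))"
      unfolding lin_add[OF assms(2) p(1) cd] lin_add[OF assms(3) p(1) cd]
        lin_smult[OF assms(2) p(2) d] lin_smult[OF assms(3) p(2) d] p(4)
        assms(4)[OF p(3)] ..
  qed
qed

text \<open>
  The linear extension of \<open>\<phi>\<close> from the basis. The map induced by a bilinear map on a tensor product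
  is this sum, taken at a representative of the coset.
\<close>

definition free_lift ::
  "('k, 'm) ring_scheme \<Rightarrow> ('k, 'u, 'q) module_scheme \<Rightarrow> ('s \<Rightarrow> 'u) \<Rightarrow> ('s \<Rightarrow> 'k) \<Rightarrow> 'u"
  where "free_lift K U \<phi> p = (\<Oplus>\<^bsub>U\<^esub>s \<in> {s. p s \<noteq> \<zero>\<^bsub>K\<^esub>}. p s \<odot>\<^bsub>U\<^esub> \<phi> s)"

text \<open>
  The sum over the support depends on \<open>p\<close>; linearity needs one index set for several elements.
\<close>

lemma free_lift_superset:
  assumes "module K U" "\<phi> \<in> S \<rightarrow> carrier U" "p \<in> carrier (free_module K S)"
    "{s. p s \<noteq> \<zero>\<^bsub>K\<^esub>} \<subseteq> T" "T \<subseteq> S" "finite T"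
  shows "free_lift K U \<phi> p = (\<Oplus>\<^bsub>U\<^esub>s \<in> T. p s \<odot>\<^bsub>U\<^esub> \<phi> s)"
proof -
  interpret U: module K U by fact
  note [simp] = free_module_in_carrier[OF U.R.is_cring assms(3)]
  show ?thesis unfolding free_lift_def
    using assms(2,4-6)
    by (intro U.add.finprod_mono_neutral_cong_left) (auto simp: subset_iff Pi_iff)
qed

lemma free_lift_linear:
  assumes "module K U" "\<phi> \<in> S \<rightarrow> carrier U"
  shows "free_lift K U \<phi> \<in> linear_maps K (free_module K S) U"
proof -
  let ?F = "free_module K S"
  interpret U: module K U by fact
  interpret F: module K "?F" using module_free_module[OF U.R.is_cring] .
  note cl = free_module_in_carrier[OF U.R.is_cring]
  have S: "s \<in> S" if "p \<in> carrier ?F" "p s \<noteq> \<zero>\<^bsub>K\<^esub>" for p s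
    using that by auto
  have fin: "finite {s. p s \<noteq> \<zero>\<^bsub>K\<^esub>}" if "p \<in> carrier ?F" for p using that by simp
  have \<phi>: "\<phi> s \<in> carrier U" if "s \<in> S" for s using that assms(2) by auto
  show ?thesis
  proof (rule linear_mapsI)
    fix p assume p: "p \<in> carrier ?F"
    show "free_lift K U \<phi> p \<in> carrier U" unfolding free_lift_def
      using S[OF p] cl[OF p] \<phi> by (intro U.finsum_closed) auto
  next
    fix p q assume p: "p \<in> carrier ?F" and q: "q \<in> carrier ?F"
    let ?T = "{s. p s \<noteq> \<zero>\<^bsub>K\<^esub>} \<union> {s. q s \<noteq> \<zero>\<^bsub>K\<^esub>}"
    have T: "?T \<subseteq> S" "finite ?T" using S[OF p] S[OF q] fin[OF p] fin[OF q] by auto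
    have sub: "{s. (p \<oplus>\<^bsub>?F\<^esub> q) s \<noteq> \<zero>\<^bsub>K\<^esub>} \<subseteq> ?T" by auto
    have "free_lift K U \<phi> (p \<oplus>\<^bsub>?F\<^esub> q) =
        (\<Oplus>\<^bsub>U\<^esub>s \<in> ?T. (p \<oplus>\<^bsub>?F\<^esub> q) s \<odot>\<^bsub>U\<^esub> \<phi> s)"
      by (rule free_lift_superset[OF assms F.a_closed[OF p q] sub T])
    also have "\<dots> = (\<Oplus>\<^bsub>U\<^esub>s \<in> ?T. p s \<odot>\<^bsub>U\<^esub> \<phi> s \<oplus>\<^bsub>U\<^esub> q s \<odot>\<^bsub>U\<^esub> \<phi> s)"
      using T cl[OF p] cl[OF q] \<phi> by (intro U.finsum_cong') (auto simp: U.smult_l_distr)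
    also have "\<dots> = (\<Oplus>\<^bsub>U\<^esub>s \<in> ?T. p s \<odot>\<^bsub>U\<^esub> \<phi> s) \<oplus>\<^bsub>U\<^esub> (\<Oplus>\<^bsub>U\<^esub>s \<in> ?T. q s \<odot>\<^bsub>U\<^esub> \<phi> s)"
      using T cl[OF p] cl[OF q] \<phi> by (intro U.finsum_addf) auto
    finally show "free_lift K U \<phi> (p \<oplus>\<^bsub>?F\<^esub> q) = free_lift K U \<phi> p \<oplus>\<^bsub>U\<^esub> free_lift K U \<phi> q"
      by (simp only: free_lift_superset[OF assms p _ T] free_lift_superset[OF assms q _ T] Un_upper1 Un_upper2)
  next
    fix c p assume c: "c \<in> carrier K" and p: "p \<in> carrier ?F"
    let ?T = "{s. p s \<noteq> \<zero>\<^bsub>K\<^esub>}"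
    have T: "?T \<subseteq> S" "finite ?T" using S[OF p] fin[OF p] by auto
    have sub: "{s. (c \<odot>\<^bsub>?F\<^esub> p) s \<noteq> \<zero>\<^bsub>K\<^esub>} \<subseteq> ?T" using c by auto
    have "free_lift K U \<phi> (c \<odot>\<^bsub>?F\<^esub> p) =
        (\<Oplus>\<^bsub>U\<^esub>s \<in> ?T. (c \<odot>\<^bsub>?F\<^esub> p) s \<odot>\<^bsub>U\<^esub> \<phi> s)"
      by (rule free_lift_superset[OF assms F.smult_closed[OF c p] sub T])
    also have "\<dots> = (\<Oplus>\<^bsub>U\<^esub>s \<in> ?T. c \<odot>\<^bsub>U\<^esub> (p s \<odot>\<^bsub>U\<^esub> \<phi> s))"
      using T cl[OF p] \<phi> c by (intro U.finsum_cong') (auto simp: U.smult_assoc1)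
    also have "\<dots> = c \<odot>\<^bsub>U\<^esub> (\<Oplus>\<^bsub>U\<^esub>s \<in> ?T. p s \<odot>\<^bsub>U\<^esub> \<phi> s)"
      using T cl[OF p] \<phi> c by (intro U.finsum_smult_ldistr[symmetric]) auto
    finally show "free_lift K U \<phi> (c \<odot>\<^bsub>?F\<^esub> p) = c \<odot>\<^bsub>U\<^esub> free_lift K U \<phi> p"
      by (simp only: free_lift_def)
  qed
qed

lemma free_lift_delta:
  assumes "module K U" "\<phi> s \<in> carrier U"
  shows "free_lift K U \<phi> (delta K s) = \<phi> s"
proof -
  interpret U: module K U by fact
  have "free_lift K U \<phi> (delta K s) = (\<Oplus>\<^bsub>U\<^esub>t \<in> {s}. delta K s t \<odot>\<^bsub>U\<^esub> \<phi> t)"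
    by (rule free_lift_superset[where S = "{s}"]) (use assms in \<open>auto simp: delta_def\<close>)
  then show ?thesis using assms by (simp add: delta_def)
qed

section \<open>Tensor products\<close>

lemma tensor_rel_submodule:
  assumes "module K V" "module K W"
  shows "submodule (tensor_rel K V W) K (free_module K (carrier V \<times> carrier W))"
proof -
  interpret V: module K V by fact
  interpret W: module K W by fact
  let ?F = "free_module K (carrier V \<times> carrier W)"
  interpret F: module K ?F using module_free_module[OF V.R.is_cring] .
  have gens: "tensor_gens K V W \<subseteq> carrier ?F"
    unfolding tensor_gens_def Let_def using V.R.is_cring
    by (auto intro!: F.minus_closed F.a_closed F.smult_closed delta_closed simp del: free_module_sel)
  show ?thesis unfolding tensor_rel_def
  proof (rule F.submoduleI)
    show "\<Inter> {N. submodule N K ?F \<and> tensor_gens K V W \<subseteq> N} \<subseteq> carrier ?F"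
      using F.carrier_is_submodule gens by (intro Inter_lower) simp
    show "\<zero>\<^bsub>?F\<^esub> \<in> \<Inter> {N. submodule N K ?F \<and> tensor_gens K V W \<subseteq> N}"
      using subgroup.one_closed[OF submodule.axioms(1), of _ K ?F] by simp
  next
    fix a assume a: "a \<in> \<Inter> {N. submodule N K ?F \<and> tensor_gens K V W \<subseteq> N}"
    show "\<ominus>\<^bsub>?F\<^esub> a \<in> \<Inter> {N. submodule N K ?F \<and> tensor_gens K V W \<subseteq> N}"
      by (rule InterI, rule F.submoduleE(3)) (use a in auto)
  next
    fix a b assume a: "a \<in> \<Inter> {N. submodule N K ?F \<and> tensor_gens K V W \<subseteq> N}"
      and b: "b \<in> \<Inter> {N. submodule N K ?F \<and> tensor_gens K V W \<subseteq> N}"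
    show "a \<oplus>\<^bsub>?F\<^esub> b \<in> \<Inter> {N. submodule N K ?F \<and> tensor_gens K V W \<subseteq> N}"
      by (rule InterI, rule F.submoduleE(5)) (use a b in auto)
  next
    fix c a assume c: "c \<in> carrier K" and a: "a \<in> \<Inter> {N. submodule N K ?F \<and> tensor_gens K V W \<subseteq> N}"
    show "c \<odot>\<^bsub>?F\<^esub> a \<in> \<Inter> {N. submodule N K ?F \<and> tensor_gens K V W \<subseteq> N}"
      by (rule InterI, rule F.submoduleE(4)) (use a c in auto)
  qed
qed

lemma tensor_gens_subset: "tensor_gens K V W \<subseteq> tensor_rel K V W"
  unfolding tensor_rel_def by auto

lemma tensor_sel [simp]:
  "carrier (tensor K V W) =
     a_rcosets\<^bsub>free_module K (carrier V \<times> carrier W)\<^esub> (tensor_rel K V W)"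
  "\<zero>\<^bsub>tensor K V W\<^esub> = tensor_rel K V W"
  "s \<oplus>\<^bsub>tensor K V W\<^esub> t = s <+>\<^bsub>free_module K (carrier V \<times> carrier W)\<^esub> t"
  "c \<odot>\<^bsub>tensor K V W\<^esub> s = (\<Union>x \<in> s. tensor_rel K V W
     +>\<^bsub>free_module K (carrier V \<times> carrier W)\<^esub> (c \<odot>\<^bsub>free_module K (carrier V \<times> carrier W)\<^esub> x))"
  by (simp_all add: tensor_def Let_def)

text \<open>The quotient map from the free module on the pairs to the tensor product.\<close>

definition tensor_class ::
  "('k, 'm) ring_scheme \<Rightarrow> ('k, 'v, 'n) module_scheme \<Rightarrow> ('k, 'w, 'p) module_scheme \<Rightarrow>
   ('v \<times> 'w \<Rightarrow> 'k) \<Rightarrow> ('v \<times> 'w \<Rightarrow> 'k) set"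
  where "tensor_class K V W p =
    tensor_rel K V W +>\<^bsub>free_module K (carrier V \<times> carrier W)\<^esub> p"

context
  fixes K :: "('k, 'm) ring_scheme" and V :: "('k, 'v, 'n) module_scheme"
    and W :: "('k, 'w, 'p) module_scheme"
  assumes V: "module K V" and W: "module K W"
begin

interpretation V: module K V by (fact V)
interpretation W: module K W by (fact W)

private abbreviation (input) "F \<equiv> free_module K (carrier V \<times> carrier W)"
private abbreviation (input) "N \<equiv> tensor_rel K V W"

interpretation F: module K F using module_free_module[OF V.R.is_cring] .

private lemma N_sub: "submodule N K F" by (rule tensor_rel_submodule[OF V W])

private lemma N_subgroup: "subgroup N (add_monoid F)" using N_sub submodule.axioms(1) by blast

private lemma N_carrier: "N \<subseteq> carrier F" using F.submoduleE(1)[OF N_sub] .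

interpretation N: abelian_subgroup N F
  by (intro abelian_subgroupI3 additive_subgroup.intro N_subgroup
      module_abelian_group[OF F.module_axioms])

lemma tensor_class_add:
  "\<lbrakk>p \<in> carrier F; q \<in> carrier F\<rbrakk> \<Longrightarrow>
    tensor_class K V W p \<oplus>\<^bsub>tensor K V W\<^esub> tensor_class K V W q = tensor_class K V W (p \<oplus>\<^bsub>F\<^esub> q)"
  unfolding tensor_class_def tensor_sel by (rule N.a_rcos_sum)

lemma tensor_class_memD:
  assumes "p \<in> carrier F" "x \<in> tensor_class K V W p"
  shows "x \<in> carrier F" "tensor_class K V W x = tensor_class K V W p" "\<exists>n \<in> N. x = n \<oplus>\<^bsub>F\<^esub> p"
proof -
  show "x \<in> carrier F"
    using subsetD[OF F.a_r_coset_subset_G[OF N_carrier assms(1)]] assms(2)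
    unfolding tensor_class_def .
  show "tensor_class K V W x = tensor_class K V W p"
    using F.a_repr_independence[OF assms(2)[unfolded tensor_class_def] assms(1) N_subgroup]
    unfolding tensor_class_def by (rule sym)
  show "\<exists>n \<in> N. x = n \<oplus>\<^bsub>F\<^esub> p" using assms(2) unfolding tensor_class_def a_r_coset_def'
    by (simp only: UN_iff singleton_iff)
qed

lemma tensor_class_self: "p \<in> carrier F \<Longrightarrow> p \<in> tensor_class K V W p"
  unfolding tensor_class_def by (rule N.a_rcos_self)

lemma tensor_class_smult:
  assumes c: "c \<in> carrier K" and p: "p \<in> carrier F"
  shows "c \<odot>\<^bsub>tensor K V W\<^esub> tensor_class K V W p = tensor_class K V W (c \<odot>\<^bsub>F\<^esub> p)"
proof -
  have "tensor_class K V W (c \<odot>\<^bsub>F\<^esub> x) = tensor_class K V W (c \<odot>\<^bsub>F\<^esub> p)"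
    if x: "x \<in> tensor_class K V W p" for x
  proof -
    from tensor_class_memD(3)[OF p x] obtain n where n: "n \<in> N" "x = n \<oplus>\<^bsub>F\<^esub> p" by (rule bexE)
    have nF: "n \<in> carrier F" using n(1) N_carrier by (rule subsetD[rotated])
    have "c \<odot>\<^bsub>F\<^esub> x = c \<odot>\<^bsub>F\<^esub> n \<oplus>\<^bsub>F\<^esub> c \<odot>\<^bsub>F\<^esub> p"
      unfolding n(2) by (rule F.smult_r_distr[OF c nF p])
    moreover have "c \<odot>\<^bsub>F\<^esub> n \<in> N" using F.submoduleE(4)[OF N_sub c n(1)] .
    ultimately have "c \<odot>\<^bsub>F\<^esub> x \<in> tensor_class K V W (c \<odot>\<^bsub>F\<^esub> p)"
      unfolding tensor_class_def using F.a_rcosI[OF _ N_carrier F.smult_closed[OF c p]] by (simp only:)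
    then show ?thesis by (rule tensor_class_memD(2)[OF F.smult_closed[OF c p]])
  qed
  then show ?thesis
    unfolding tensor_sel(4) tensor_class_def[symmetric]
    using tensor_class_self[OF p] by (metis (mono_tags, lifting) SUP_eq_const empty_iff)
qed

lemma tensor_class_surj:
  assumes "s \<in> carrier (tensor K V W)" obtains p where "p \<in> carrier F" "s = tensor_class K V W p"
  using assms unfolding tensor_sel tensor_class_def A_RCOSETS_def' by auto

lemma tensor_class_closed: "p \<in> carrier F \<Longrightarrow> tensor_class K V W p \<in> carrier (tensor K V W)"
  unfolding tensor_sel tensor_class_def by (rule F.a_rcosetsI[OF N_carrier])

lemma tensor_class_zero: "tensor_class K V W \<zero>\<^bsub>F\<^esub> = \<zero>\<^bsub>tensor K V W\<^esub>"
  unfolding tensor_class_def tensor_sel by (rule F.a_coset_add_zero[OF N_carrier])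

lemma module_tensor: "module K (tensor K V W)"
proof -
  let ?T = "tensor K V W" and ?q = "tensor_class K V W"
  note add = tensor_class_add and sm = tensor_class_smult and cl = tensor_class_closed
  have "abelian_group ?T"
  proof (rule abelian_groupI)
    fix x y assume "x \<in> carrier ?T" "y \<in> carrier ?T"
    then obtain p q where p: "p \<in> carrier F" "x = ?q p" and q: "q \<in> carrier F" "y = ?q q"
      by (elim tensor_class_surj)
    show "x \<oplus>\<^bsub>?T\<^esub> y \<in> carrier ?T"
      unfolding p(2) q(2) add[OF p(1) q(1)] by (rule cl[OF F.a_closed[OF p(1) q(1)]])
    show "x \<oplus>\<^bsub>?T\<^esub> y = y \<oplus>\<^bsub>?T\<^esub> x"
      unfolding p(2) q(2) add[OF p(1) q(1)] add[OF q(1) p(1)] F.a_comm[OF p(1) q(1)] ..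
  next
    fix x y z assume "x \<in> carrier ?T" "y \<in> carrier ?T" "z \<in> carrier ?T"
    then obtain p q r where p: "p \<in> carrier F" "x = ?q p" and q: "q \<in> carrier F" "y = ?q q"
      and r: "r \<in> carrier F" "z = ?q r"
      by (elim tensor_class_surj)
    show "x \<oplus>\<^bsub>?T\<^esub> y \<oplus>\<^bsub>?T\<^esub> z = x \<oplus>\<^bsub>?T\<^esub> (y \<oplus>\<^bsub>?T\<^esub> z)"
      unfolding p(2) q(2) r(2) add[OF p(1) q(1)] add[OF q(1) r(1)]
        add[OF F.a_closed[OF p(1) q(1)] r(1)] add[OF p(1) F.a_closed[OF q(1) r(1)]]
        F.a_assoc[OF p(1) q(1) r(1)] ..
  next
    fix x assume "x \<in> carrier ?T"
    then obtain p where p: "p \<in> carrier F" "x = ?q p" by (rule tensor_class_surj)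
    show "\<zero>\<^bsub>?T\<^esub> \<oplus>\<^bsub>?T\<^esub> x = x"
      unfolding p(2) tensor_class_zero[symmetric] add[OF F.zero_closed p(1)] F.l_zero[OF p(1)] ..
    have "?q (\<ominus>\<^bsub>F\<^esub> p) \<oplus>\<^bsub>?T\<^esub> x = \<zero>\<^bsub>?T\<^esub>"
      unfolding p(2) tensor_class_zero[symmetric] add[OF F.a_inv_closed[OF p(1)] p(1)]
        F.l_neg[OF p(1)] ..
    then show "\<exists>y \<in> carrier ?T. y \<oplus>\<^bsub>?T\<^esub> x = \<zero>\<^bsub>?T\<^esub>"
      using cl[OF F.a_inv_closed[OF p(1)]] by (rule bexI)
  next
    show "\<zero>\<^bsub>?T\<^esub> \<in> carrier ?T"
      unfolding tensor_class_zero[symmetric] by (rule cl[OF F.zero_closed])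
  qed
  then show ?thesis
  proof (rule moduleI[OF V.R.is_cring])
    fix a x assume a: "a \<in> carrier K" and "x \<in> carrier ?T"
    then obtain p where p: "p \<in> carrier F" "x = ?q p" by (elim tensor_class_surj)
    show "a \<odot>\<^bsub>?T\<^esub> x \<in> carrier ?T"
      unfolding p(2) sm[OF a p(1)] by (rule cl[OF F.smult_closed[OF a p(1)]])
  next
    fix x assume "x \<in> carrier ?T"
    then obtain p where p: "p \<in> carrier F" "x = ?q p" by (elim tensor_class_surj)
    show "\<one>\<^bsub>K\<^esub> \<odot>\<^bsub>?T\<^esub> x = x"
      unfolding p(2) sm[OF V.R.one_closed p(1)] F.smult_one[OF p(1)] ..
  next
    fix a b x assume a: "a \<in> carrier K" and b: "b \<in> carrier K" and "x \<in> carrier ?T"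
    then obtain p where p: "p \<in> carrier F" "x = ?q p" by (elim tensor_class_surj)
    show "(a \<oplus>\<^bsub>K\<^esub> b) \<odot>\<^bsub>?T\<^esub> x = a \<odot>\<^bsub>?T\<^esub> x \<oplus>\<^bsub>?T\<^esub> b \<odot>\<^bsub>?T\<^esub> x"
      unfolding p(2) sm[OF V.R.a_closed[OF a b] p(1)] sm[OF a p(1)] sm[OF b p(1)]
        add[OF F.smult_closed[OF a p(1)] F.smult_closed[OF b p(1)]] F.smult_l_distr[OF a b p(1)] ..
    show "(a \<otimes>\<^bsub>K\<^esub> b) \<odot>\<^bsub>?T\<^esub> x = a \<odot>\<^bsub>?T\<^esub> (b \<odot>\<^bsub>?T\<^esub> x)"
      unfolding p(2) sm[OF V.R.m_closed[OF a b] p(1)] sm[OF b p(1)]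
        sm[OF a F.smult_closed[OF b p(1)]] F.smult_assoc1[OF a b p(1)] ..
  next
    fix a x y assume a: "a \<in> carrier K" and "x \<in> carrier ?T" "y \<in> carrier ?T"
    then obtain p q where p: "p \<in> carrier F" "x = ?q p" and q: "q \<in> carrier F" "y = ?q q"
      by (elim tensor_class_surj)
    show "a \<odot>\<^bsub>?T\<^esub> (x \<oplus>\<^bsub>?T\<^esub> y) = a \<odot>\<^bsub>?T\<^esub> x \<oplus>\<^bsub>?T\<^esub> a \<odot>\<^bsub>?T\<^esub> y"
      unfolding p(2) q(2) add[OF p(1) q(1)] sm[OF a p(1)] sm[OF a q(1)]
        sm[OF a F.a_closed[OF p(1) q(1)]]
        add[OF F.smult_closed[OF a p(1)] F.smult_closed[OF a q(1)]]
        F.smult_r_distr[OF a p(1) q(1)] ..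
  qed
qed

lemma tensor_class_linear: "tensor_class K V W \<in> linear_maps K F (tensor K V W)"
  by (rule linear_mapsI)
     (simp_all only: tensor_class_add tensor_class_smult tensor_class_closed)

lemma pure_eq_class: "pure K V W v w = tensor_class K V W (delta K (v, w))"
  by (simp add: pure_def tensor_class_def)

lemma tensor_class_eqI:
  assumes "p \<in> carrier F" "q \<in> carrier F" "p \<ominus>\<^bsub>F\<^esub> q \<in> N"
  shows "tensor_class K V W p = tensor_class K V W q"
proof -
  have "p = (p \<ominus>\<^bsub>F\<^esub> q) \<oplus>\<^bsub>F\<^esub> q"
    unfolding F.minus_eq F.a_assoc[OF assms(1) F.a_inv_closed[OF assms(2)] assms(2)]
      F.l_neg[OF assms(2)] F.r_zero[OF assms(1)] ..
  then have "p \<in> tensor_class K V W q"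
    unfolding tensor_class_def using F.a_rcosI[OF assms(3) N_carrier assms(2)] by (simp only:)
  then show ?thesis by (rule tensor_class_memD(2)[OF assms(2)])
qed

lemma pure_closed [simp]: "\<lbrakk>v \<in> carrier V; w \<in> carrier W\<rbrakk> \<Longrightarrow> pure K V W v w \<in> carrier (tensor K V W)"
  unfolding pure_eq_class by (intro tensor_class_closed delta_closed V.R.is_cring) auto

lemma pure_bilinear: "pure K V W \<in> bilinear_maps K V W (tensor K V W)"
proof -
  note [simp del] = tensor_sel free_module_sel
  have d: "delta K (v, w) \<in> carrier F" if "v \<in> carrier V" "w \<in> carrier W" for v w
    using that by (intro delta_closed V.R.is_cring) auto
  note gen = subsetD[OF tensor_gens_subset]
  have eq_sum: "tensor_class K V W p = tensor_class K V W q \<oplus>\<^bsub>tensor K V W\<^esub> tensor_class K V W r"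
    if "p \<ominus>\<^bsub>F\<^esub> (q \<oplus>\<^bsub>F\<^esub> r) \<in> tensor_gens K V W" "p \<in> carrier F" "q \<in> carrier F" "r \<in> carrier F"
    for p q r
    unfolding tensor_class_add[OF that(3,4)]
    by (rule tensor_class_eqI[OF that(2) F.a_closed[OF that(3,4)] gen[OF that(1)]])
  have eq_smult: "tensor_class K V W p = c \<odot>\<^bsub>tensor K V W\<^esub> tensor_class K V W q"
    if "p \<ominus>\<^bsub>F\<^esub> (c \<odot>\<^bsub>F\<^esub> q) \<in> tensor_gens K V W" "p \<in> carrier F" "q \<in> carrier F" "c \<in> carrier K"
    for p q c
    unfolding tensor_class_smult[OF that(4,3)]
    by (rule tensor_class_eqI[OF that(2) F.smult_closed[OF that(4,3)] gen[OF that(1)]])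
  show ?thesis
  proof (intro bilinear_mapsI linear_mapsI)
    fix v x y assume a: "v \<in> carrier V" "x \<in> carrier W" "y \<in> carrier W"
    show "pure K V W v (x \<oplus>\<^bsub>W\<^esub> y) = pure K V W v x \<oplus>\<^bsub>tensor K V W\<^esub> pure K V W v y"
      unfolding pure_eq_class
      by (rule eq_sum) (use a in \<open>(unfold tensor_gens_def Let_def, blast) | (blast intro: d W.a_closed)\<close>)+
  next
    fix v c y assume a: "v \<in> carrier V" "c \<in> carrier K" "y \<in> carrier W"
    show "pure K V W v (c \<odot>\<^bsub>W\<^esub> y) = c \<odot>\<^bsub>tensor K V W\<^esub> pure K V W v y"
      unfolding pure_eq_class
      by (rule eq_smult) (use a in \<open>(unfold tensor_gens_def Let_def, blast) | (blast intro: d W.smult_closed)\<close>)+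
  next
    fix v x y assume a: "v \<in> carrier W" "x \<in> carrier V" "y \<in> carrier V"
    show "pure K V W (x \<oplus>\<^bsub>V\<^esub> y) v = pure K V W x v \<oplus>\<^bsub>tensor K V W\<^esub> pure K V W y v"
      unfolding pure_eq_class
      by (rule eq_sum) (use a in \<open>(unfold tensor_gens_def Let_def, blast) | (blast intro: d V.a_closed)\<close>)+
  next
    fix v c y assume a: "v \<in> carrier W" "c \<in> carrier K" "y \<in> carrier V"
    show "pure K V W (c \<odot>\<^bsub>V\<^esub> y) v = c \<odot>\<^bsub>tensor K V W\<^esub> pure K V W y v"
      unfolding pure_eq_class
      by (rule eq_smult) (use a in \<open>(unfold tensor_gens_def Let_def, blast) | (blast intro: d V.smult_closed)\<close>)+
  qed (simp_all del: tensor_sel)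
qed

text \<open>
  The quotient map is surjective and the free module is spanned by its basis vectors, so the pure
  tensors span the tensor product. Nearly all identities below are reduced to pure tensors by this
  rule.
\<close>

lemma tensor_ext:
  assumes U: "module K U" and f: "f \<in> linear_maps K (tensor K V W) U"
    and g: "g \<in> linear_maps K (tensor K V W) U"
    and eq: "\<And>v w. \<lbrakk>v \<in> carrier V; w \<in> carrier W\<rbrakk> \<Longrightarrow> f (pure K V W v w) = g (pure K V W v w)"
    and s: "s \<in> carrier (tensor K V W)"
  shows "f s = g s"
proof -
  obtain p where p: "p \<in> carrier F" "s = tensor_class K V W p" using s by (rule tensor_class_surj)
  have "(\<lambda>p. f (tensor_class K V W p)) p = (\<lambda>p. g (tensor_class K V W p)) p"
    by (rule free_module_ext[OF U lin_compose[OF f tensor_class_linear]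
          lin_compose[OF g tensor_class_linear] _ p(1)])
       (use eq in \<open>auto simp: pure_eq_class\<close>)
  then show ?thesis using p by simp
qed

text \<open>
  The linear extension of a bilinear map to the free module kills the generating relations. Its
  kernel is a submodule and so contains the whole relation module; hence the value is the same at
  every representative, in particular at the one chosen in the definition of \<open>tensor_lift\<close>.
\<close>

lemma tensor_lift_class:
  assumes U: "module K U" and f: "f \<in> bilinear_maps K V W U" and p: "p \<in> carrier F"
  shows "tensor_lift K U f (tensor_class K V W p) = free_lift K U (\<lambda>z. f (fst z) (snd z)) p"
proof -
  interpret U: module K U by fact
  note [simp del] = tensor_sel free_module_sel
  let ?\<Lambda> = "free_lift K U (\<lambda>z. f (fst z) (snd z))"
  have lin: "?\<Lambda> \<in> linear_maps K F U"
    by (rule free_lift_linear[OF U]) (use bilin_closed[OF f] in auto)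
  have cl: "?\<Lambda> p \<in> carrier U" if "p \<in> carrier F" for p using lin_closed[OF lin that] .
  have val: "?\<Lambda> (delta K (v, w)) = f v w" if "v \<in> carrier V" "w \<in> carrier W" for v w
    using free_lift_delta[OF U, of "\<lambda>z. f (fst z) (snd z)" "(v, w)"] bilin_closed[OF f that]
    by simp
  have d: "delta K (v, w) \<in> carrier F" if "v \<in> carrier V" "w \<in> carrier W" for v w
    using that by (intro delta_closed V.R.is_cring) auto
  have diff: "?\<Lambda> (p \<ominus>\<^bsub>F\<^esub> q) = \<zero>\<^bsub>U\<^esub>"
    if "p \<in> carrier F" "q \<in> carrier F" "?\<Lambda> p = ?\<Lambda> q" for p q
  proof -
    have "?\<Lambda> ((p \<ominus>\<^bsub>F\<^esub> q) \<oplus>\<^bsub>F\<^esub> q) = ?\<Lambda> (p \<ominus>\<^bsub>F\<^esub> q) \<oplus>\<^bsub>U\<^esub> ?\<Lambda> q"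
      using that by (intro lin_add[OF lin]) auto
    moreover have "(p \<ominus>\<^bsub>F\<^esub> q) \<oplus>\<^bsub>F\<^esub> q = p" using that by (simp add: F.minus_eq F.a_assoc F.l_neg)
    ultimately have "?\<Lambda> (p \<ominus>\<^bsub>F\<^esub> q) \<oplus>\<^bsub>U\<^esub> ?\<Lambda> q = \<zero>\<^bsub>U\<^esub> \<oplus>\<^bsub>U\<^esub> ?\<Lambda> q" using that cl by simp
    then show ?thesis using that cl by (simp del: U.l_zero)
  qed
  define L where "L = {p \<in> carrier F. ?\<Lambda> p = \<zero>\<^bsub>U\<^esub>}"
  have "submodule L K F"
  proof (rule F.submoduleI)
    fix a assume "a \<in> L"
    then have "?\<Lambda> (\<zero>\<^bsub>F\<^esub> \<ominus>\<^bsub>F\<^esub> a) = \<zero>\<^bsub>U\<^esub>"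
      by (intro diff) (auto simp: L_def lin_zero[OF F.module_axioms U lin])
    then show "\<ominus>\<^bsub>F\<^esub> a \<in> L" using \<open>a \<in> L\<close> by (simp add: L_def F.minus_eq)
  qed (auto simp: L_def lin_zero[OF F.module_axioms U lin] lin_add[OF lin]
        lin_smult[OF lin])
  moreover have "tensor_gens K V W \<subseteq> L"
    unfolding tensor_gens_def Let_def L_def using d val
    by (auto intro!: diff simp: lin_add[OF lin] lin_smult[OF lin]
        lin_add[OF bilin_right[OF f _ lin_id]]
        lin_add[OF bilin_left[OF f _ lin_id]]
        lin_smult[OF bilin_right[OF f _ lin_id]]
        lin_smult[OF bilin_left[OF f _ lin_id]])
  ultimately have NL: "N \<subseteq> L" unfolding tensor_rel_def by blast
  define q where "q = (SOME q. q \<in> tensor_class K V W p)"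
  have "q \<in> tensor_class K V W p"
    unfolding q_def some_in_eq using tensor_class_self[OF p] by (metis empty_iff)
  then obtain n where n: "n \<in> N" "q = n \<oplus>\<^bsub>F\<^esub> p" using tensor_class_memD(3)[OF p] by blast
  have nF: "n \<in> carrier F" and n0: "?\<Lambda> n = \<zero>\<^bsub>U\<^esub>" using n NL by (auto simp: L_def)
  have "?\<Lambda> q = ?\<Lambda> p" unfolding n(2) lin_add[OF lin nF p] n0 using cl[OF p] by simp
  then show ?thesis unfolding tensor_lift_def Let_def q_def[symmetric] free_lift_def .
qed

lemma tensor_lift_pure:
  assumes "module K U" "f \<in> bilinear_maps K V W U" "v \<in> carrier V" "w \<in> carrier W"
  shows "tensor_lift K U f (pure K V W v w) = f v w"
  unfolding pure_eq_class
  using assms free_lift_delta[OF assms(1), of "\<lambda>z. f (fst z) (snd z)" "(v, w)"]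
    bilin_closed[OF assms(2-4)]
  by (subst tensor_lift_class) (auto intro!: delta_closed V.R.is_cring simp del: free_module_sel)

lemma tensor_lift_linear:
  assumes U: "module K U" and f: "f \<in> bilinear_maps K V W U"
  shows "tensor_lift K U f \<in> linear_maps K (tensor K V W) U"
proof -
  note [simp del] = tensor_sel free_module_sel
  have lin: "free_lift K U (\<lambda>z. f (fst z) (snd z)) \<in> linear_maps K F U"
    by (rule free_lift_linear[OF U]) (use bilin_closed[OF f] in auto)
  show ?thesis
    by (rule linear_mapsI)
       (auto elim!: tensor_class_surj simp: tensor_class_add tensor_class_smult
         tensor_lift_class[OF U f] lin_closed[OF lin] lin_add[OF lin]
         lin_smult[OF lin])
qed

end

text \<open>
  From here on tensor products are used through their universal property, so their carriers and
  operations stay folded.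
\<close>

declare tensor_sel [simp del] free_module_sel(1) [simp del]

section \<open>Multilinear calculus\<close>

lemma lin_sum:
  assumes "module K W" "f \<in> linear_maps K V W" "g \<in> linear_maps K V W"
  shows "(\<lambda>x. f x \<oplus>\<^bsub>W\<^esub> g x) \<in> linear_maps K V W"
proof -
  interpret W: module K W by fact
  note cl = lin_closed[OF assms(2)] lin_closed[OF assms(3)]
  show ?thesis
    by (rule linear_mapsI)
       (simp_all add: cl lin_add[OF assms(2)] lin_add[OF assms(3)]
         lin_smult[OF assms(2)] lin_smult[OF assms(3)] W.smult_r_distr W.a_ac)
qed

lemma lin_cong:
  assumes "module K V" "f \<in> linear_maps K V W" "\<And>x. x \<in> carrier V \<Longrightarrow> g x = f x"
  shows "g \<in> linear_maps K V W"
proof -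
  interpret V: module K V by fact
  show ?thesis
    using assms(2,3) by (auto simp: linear_maps_def Pi_def)
qed

lemma bilin_cong:
  assumes "module K V" "module K W" "f \<in> bilinear_maps K V W U"
    and "\<And>x y. \<lbrakk>x \<in> carrier V; y \<in> carrier W\<rbrakk> \<Longrightarrow> g x y = f x y"
  shows "g \<in> bilinear_maps K V W U"
  by (rule bilinear_mapsI; rule lin_cong)
     (use assms in \<open>auto simp: bilinear_maps_def\<close>)

text \<open>
  This makes iterated Sweedler expressions linear in the variables that occur below the sums. For
  fixed parameters both sides of the linearity equations are linear in \<open>t\<close>, so they only have to be
  compared on pure tensors, where they are the linearity of \<open>\<lambda>x. f x v w\<close>.
\<close>

lemma tensor_lift_param:
  assumes V: "module K V" and W: "module K W" and U: "module K U" and Y: "module K Y"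
    and t: "t \<in> carrier (tensor K V W)"
    and bil: "\<And>x. x \<in> carrier Y \<Longrightarrow> f x \<in> bilinear_maps K V W U"
    and lin: "\<And>v w. \<lbrakk>v \<in> carrier V; w \<in> carrier W\<rbrakk> \<Longrightarrow> (\<lambda>x. f x v w) \<in> linear_maps K Y U"
  shows "(\<lambda>x. tensor_lift K U (f x) t) \<in> linear_maps K Y U"
proof (rule linear_mapsI)
  interpret Y: module K Y by fact
  note L = tensor_lift_linear[OF V W U bil] and P = tensor_lift_pure[OF V W U bil]
  show "tensor_lift K U (f x) t \<in> carrier U" if "x \<in> carrier Y" for x
    using lin_closed[OF L[OF that] t] .
  show "tensor_lift K U (f (x \<oplus>\<^bsub>Y\<^esub> y)) t = tensor_lift K U (f x) t \<oplus>\<^bsub>U\<^esub> tensor_lift K U (f y) t"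
    if x: "x \<in> carrier Y" and y: "y \<in> carrier Y" for x y
    by (rule tensor_ext[OF V W U L[OF Y.a_closed[OF x y]] lin_sum[OF U L[OF x] L[OF y]] _ t])
       (simp add: P x y lin_add[OF lin])
  show "tensor_lift K U (f (c \<odot>\<^bsub>Y\<^esub> x)) t = c \<odot>\<^bsub>U\<^esub> tensor_lift K U (f x) t"
    if c: "c \<in> carrier K" and x: "x \<in> carrier Y" for c x
    by (rule tensor_ext[OF V W U L[OF Y.smult_closed[OF c x]] lin_scale[OF U c L[OF x]] _ t])
       (simp add: P c x lin_smult[OF lin])
qed

lemma tensor_lift_cong:
  assumes V: "module K V" and W: "module K W" and U: "module K U"
    and t: "t \<in> carrier (tensor K V W)" and f: "f \<in> bilinear_maps K V W U"
    and eq: "\<And>v w. \<lbrakk>v \<in> carrier V; w \<in> carrier W\<rbrakk> \<Longrightarrow> f v w = g v w"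
  shows "tensor_lift K U f t = tensor_lift K U g t"
proof -
  have g: "g \<in> bilinear_maps K V W U" by (rule bilin_cong[OF V W f]) (simp add: eq)
  show ?thesis
    by (rule tensor_ext[OF V W U tensor_lift_linear[OF V W U f] tensor_lift_linear[OF V W U g] _ t])
       (simp add: tensor_lift_pure[OF V W U f] tensor_lift_pure[OF V W U g] eq)
qed

lemma linear_map_tensor_lift:
  assumes V: "module K V" and W: "module K W" and U: "module K U" and U': "module K U'"
    and t: "t \<in> carrier (tensor K V W)" and f: "f \<in> bilinear_maps K V W U"
    and \<phi>: "\<phi> \<in> linear_maps K U U'"
  shows "\<phi> (tensor_lift K U f t) = tensor_lift K U' (\<lambda>v w. \<phi> (f v w)) t"
proof -
  have g: "(\<lambda>v w. \<phi> (f v w)) \<in> bilinear_maps K V W U'"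
    by (intro bilinear_mapsI lin_compose[OF \<phi>] bilin_left[OF f]
        bilin_right[OF f] lin_id)
  show ?thesis
    by (rule tensor_ext[OF V W U' lin_compose[OF \<phi> tensor_lift_linear[OF V W U f]]
          tensor_lift_linear[OF V W U' g] _ t])
       (simp add: tensor_lift_pure[OF V W U f] tensor_lift_pure[OF V W U' g])
qed

text \<open>
  Independent sums may be interchanged: both sides are linear in \<open>s\<close>, and for a pure tensor \<open>s\<close>
  the sum over \<open>s\<close> has only one term.
\<close>

lemma tensor_lift_swap:
  assumes V: "module K V" and W: "module K W" and V': "module K V'" and W': "module K W'"
    and U: "module K U"
    and s: "s \<in> carrier (tensor K V W)" and t: "t \<in> carrier (tensor K V' W')"
    and f: "\<And>v w. \<lbrakk>v \<in> carrier V; w \<in> carrier W\<rbrakk> \<Longrightarrow> f v w \<in> bilinear_maps K V' W' U"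
    and f': "\<And>v' w'. \<lbrakk>v' \<in> carrier V'; w' \<in> carrier W'\<rbrakk> \<Longrightarrow>
      (\<lambda>v w. f v w v' w') \<in> bilinear_maps K V W U"
  shows "tensor_lift K U (\<lambda>v w. tensor_lift K U (\<lambda>v' w'. f v w v' w') t) s =
    tensor_lift K U (\<lambda>v' w'. tensor_lift K U (\<lambda>v w. f v w v' w') s) t"
proof -
  note r = bilin_right[OF f' _ lin_id] bilin_left[OF f' _ lin_id]
  note r' = bilin_right[OF f _ lin_id] bilin_left[OF f _ lin_id]
  have 1: "(\<lambda>v w. tensor_lift K U (\<lambda>v' w'. f v w v' w') t) \<in> bilinear_maps K V W U"
    by (intro bilinear_mapsI tensor_lift_param[OF V' W' U _ t] V W f r)
  have 2: "(\<lambda>s. tensor_lift K U (\<lambda>v' w'. tensor_lift K U (\<lambda>v w. f v w v' w') s) t)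
      \<in> linear_maps K (tensor K V W) U"
  proof (rule tensor_lift_param[OF V' W' U module_tensor[OF V W] t])
    show "(\<lambda>v' w'. tensor_lift K U (\<lambda>v w. f v w v' w') s) \<in> bilinear_maps K V' W' U"
      if "s \<in> carrier (tensor K V W)" for s
      by (intro bilinear_mapsI tensor_lift_param[OF V W U _ that] V' W' f' r')
    show "(\<lambda>s. tensor_lift K U (\<lambda>v w. f v w v' w') s) \<in> linear_maps K (tensor K V W) U"
      if "v' \<in> carrier V'" "w' \<in> carrier W'" for v' w'
      by (intro tensor_lift_linear[OF V W U] f' that)
  qed
  have 3: "(\<lambda>v' w'. f v w v' w') \<in> bilinear_maps K V' W' U" if "v \<in> carrier V" "w \<in> carrier W" for v w
    using f[OF that] .
  show ?thesis
  proof (rule tensor_ext[OF V W U tensor_lift_linear[OF V W U 1] 2 _ s])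
    fix v w assume vw: "v \<in> carrier V" "w \<in> carrier W"
    show "tensor_lift K U (\<lambda>v w. tensor_lift K U (\<lambda>v' w'. f v w v' w') t) (pure K V W v w) =
      tensor_lift K U (\<lambda>v' w'. tensor_lift K U (\<lambda>v w. f v w v' w') (pure K V W v w)) t"
      unfolding tensor_lift_pure[OF V W U 1 vw]
      by (rule tensor_lift_cong[OF V' W' U t f[OF vw]]) (simp add: tensor_lift_pure[OF V W U f' vw])
  qed
qed

lemma tensor_map_bilinear:
  assumes "module K V" "module K W" "module K V'" "module K W'"
    and "f \<in> linear_maps K V V'" "g \<in> linear_maps K W W'"
  shows "(\<lambda>v w. pure K V' W' (f v) (g w)) \<in> bilinear_maps K V W (tensor K V' W')"
  by (intro bilinear_mapsI bilin_left[OF pure_bilinear]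
      bilin_right[OF pure_bilinear] assms lin_closed[OF assms(5)] lin_closed[OF assms(6)])

lemma tensor_map_linear:
  assumes "module K V" "module K W" "module K V'" "module K W'"
    and "f \<in> linear_maps K V V'" "g \<in> linear_maps K W W'"
  shows "tensor_map K V' W' f g \<in> linear_maps K (tensor K V W) (tensor K V' W')"
  unfolding tensor_map_def
  by (intro tensor_lift_linear module_tensor tensor_map_bilinear assms)

lemma tensor_map_pure:
  assumes "module K V" "module K W" "module K V'" "module K W'"
    and "f \<in> linear_maps K V V'" "g \<in> linear_maps K W W'" "v \<in> carrier V" "w \<in> carrier W"
  shows "tensor_map K V' W' f g (pure K V W v w) = pure K V' W' (f v) (g w)"
  unfolding tensor_map_def
  by (subst tensor_lift_pure[OF assms(1,2) module_tensor[OF assms(3,4)] tensor_map_bilinear[OF assms(1-6)]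
        assms(7,8)]) (rule refl)

context
  fixes K :: "('k, 'm) ring_scheme" and U :: "('k, 'u, 'n) module_scheme"
    and V :: "('k, 'v, 'p) module_scheme" and W :: "('k, 'w, 'q) module_scheme"
  assumes U: "module K U" and V: "module K V" and W: "module K W"
begin

private lemmas mods = U V W module_tensor[OF U V] module_tensor[OF V W]
  module_tensor[OF module_tensor[OF U V] W] module_tensor[OF U module_tensor[OF V W]]

private lemmas pl = bilin_left[OF pure_bilinear[OF U V]]
  bilin_left[OF pure_bilinear[OF V W]]
  bilin_left[OF pure_bilinear[OF module_tensor[OF U V] W]]
  bilin_left[OF pure_bilinear[OF U module_tensor[OF V W]]]
  bilin_right[OF pure_bilinear[OF U V]]
  bilin_right[OF pure_bilinear[OF V W]]
  bilin_right[OF pure_bilinear[OF module_tensor[OF U V] W]]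
  bilin_right[OF pure_bilinear[OF U module_tensor[OF V W]]]
  lin_id pure_closed[OF U V] pure_closed[OF V W]

private lemma inner_right:
  "w \<in> carrier W \<Longrightarrow> (\<lambda>u v. pure K U (tensor K V W) u (pure K V W v w))
    \<in> bilinear_maps K U V (tensor K U (tensor K V W))"
  by (intro bilinear_mapsI pl)

private lemma outer_right:
  "(\<lambda>x w. tensor_lift K (tensor K U (tensor K V W))
        (\<lambda>u v. pure K U (tensor K V W) u (pure K V W v w)) x)
    \<in> bilinear_maps K (tensor K U V) W (tensor K U (tensor K V W))"
proof (rule bilinear_mapsI)
  show "(\<lambda>w. tensor_lift K (tensor K U (tensor K V W))
        (\<lambda>u v. pure K U (tensor K V W) u (pure K V W v w)) x)
    \<in> linear_maps K W (tensor K U (tensor K V W))" if "x \<in> carrier (tensor K U V)" for x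
    by (rule tensor_lift_param[OF U V _ W that]; (intro mods inner_right pl; assumption)?)
  show "(\<lambda>x. tensor_lift K (tensor K U (tensor K V W))
        (\<lambda>u v. pure K U (tensor K V W) u (pure K V W v w)) x)
    \<in> linear_maps K (tensor K U V) (tensor K U (tensor K V W))" if "w \<in> carrier W" for w
    by (intro tensor_lift_linear inner_right mods that)
qed

lemma assoc_right_linear:
  "assoc_right K U V W \<in> linear_maps K (tensor K (tensor K U V) W) (tensor K U (tensor K V W))"
  unfolding assoc_right_def Let_def by (intro tensor_lift_linear mods outer_right)

lemma assoc_right_pure:
  assumes "u \<in> carrier U" "v \<in> carrier V" "w \<in> carrier W"
  shows "assoc_right K U V W (pure K (tensor K U V) W (pure K U V u v) w) =
    pure K U (tensor K V W) u (pure K V W v w)"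
  unfolding assoc_right_def Let_def
  by (subst tensor_lift_pure[OF _ _ _ outer_right], (intro mods assms pl)+,
      subst tensor_lift_pure[OF U V _ inner_right], (intro mods assms)+, rule refl)

private lemma inner_left:
  "u \<in> carrier U \<Longrightarrow> (\<lambda>v w. pure K (tensor K U V) W (pure K U V u v) w)
    \<in> bilinear_maps K V W (tensor K (tensor K U V) W)"
  by (intro bilinear_mapsI pl)

private lemma outer_left:
  "(\<lambda>u y. tensor_lift K (tensor K (tensor K U V) W)
        (\<lambda>v w. pure K (tensor K U V) W (pure K U V u v) w) y)
    \<in> bilinear_maps K U (tensor K V W) (tensor K (tensor K U V) W)"
proof (rule bilinear_mapsI)
  show "(\<lambda>u. tensor_lift K (tensor K (tensor K U V) W)
        (\<lambda>v w. pure K (tensor K U V) W (pure K U V u v) w) y)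
    \<in> linear_maps K U (tensor K (tensor K U V) W)" if "y \<in> carrier (tensor K V W)" for y
    by (rule tensor_lift_param[OF V W _ U that]; (intro mods inner_left pl; assumption)?)
  show "(\<lambda>y. tensor_lift K (tensor K (tensor K U V) W)
        (\<lambda>v w. pure K (tensor K U V) W (pure K U V u v) w) y)
    \<in> linear_maps K (tensor K V W) (tensor K (tensor K U V) W)" if "u \<in> carrier U" for u
    by (intro tensor_lift_linear inner_left mods that)
qed

lemma assoc_left_linear:
  "assoc_left K U V W \<in> linear_maps K (tensor K U (tensor K V W)) (tensor K (tensor K U V) W)"
  unfolding assoc_left_def Let_def by (intro tensor_lift_linear mods outer_left)

lemma assoc_left_pure:
  assumes "u \<in> carrier U" "v \<in> carrier V" "w \<in> carrier W"
  shows "assoc_left K U V W (pure K U (tensor K V W) u (pure K V W v w)) =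
    pure K (tensor K U V) W (pure K U V u v) w"
  unfolding assoc_left_def Let_def
  by (subst tensor_lift_pure[OF _ _ _ outer_left], (intro mods assms pl)+,
      subst tensor_lift_pure[OF V W _ inner_left], (intro mods assms)+, rule refl)

end

section \<open>Sweedler notation\<close>

lemma (in coalgebra) counit_closed: "x \<in> carrier C \<Longrightarrow> counit C x \<in> carrier K"
  using lin_closed[OF counit_linear] by (simp add: self_module_def)

lemma (in coalgebra) counit_scale_linear:
  assumes "module K U" "u \<in> carrier U"
  shows "(\<lambda>x. counit C x \<odot>\<^bsub>U\<^esub> u) \<in> linear_maps K C U"
proof -
  interpret U: module K U by fact
  show ?thesis
    using assms(2)
    by (intro linear_mapsI) (auto simp: counit_closed lin_add[OF counit_linear]
      lin_smult[OF counit_linear] self_module_def U.smult_l_distr U.smult_assoc1)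
qed

context
  fixes K :: "('k, 'm) ring_scheme" and C :: "('k, 'c, 'n) hopf_scheme"
    and U :: "('k, 'u, 'q) module_scheme"
  assumes C: "coalgebra K C" and U: "module K U"
begin

interpretation C: coalgebra K C by (fact C)

private lemma mC: "module K C" by (fact C.module_axioms)

private lemma comult_closed: "x \<in> carrier C \<Longrightarrow> comult C x \<in> carrier (tensor K C C)"
  using lin_closed[OF C.comult_linear] .

lemma sweedler_linear:
  assumes "f \<in> bilinear_maps K C C U" "g \<in> linear_maps K Y C"
  shows "(\<lambda>x. sweedler K C U f (g x)) \<in> linear_maps K Y U"
  unfolding sweedler_def
  by (rule lin_compose[OF tensor_lift_linear[OF mC mC U assms(1)]
        lin_compose[OF C.comult_linear assms(2)]])

lemma sweedler_closed:
  assumes "f \<in> bilinear_maps K C C U" "x \<in> carrier C"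
  shows "sweedler K C U f x \<in> carrier U"
  using lin_closed[OF sweedler_linear[OF assms(1) lin_id] assms(2)] .

lemma sweedler_param:
  assumes "module K Y" "x \<in> carrier C"
    and "\<And>y. y \<in> carrier Y \<Longrightarrow> f y \<in> bilinear_maps K C C U"
    and "\<And>v w. \<lbrakk>v \<in> carrier C; w \<in> carrier C\<rbrakk> \<Longrightarrow> (\<lambda>y. f y v w) \<in> linear_maps K Y U"
  shows "(\<lambda>y. sweedler K C U (f y) x) \<in> linear_maps K Y U"
  unfolding sweedler_def
  by (rule tensor_lift_param[OF mC mC U assms(1) comult_closed[OF assms(2)] assms(3,4)])

lemma sweedler_cong:
  assumes "x \<in> carrier C" "f \<in> bilinear_maps K C C U"
    and "\<And>y z. \<lbrakk>y \<in> carrier C; z \<in> carrier C\<rbrakk> \<Longrightarrow> f y z = g y z"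
  shows "sweedler K C U f x = sweedler K C U g x"
  unfolding sweedler_def
  by (rule tensor_lift_cong[OF mC mC U comult_closed[OF assms(1)] assms(2,3)])

lemma linear_map_sweedler:
  assumes "module K U'" "\<phi> \<in> linear_maps K U U'" "f \<in> bilinear_maps K C C U" "x \<in> carrier C"
  shows "\<phi> (sweedler K C U f x) = sweedler K C U' (\<lambda>y z. \<phi> (f y z)) x"
  unfolding sweedler_def
  by (rule linear_map_tensor_lift[OF mC mC U assms(1) comult_closed[OF assms(4)] assms(3,2)])

lemma sweedler_swap:
  fixes D :: "('k, 'd, 'r) hopf_scheme"
  assumes D: "coalgebra K D" and x: "x \<in> carrier C" and y: "y \<in> carrier D"
    and "\<And>v w. \<lbrakk>v \<in> carrier C; w \<in> carrier C\<rbrakk> \<Longrightarrow> f v w \<in> bilinear_maps K D D U"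
    and "\<And>v' w'. \<lbrakk>v' \<in> carrier D; w' \<in> carrier D\<rbrakk> \<Longrightarrow>
      (\<lambda>v w. f v w v' w') \<in> bilinear_maps K C C U"
  shows "sweedler K C U (\<lambda>v w. sweedler K D U (\<lambda>v' w'. f v w v' w') y) x =
    sweedler K D U (\<lambda>v' w'. sweedler K C U (\<lambda>v w. f v w v' w') x) y"
proof -
  interpret D: coalgebra K D by (fact D)
  show ?thesis unfolding sweedler_def
    by (rule tensor_lift_swap[OF mC mC D.module_axioms D.module_axioms U comult_closed[OF x]
          lin_closed[OF D.comult_linear y] assms(4,5)])
qed

text \<open>
  The counit law of \<open>C\<close>, with a linear map \<open>f\<close> applied to both sides and moved through the sum.
\<close>

lemma sweedler_counit_left:
  assumes "f \<in> linear_maps K C U" "x \<in> carrier C"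
  shows "sweedler K C U (\<lambda>y z. counit C y \<odot>\<^bsub>U\<^esub> f z) x = f x"
proof -
  have bil: "(\<lambda>y z. counit C y \<odot>\<^bsub>C\<^esub> z) \<in> bilinear_maps K C C C"
    by (intro bilinear_mapsI lin_scale C.counit_scale_linear C.counit_closed mC lin_id)
  have "f x = f (sweedler K C C (\<lambda>y z. counit C y \<odot>\<^bsub>C\<^esub> z) x)"
    using C.counit_left[OF assms(2)] by simp
  also have "\<dots> = sweedler K C U (\<lambda>y z. f (counit C y \<odot>\<^bsub>C\<^esub> z)) x"
    unfolding sweedler_def
    by (rule linear_map_tensor_lift[OF mC mC mC U comult_closed[OF assms(2)] bil assms(1)])
  also have "\<dots> = sweedler K C U (\<lambda>y z. counit C y \<odot>\<^bsub>U\<^esub> f z) x"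
    by (rule sweedler_cong[OF assms(2)])
       (use lin_compose[OF assms(1)] bil in \<open>auto simp: bilinear_maps_def
         lin_smult[OF assms(1)] C.counit_closed\<close>)
  finally show ?thesis by simp
qed

lemma sweedler_counit_right:
  assumes "f \<in> linear_maps K C U" "x \<in> carrier C"
  shows "sweedler K C U (\<lambda>y z. counit C z \<odot>\<^bsub>U\<^esub> f y) x = f x"
proof -
  have bil: "(\<lambda>y z. counit C z \<odot>\<^bsub>C\<^esub> y) \<in> bilinear_maps K C C C"
    by (intro bilinear_mapsI lin_scale C.counit_scale_linear C.counit_closed mC lin_id)
  have "f x = f (sweedler K C C (\<lambda>y z. counit C z \<odot>\<^bsub>C\<^esub> y) x)"
    using C.counit_right[OF assms(2)] by simp
  also have "\<dots> = sweedler K C U (\<lambda>y z. f (counit C z \<odot>\<^bsub>C\<^esub> y)) x"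
    unfolding sweedler_def
    by (rule linear_map_tensor_lift[OF mC mC mC U comult_closed[OF assms(2)] bil assms(1)])
  also have "\<dots> = sweedler K C U (\<lambda>y z. counit C z \<odot>\<^bsub>U\<^esub> f y) x"
    by (rule sweedler_cong[OF assms(2)])
       (use lin_compose[OF assms(1)] bil in \<open>auto simp: bilinear_maps_def
         lin_smult[OF assms(1)] C.counit_closed\<close>)
  finally show ?thesis by simp
qed

text \<open>
  The coassociativity law is an identity in \<open>C \<otimes> (C \<otimes> C)\<close>. A trilinear \<open>f\<close> induces a linear map
  \<open>?L\<close> on this space, and the two sides of the law are mapped to the two iterated sums.
\<close>

lemma sweedler_coassoc:
  assumes x: "x \<in> carrier C"
    and f1: "\<And>v w. \<lbrakk>v \<in> carrier C; w \<in> carrier C\<rbrakk> \<Longrightarrow> (\<lambda>u. f u v w) \<in> linear_maps K C U"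
    and f2: "\<And>u w. \<lbrakk>u \<in> carrier C; w \<in> carrier C\<rbrakk> \<Longrightarrow> (\<lambda>v. f u v w) \<in> linear_maps K C U"
    and f3: "\<And>u v. \<lbrakk>u \<in> carrier C; v \<in> carrier C\<rbrakk> \<Longrightarrow> (\<lambda>w. f u v w) \<in> linear_maps K C U"
  shows "sweedler K C U (\<lambda>y w. sweedler K C U (\<lambda>u v. f u v w) y) x =
    sweedler K C U (\<lambda>u y. sweedler K C U (\<lambda>v w. f u v w) y) x"
proof -
  let ?CC = "tensor K C C" and ?CCC = "tensor K C (tensor K C C)"
  have mCC: "module K ?CC" by (rule module_tensor[OF mC mC])
  have mCCC: "module K ?CCC" by (rule module_tensor[OF mC mCC])
  have b1: "(\<lambda>u v. f u v w) \<in> bilinear_maps K C C U" if "w \<in> carrier C" for w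
    by (rule bilinear_mapsI) (use that f1 f2 in auto)
  have b2: "(\<lambda>v w. f u v w) \<in> bilinear_maps K C C U" if "u \<in> carrier C" for u
    by (rule bilinear_mapsI) (use that f3 f2 in auto)
  let ?l = "\<lambda>u y. tensor_lift K U (\<lambda>v w. f u v w) y"
  have l: "?l \<in> bilinear_maps K C ?CC U"
  proof (rule bilinear_mapsI)
    show "(\<lambda>y. ?l u y) \<in> linear_maps K ?CC U" if "u \<in> carrier C" for u
      by (rule tensor_lift_linear[OF mC mC U b2[OF that]])
    show "(\<lambda>u. ?l u y) \<in> linear_maps K C U" if "y \<in> carrier ?CC" for y
      by (rule tensor_lift_param[OF mC mC U mC that b2 f1])
  qed
  let ?L = "tensor_lift K U ?l"
  have L: "?L \<in> linear_maps K ?CCC U" by (rule tensor_lift_linear[OF mC mCC U l])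
  have L_pure: "?L (pure K C ?CC u y) = ?l u y" if "u \<in> carrier C" "y \<in> carrier ?CC" for u y
    by (rule tensor_lift_pure[OF mC mCC U l that])
  note D = C.comult_linear
  have "?L (tensor_map K C ?CC id (comult C) (comult C x)) =
      tensor_lift K U (\<lambda>u y. ?L (pure K C ?CC (id u) (comult C y))) (comult C x)"
    unfolding tensor_map_def
    by (rule linear_map_tensor_lift[OF mC mC mCCC U comult_closed[OF x]
          tensor_map_bilinear[OF mC mC mC mCC _ D] L]) (simp add: linear_maps_def)
  also have "\<dots> = sweedler K C U (\<lambda>u y. ?L (pure K C ?CC (id u) (comult C y))) x"
    by (simp add: sweedler_def)
  also have "\<dots> = sweedler K C U (\<lambda>u y. sweedler K C U (\<lambda>v w. f u v w) y) x"
  proof (rule sweedler_cong[OF x])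
    show "(\<lambda>u y. ?L (pure K C ?CC (id u) (comult C y))) \<in> bilinear_maps K C C U"
      by (intro bilinear_mapsI lin_compose[OF L] bilin_left[OF pure_bilinear]
          bilin_right[OF pure_bilinear] mC mCC D lin_closed[OF D])
         (auto simp: linear_maps_def)
  qed (simp add: L_pure comult_closed sweedler_def)
  finally have R: "?L (tensor_map K C ?CC id (comult C) (comult C x)) =
    sweedler K C U (\<lambda>u y. sweedler K C U (\<lambda>v w. f u v w) y) x" .
  let ?a = "\<lambda>t. ?L (assoc_right K C C C t)"
  have a: "?a \<in> linear_maps K (tensor K ?CC C) U"
    by (rule lin_compose[OF L assoc_right_linear[OF mC mC mC]])
  have a_pure: "?a (pure K ?CC C s w) = tensor_lift K U (\<lambda>u v. f u v w) s"
    if s: "s \<in> carrier ?CC" and w: "w \<in> carrier C" for s w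
  proof -
    have 1: "(\<lambda>s. ?a (pure K ?CC C s w)) \<in> linear_maps K ?CC U"
      by (rule lin_compose[OF a bilin_left[OF pure_bilinear[OF mCC mC] w lin_id]])
    show ?thesis
    proof (rule tensor_ext[OF mC mC U 1 tensor_lift_linear[OF mC mC U b1[OF w]] _ s])
      fix u v assume uv: "u \<in> carrier C" "v \<in> carrier C"
      show "?a (pure K ?CC C (pure K C C u v) w) =
        tensor_lift K U (\<lambda>u v. f u v w) (pure K C C u v)"
        by (simp add: assoc_right_pure[OF mC mC mC uv w] L_pure uv w pure_closed mC
            tensor_lift_pure[OF mC mC U b1[OF w] uv] tensor_lift_pure[OF mC mC U b2[OF uv(1)] uv(2) w])
    qed
  qed
  have "?L (assoc_right K C C C (tensor_map K ?CC C (comult C) id (comult C x))) =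
      tensor_lift K U (\<lambda>y w. ?a (pure K ?CC C (comult C y) (id w))) (comult C x)"
    unfolding tensor_map_def
    by (rule linear_map_tensor_lift[OF mC mC module_tensor[OF mCC mC] U comult_closed[OF x]
          tensor_map_bilinear[OF mC mC mCC mC D] a]) (simp add: linear_maps_def)
  also have "\<dots> = sweedler K C U (\<lambda>y w. ?a (pure K ?CC C (comult C y) (id w))) x"
    by (simp add: sweedler_def)
  also have "\<dots> = sweedler K C U (\<lambda>y w. sweedler K C U (\<lambda>u v. f u v w) y) x"
  proof (rule sweedler_cong[OF x])
    show "(\<lambda>y w. ?a (pure K ?CC C (comult C y) (id w))) \<in> bilinear_maps K C C U"
      by (intro bilinear_mapsI lin_compose[OF a] bilin_left[OF pure_bilinear]
          bilin_right[OF pure_bilinear] mC mCC D lin_closed[OF D])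
         (auto simp: linear_maps_def)
  qed (simp add: a_pure comult_closed sweedler_def)
  finally show ?thesis using R C.coassoc[OF x] by simp
qed

end

section \<open>Smash products\<close>

text \<open>
  The left action of \<open>A\<close> on the first factor of \<open>A \<otimes> B\<close> and the right action of \<open>B\<close> on the second.
  In a smash product these are multiplication by \<open>a \<otimes> 1\<close> from the left and by \<open>1 \<otimes> b\<close> from the right.
\<close>

definition mult_left_factor ::
  "('k, 'm) ring_scheme \<Rightarrow> ('k, 'a, 'n) module_scheme \<Rightarrow> ('k, 'b, 'p) module_scheme \<Rightarrow>
   'a \<Rightarrow> ('a \<times> 'b \<Rightarrow> 'k) set \<Rightarrow> ('a \<times> 'b \<Rightarrow> 'k) set"
  where "mult_left_factor K A B a = tensor_lift K (tensor K A B) (\<lambda>u v. pure K A B (a \<otimes>\<^bsub>A\<^esub> u) v)"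

definition mult_right_factor ::
  "('k, 'm) ring_scheme \<Rightarrow> ('k, 'a, 'n) module_scheme \<Rightarrow> ('k, 'b, 'p) module_scheme \<Rightarrow>
   'b \<Rightarrow> ('a \<times> 'b \<Rightarrow> 'k) set \<Rightarrow> ('a \<times> 'b \<Rightarrow> 'k) set"
  where "mult_right_factor K A B b = tensor_lift K (tensor K A B) (\<lambda>u v. pure K A B u (v \<otimes>\<^bsub>B\<^esub> b))"

abbreviation bilinear_mult :: "('k, 'm) ring_scheme \<Rightarrow> ('k, 'a, 'n) module_scheme \<Rightarrow> bool"
  where "bilinear_mult K A \<equiv> (\<lambda>x y. x \<otimes>\<^bsub>A\<^esub> y) \<in> bilinear_maps K A A A"

context
  fixes K :: "('k, 'm) ring_scheme" and A :: "('k, 'a, 'n) module_scheme"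
    and B :: "('k, 'b, 'p) module_scheme"
  assumes A: "module K A" and B: "module K B"
    and multA: "bilinear_mult K A" and multB: "bilinear_mult K B"
begin

private abbreviation (input) "T \<equiv> tensor K A B"
private lemma T: "module K T" by (rule module_tensor[OF A B])

private lemmas pAB = bilin_left[OF pure_bilinear[OF A B]]
  bilin_right[OF pure_bilinear[OF A B]]

lemma mult_left_factor_inner:
  "a \<in> carrier A \<Longrightarrow> (\<lambda>u v. pure K A B (a \<otimes>\<^bsub>A\<^esub> u) v) \<in> bilinear_maps K A B T"
  by (intro bilinear_mapsI pAB bilin_right[OF multA] lin_id
      bilin_closed[OF multA])

lemma mult_right_factor_inner:
  "b \<in> carrier B \<Longrightarrow> (\<lambda>u v. pure K A B u (v \<otimes>\<^bsub>B\<^esub> b)) \<in> bilinear_maps K A B T"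
  by (intro bilinear_mapsI pAB bilin_left[OF multB] lin_id
      bilin_closed[OF multB])

lemma mult_left_factor_bilinear: "mult_left_factor K A B \<in> bilinear_maps K A T T"
proof (rule bilinear_mapsI)
  show "(\<lambda>t. mult_left_factor K A B a t) \<in> linear_maps K T T" if "a \<in> carrier A" for a
    unfolding mult_left_factor_def
    by (rule tensor_lift_linear[OF A B T mult_left_factor_inner[OF that]])
  show "(\<lambda>a. mult_left_factor K A B a t) \<in> linear_maps K A T" if "t \<in> carrier T" for t
    unfolding mult_left_factor_def
    by (rule tensor_lift_param[OF A B T A that mult_left_factor_inner])
       (assumption | intro pAB bilin_left[OF multA] lin_id)+
qed

lemma mult_right_factor_bilinear: "mult_right_factor K A B \<in> bilinear_maps K B T T"
proof (rule bilinear_mapsI)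
  show "(\<lambda>t. mult_right_factor K A B b t) \<in> linear_maps K T T" if "b \<in> carrier B" for b
    unfolding mult_right_factor_def
    by (rule tensor_lift_linear[OF A B T mult_right_factor_inner[OF that]])
  show "(\<lambda>b. mult_right_factor K A B b t) \<in> linear_maps K B T" if "t \<in> carrier T" for t
    unfolding mult_right_factor_def
    by (rule tensor_lift_param[OF A B T B that mult_right_factor_inner])
       (assumption | intro pAB bilin_right[OF multB] lin_id)+
qed

lemma mult_left_factor_pure:
  "\<lbrakk>a \<in> carrier A; u \<in> carrier A; v \<in> carrier B\<rbrakk> \<Longrightarrow>
    mult_left_factor K A B a (pure K A B u v) = pure K A B (a \<otimes>\<^bsub>A\<^esub> u) v"
  unfolding mult_left_factor_def by (rule tensor_lift_pure[OF A B T mult_left_factor_inner])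

lemma mult_right_factor_pure:
  "\<lbrakk>b \<in> carrier B; u \<in> carrier A; v \<in> carrier B\<rbrakk> \<Longrightarrow>
    mult_right_factor K A B b (pure K A B u v) = pure K A B u (v \<otimes>\<^bsub>B\<^esub> b)"
  unfolding mult_right_factor_def by (rule tensor_lift_pure[OF A B T mult_right_factor_inner])

lemma mult_map_linear: "mult_map K A \<in> linear_maps K (tensor K A A) A"
  unfolding mult_map_def by (rule tensor_lift_linear[OF A A A multA])

lemma mult_map_pure: "\<lbrakk>x \<in> carrier A; y \<in> carrier A\<rbrakk> \<Longrightarrow> mult_map K A (pure K A A x y) = x \<otimes>\<^bsub>A\<^esub> y"
  unfolding mult_map_def by (rule tensor_lift_pure[OF A A A multA])

end

lemma lin_id': "id \<in> linear_maps K V V"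
  using lin_id[of K V] by (simp add: id_def)

text \<open>
  Quasitriangularity on elements. Each side of the two identities is a composition of linear maps on
  an iterated tensor product; it is evaluated from the inside, and whenever a factor \<open>R\<close> has produced
  a tensor that is not pure, the remaining maps \<open>C2\<close>, \<open>C3\<close> (or \<open>D2\<close>, \<open>D3\<close>) are
  computed on pure tensors and extended linearly.
\<close>

lemma quasitriangularI:
  fixes K :: "('k, 'm) ring_scheme" and A :: "('k, 'a, 'n) module_scheme"
    and B :: "('k, 'b, 'p) module_scheme"
  assumes A: "module K A" and B: "module K B"
    and multA: "bilinear_mult K A" and multB: "bilinear_mult K B"
    and R: "R \<in> linear_maps K (tensor K B A) (tensor K A B)"
    and Q1: "\<And>h g a. \<lbrakk>h \<in> carrier B; g \<in> carrier B; a \<in> carrier A\<rbrakk> \<Longrightarrow>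
      R (pure K B A (h \<otimes>\<^bsub>B\<^esub> g) a) = tensor_lift K (tensor K A B)
        (\<lambda>c g'. mult_right_factor K A B g' (R (pure K B A h c))) (R (pure K B A g a))"
    and Q2: "\<And>h a a'. \<lbrakk>h \<in> carrier B; a \<in> carrier A; a' \<in> carrier A\<rbrakk> \<Longrightarrow>
      R (pure K B A h (a \<otimes>\<^bsub>A\<^esub> a')) = tensor_lift K (tensor K A B)
        (\<lambda>c g. mult_left_factor K A B c (R (pure K B A g a'))) (R (pure K B A h a))"
  shows "quasitriangular K A B R"
proof -
  let ?T = "tensor K A B" and ?l = "mult_left_factor K A B" and ?r = "mult_right_factor K A B"
  note left_bil = mult_left_factor_bilinear[OF A B multA multB]
    and right_bil = mult_right_factor_bilinear[OF A B multA multB]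
  note T = module_tensor[OF A B] and AA = module_tensor[OF A A] and BA = module_tensor[OF B A]
    and BB = module_tensor[OF B B]
  note mods = A B AA T BA BB module_tensor[OF BB A] module_tensor[OF BA A] module_tensor[OF T A]
    module_tensor[OF T B] module_tensor[OF BA B] module_tensor[OF AA B]
  note mmA = mult_map_linear[OF A B multA multB] and mmB = mult_map_linear[OF B A multB multA]
  note lins = R mmA mmB lin_id'
  note cls = pure_closed lin_closed[OF R] mods bilin_closed[OF multA]
    bilin_closed[OF multB]
  have closedR: "R (pure K B A b a) \<in> carrier ?T" if "a \<in> carrier A" "b \<in> carrier B" for a b
    by (intro cls that)
  define C3 where "C3 = tensor_map K A B id (mult_map K B) \<circ> assoc_right K A B B"
  have C3: "C3 \<in> linear_maps K (tensor K ?T B) ?T"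
    unfolding C3_def comp_def
    by (rule lin_compose[OF tensor_map_linear assoc_right_linear]) (intro mods lins)+
  have C3_pure: "C3 (pure K ?T B z g) = ?r g z"
    if z: "z \<in> carrier ?T" and g: "g \<in> carrier B" for z g
  proof (rule tensor_ext[OF A B T _ _ _ z])
    show "(\<lambda>z. C3 (pure K ?T B z g)) \<in> linear_maps K ?T ?T"
      by (rule lin_compose[OF C3 bilin_left[OF pure_bilinear[OF T B] g lin_id]])
    show "(\<lambda>z. ?r g z) \<in> linear_maps K ?T ?T"
      by (rule bilin_right[OF right_bil g lin_id])
    show "C3 (pure K ?T B (pure K A B u v) g) = ?r g (pure K A B u v)"
      if uv: "u \<in> carrier A" "v \<in> carrier B" for u v
      by (simp add: C3_def assoc_right_pure[OF A B B uv g] mult_right_factor_pure[OF A B multA multB g uv]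
          tensor_map_pure[OF A BB A B lin_id' mmB uv(1)]
          pure_closed[OF B B] uv g mult_map_pure[OF B A multB multA])
  qed
  define C2 where "C2 = C3 \<circ> (tensor_map K ?T B R id \<circ> assoc_left K B A B)"
  have C2: "C2 \<in> linear_maps K (tensor K B ?T) ?T"
    unfolding C2_def comp_def
    by (rule lin_compose[OF C3], rule lin_compose[OF tensor_map_linear assoc_left_linear])
       (intro mods lins)+
  have C2_bil: "(\<lambda>c g. ?r g (R (pure K B A h c))) \<in> bilinear_maps K A B ?T"
    if h: "h \<in> carrier B" for h
    by (intro bilinear_mapsI bilin_left[OF right_bil]
        bilin_right[OF right_bil] lin_id closedR
        lin_compose[OF R] bilin_right[OF pure_bilinear[OF B A]] h)
  have C2_pure: "C2 (pure K B ?T h y) =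
      tensor_lift K ?T (\<lambda>c g. ?r g (R (pure K B A h c))) y"
    if y: "y \<in> carrier ?T" and h: "h \<in> carrier B" for h y
  proof (rule tensor_ext[OF A B T _ _ _ y])
    show "(\<lambda>y. C2 (pure K B ?T h y)) \<in> linear_maps K ?T ?T"
      by (rule lin_compose[OF C2 bilin_right[OF pure_bilinear[OF B T] h lin_id]])
    show "tensor_lift K ?T (\<lambda>c g. ?r g (R (pure K B A h c))) \<in> linear_maps K ?T ?T"
      by (rule tensor_lift_linear[OF A B T C2_bil[OF h]])
    show "C2 (pure K B ?T h (pure K A B c g)) =
        tensor_lift K ?T (\<lambda>c g. ?r g (R (pure K B A h c))) (pure K A B c g)"
      if cg: "c \<in> carrier A" "g \<in> carrier B" for c g
      by (simp add: C2_def assoc_left_pure[OF B A B h cg] tensor_lift_pure[OF A B T C2_bil[OF h] cg]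
          tensor_map_pure[OF BA B T B R lin_id' pure_closed[OF B A h cg(1)] cg(2)]
          C3_pure[OF closedR[OF cg(1) h] cg(2)])
  qed
  define C1 where "C1 = C2 \<circ> (tensor_map K B ?T id R \<circ> assoc_right K B B A)"
  have C1: "C1 \<in> linear_maps K (tensor K (tensor K B B) A) ?T"
    unfolding C1_def comp_def
    by (rule lin_compose[OF C2], rule lin_compose[OF tensor_map_linear assoc_right_linear])
       (intro mods lins)+
  have L1: "(\<lambda>x. R (tensor_map K B A (mult_map K B) id x)) \<in>
      linear_maps K (tensor K (tensor K B B) A) ?T"
    by (rule lin_compose[OF R], rule tensor_map_linear) (intro mods lins)+
  have first: "R (tensor_map K B A (mult_map K B) id x) = C1 x"
    if x: "x \<in> carrier (tensor K (tensor K B B) A)" for x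
  proof (rule tensor_ext[OF BB A T L1 C1 _ x])
    fix s a assume s: "s \<in> carrier (tensor K B B)" and a: "a \<in> carrier A"
    note pl = bilin_left[OF pure_bilinear[OF BB A] a lin_id]
    show "R (tensor_map K B A (mult_map K B) id (pure K (tensor K B B) A s a)) =
      C1 (pure K (tensor K B B) A s a)"
    proof (rule tensor_ext[OF B B T lin_compose[OF L1 pl] lin_compose[OF C1 pl] _ s])
      fix h g assume h: "h \<in> carrier B" and g: "g \<in> carrier B"
      show "R (tensor_map K B A (mult_map K B) id (pure K (tensor K B B) A (pure K B B h g) a)) =
        C1 (pure K (tensor K B B) A (pure K B B h g) a)"
        by (simp add: C1_def assoc_right_pure[OF B B A h g a]
            tensor_map_pure[OF BB A B A mmB lin_id' pure_closed[OF B B h g] a]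
            tensor_map_pure[OF B BA B T lin_id' R h pure_closed[OF B A g a]]
            mult_map_pure[OF B A multB multA h g] C2_pure[OF closedR[OF a g] h] Q1[OF h g a])
    qed
  qed
  define D3 where "D3 = tensor_map K A B (mult_map K A) id \<circ> assoc_left K A A B"
  have D3: "D3 \<in> linear_maps K (tensor K A ?T) ?T"
    unfolding D3_def comp_def
    by (rule lin_compose[OF tensor_map_linear assoc_left_linear]) (intro mods lins)+
  have D3_pure: "D3 (pure K A ?T c z) = ?l c z"
    if z: "z \<in> carrier ?T" and c: "c \<in> carrier A" for z c
  proof (rule tensor_ext[OF A B T _ _ _ z])
    show "(\<lambda>z. D3 (pure K A ?T c z)) \<in> linear_maps K ?T ?T"
      by (rule lin_compose[OF D3 bilin_right[OF pure_bilinear[OF A T] c lin_id]])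
    show "(\<lambda>z. ?l c z) \<in> linear_maps K ?T ?T"
      by (rule bilin_right[OF left_bil c lin_id])
    show "D3 (pure K A ?T c (pure K A B u v)) = ?l c (pure K A B u v)"
      if uv: "u \<in> carrier A" "v \<in> carrier B" for u v
      by (simp add: D3_def assoc_left_pure[OF A A B c uv] mult_left_factor_pure[OF A B multA multB c uv]
          tensor_map_pure[OF AA B A B mmA lin_id' _ uv(2)]
          pure_closed[OF A A] uv c mult_map_pure[OF A B multA multB])
  qed
  define D2 where "D2 = D3 \<circ> (tensor_map K A ?T id R \<circ> assoc_right K A B A)"
  have D2: "D2 \<in> linear_maps K (tensor K ?T A) ?T"
    unfolding D2_def comp_def
    by (rule lin_compose[OF D3], rule lin_compose[OF tensor_map_linear assoc_right_linear])
       (intro mods lins)+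
  have D2_bil: "(\<lambda>c g. ?l c (R (pure K B A g a))) \<in> bilinear_maps K A B ?T"
    if a: "a \<in> carrier A" for a
    by (intro bilinear_mapsI bilin_left[OF left_bil]
        bilin_right[OF left_bil] lin_id closedR
        lin_compose[OF R] bilin_left[OF pure_bilinear[OF B A]] a)
  have D2_pure: "D2 (pure K ?T A y a) =
      tensor_lift K ?T (\<lambda>c g. ?l c (R (pure K B A g a))) y"
    if y: "y \<in> carrier ?T" and a: "a \<in> carrier A" for a y
  proof (rule tensor_ext[OF A B T _ _ _ y])
    show "(\<lambda>y. D2 (pure K ?T A y a)) \<in> linear_maps K ?T ?T"
      by (rule lin_compose[OF D2 bilin_left[OF pure_bilinear[OF T A] a lin_id]])
    show "tensor_lift K ?T (\<lambda>c g. ?l c (R (pure K B A g a))) \<in> linear_maps K ?T ?T"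
      by (rule tensor_lift_linear[OF A B T D2_bil[OF a]])
    show "D2 (pure K ?T A (pure K A B c g) a) =
        tensor_lift K ?T (\<lambda>c g. ?l c (R (pure K B A g a))) (pure K A B c g)"
      if cg: "c \<in> carrier A" "g \<in> carrier B" for c g
      by (simp add: D2_def assoc_right_pure[OF A B A cg a] tensor_lift_pure[OF A B T D2_bil[OF a] cg]
          tensor_map_pure[OF A BA A T lin_id' R cg(1) pure_closed[OF B A cg(2) a]]
          D3_pure[OF closedR[OF a cg(2)] cg(1)])
  qed
  define D1 where "D1 = D2 \<circ> tensor_map K ?T A R id"
  have D1: "D1 \<in> linear_maps K (tensor K (tensor K B A) A) ?T"
    unfolding D1_def comp_def
    by (rule lin_compose[OF D2], rule tensor_map_linear) (intro mods lins)+
  have L2: "(\<lambda>x. R (tensor_map K B A id (mult_map K A) (assoc_right K B A A x))) \<in>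
      linear_maps K (tensor K (tensor K B A) A) ?T"
    by (rule lin_compose[OF R], rule lin_compose[OF tensor_map_linear assoc_right_linear])
       (intro mods lins)+
  have second: "R (tensor_map K B A id (mult_map K A) (assoc_right K B A A x)) = D1 x"
    if x: "x \<in> carrier (tensor K (tensor K B A) A)" for x
  proof (rule tensor_ext[OF BA A T L2 D1 _ x])
    fix s a' assume s: "s \<in> carrier (tensor K B A)" and a': "a' \<in> carrier A"
    note pl = bilin_left[OF pure_bilinear[OF BA A] a' lin_id]
    show "R (tensor_map K B A id (mult_map K A) (assoc_right K B A A (pure K (tensor K B A) A s a'))) =
      D1 (pure K (tensor K B A) A s a')"
    proof (rule tensor_ext[OF B A T lin_compose[OF L2 pl] lin_compose[OF D1 pl] _ s])
      fix h a assume h: "h \<in> carrier B" and a: "a \<in> carrier A"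
      show "R (tensor_map K B A id (mult_map K A)
            (assoc_right K B A A (pure K (tensor K B A) A (pure K B A h a) a'))) =
        D1 (pure K (tensor K B A) A (pure K B A h a) a')"
        by (simp add: D1_def assoc_right_pure[OF B A A h a a']
            tensor_map_pure[OF B AA B A lin_id' mmA h pure_closed[OF A A a a']]
            tensor_map_pure[OF BA A T A R lin_id' pure_closed[OF B A h a] a']
            mult_map_pure[OF A B multA multB a a'] D2_pure[OF closedR[OF a h] a'] Q2[OF h a a'])
    qed
  qed
  show ?thesis
    unfolding quasitriangular_def
    using first second
    by (simp add: C1_def C2_def C3_def D1_def D2_def D3_def comp_assoc)
qed

section \<open>Sweedler notation in two coalgebras\<close>

text \<open>
  Sweedler notation for the tensor product coalgebra \<open>C \<otimes> D\<close>, as a function of its two factors: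
  \<open>f(c\<^sub>(\<^sub>1\<^sub>), d\<^sub>(\<^sub>1\<^sub>), c\<^sub>(\<^sub>2\<^sub>), d\<^sub>(\<^sub>2\<^sub>))\<close>. The two actions of a matched pair always split \<open>h\<close> and \<open>b\<close> together, and
  the coassociativity and counit laws hold for the pair as they do for one element.
\<close>

definition sweedler2 ::
  "('k, 'm) ring_scheme \<Rightarrow> ('k, 'c, 'n) hopf_scheme \<Rightarrow> ('k, 'd, 'p) hopf_scheme \<Rightarrow>
   ('k, 'u, 'q) module_scheme \<Rightarrow> ('c \<Rightarrow> 'd \<Rightarrow> 'c \<Rightarrow> 'd \<Rightarrow> 'u) \<Rightarrow> 'c \<Rightarrow> 'd \<Rightarrow> 'u"
  where "sweedler2 K C D U f c d =
    sweedler K C U (\<lambda>c1 c2. sweedler K D U (\<lambda>d1 d2. f c1 d1 c2 d2) d) c"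

definition quadlinear_maps ::
  "('k, 'm) ring_scheme \<Rightarrow> ('k, 'c, 'n) hopf_scheme \<Rightarrow> ('k, 'd, 'p) hopf_scheme \<Rightarrow>
   ('k, 'u, 'q) module_scheme \<Rightarrow> ('c \<Rightarrow> 'd \<Rightarrow> 'c \<Rightarrow> 'd \<Rightarrow> 'u) set"
  where "quadlinear_maps K C D U = {f.
    (\<forall>b \<in> carrier D. \<forall>c \<in> carrier C. \<forall>d \<in> carrier D. (\<lambda>a. f a b c d) \<in> linear_maps K C U) \<and>
    (\<forall>a \<in> carrier C. \<forall>c \<in> carrier C. \<forall>d \<in> carrier D. (\<lambda>b. f a b c d) \<in> linear_maps K D U) \<and>
    (\<forall>a \<in> carrier C. \<forall>b \<in> carrier D. \<forall>d \<in> carrier D. (\<lambda>c. f a b c d) \<in> linear_maps K C U) \<and>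
    (\<forall>a \<in> carrier C. \<forall>b \<in> carrier D. \<forall>c \<in> carrier C. (\<lambda>d. f a b c d) \<in> linear_maps K D U)}"

lemma quadlinear_mapsI:
  assumes "\<And>b c d. \<lbrakk>b \<in> carrier D; c \<in> carrier C; d \<in> carrier D\<rbrakk> \<Longrightarrow> (\<lambda>a. f a b c d) \<in> linear_maps K C U"
    and "\<And>a c d. \<lbrakk>a \<in> carrier C; c \<in> carrier C; d \<in> carrier D\<rbrakk> \<Longrightarrow> (\<lambda>b. f a b c d) \<in> linear_maps K D U"
    and "\<And>a b d. \<lbrakk>a \<in> carrier C; b \<in> carrier D; d \<in> carrier D\<rbrakk> \<Longrightarrow> (\<lambda>c. f a b c d) \<in> linear_maps K C U"
    and "\<And>a b c. \<lbrakk>a \<in> carrier C; b \<in> carrier D; c \<in> carrier C\<rbrakk> \<Longrightarrow> (\<lambda>d. f a b c d) \<in> linear_maps K D U"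
  shows "f \<in> quadlinear_maps K C D U"
  using assms by (auto simp: quadlinear_maps_def)

lemma quadlinear_mapsD:
  assumes "f \<in> quadlinear_maps K C D U"
  shows "\<lbrakk>b \<in> carrier D; c \<in> carrier C; d \<in> carrier D\<rbrakk> \<Longrightarrow> (\<lambda>a. f a b c d) \<in> linear_maps K C U"
    and "\<lbrakk>a \<in> carrier C; c \<in> carrier C; d \<in> carrier D\<rbrakk> \<Longrightarrow> (\<lambda>b. f a b c d) \<in> linear_maps K D U"
    and "\<lbrakk>a \<in> carrier C; b \<in> carrier D; d \<in> carrier D\<rbrakk> \<Longrightarrow> (\<lambda>c. f a b c d) \<in> linear_maps K C U"
    and "\<lbrakk>a \<in> carrier C; b \<in> carrier D; c \<in> carrier C\<rbrakk> \<Longrightarrow> (\<lambda>d. f a b c d) \<in> linear_maps K D U"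
    and "\<lbrakk>a \<in> carrier C; b \<in> carrier D; c \<in> carrier C; d \<in> carrier D\<rbrakk> \<Longrightarrow> f a b c d \<in> carrier U"
  using assms lin_closed[of "\<lambda>a. f a b c d" K C U]
  by (auto simp: quadlinear_maps_def)

context
  fixes K :: "('k, 'm) ring_scheme" and C :: "('k, 'c, 'n) hopf_scheme"
    and D :: "('k, 'd, 'p) hopf_scheme" and U :: "('k, 'u, 'q) module_scheme"
  assumes C: "coalgebra K C" and D: "coalgebra K D" and U: "module K U"
begin

interpretation C: coalgebra K C by (fact C)
interpretation D: coalgebra K D by (fact D)

private lemmas mods2 = C.module_axioms D.module_axioms U C D

private lemma inner2:
  assumes "f \<in> quadlinear_maps K C D U"
  shows "\<lbrakk>c1 \<in> carrier C; c2 \<in> carrier C\<rbrakk> \<Longrightarrow> (\<lambda>d1 d2. f c1 d1 c2 d2) \<in> bilinear_maps K D D U"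
    and "\<lbrakk>d1 \<in> carrier D; d2 \<in> carrier D\<rbrakk> \<Longrightarrow> (\<lambda>c1 c2. f c1 d1 c2 d2) \<in> bilinear_maps K C C U"
  by (intro bilinear_mapsI quadlinear_mapsD[OF assms]; assumption)+

private lemma outer2:
  assumes "f \<in> quadlinear_maps K C D U" "d \<in> carrier D"
  shows "(\<lambda>c1 c2. sweedler K D U (\<lambda>d1 d2. f c1 d1 c2 d2) d) \<in> bilinear_maps K C C U"
  by (intro bilinear_mapsI sweedler_param inner2[OF assms(1)] quadlinear_mapsD[OF assms(1)] mods2 assms(2))

lemma sweedler2_linear_left:
  assumes "f \<in> quadlinear_maps K C D U" "d \<in> carrier D" "g \<in> linear_maps K Y C"
  shows "(\<lambda>x. sweedler2 K C D U f (g x) d) \<in> linear_maps K Y U"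
  unfolding sweedler2_def by (intro sweedler_linear outer2 mods2 assms)

lemma sweedler2_linear_right:
  assumes "f \<in> quadlinear_maps K C D U" "c \<in> carrier C" "g \<in> linear_maps K Y D" "module K Y"
  shows "(\<lambda>x. sweedler2 K C D U f c (g x)) \<in> linear_maps K Y U"
  unfolding sweedler2_def
  by (rule sweedler_param)
     (assumption | intro mods2 assms sweedler_linear outer2 inner2[OF assms(1)] lin_closed[OF assms(3)])+

lemma sweedler2_closed:
  assumes "f \<in> quadlinear_maps K C D U" "c \<in> carrier C" "d \<in> carrier D"
  shows "sweedler2 K C D U f c d \<in> carrier U"
  unfolding sweedler2_def by (intro sweedler_closed outer2 mods2 assms)

lemma sweedler2_param:
  assumes "module K Y" "c \<in> carrier C" "d \<in> carrier D"
    and f: "\<And>y. y \<in> carrier Y \<Longrightarrow> f y \<in> quadlinear_maps K C D U"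
    and "\<And>c1 d1 c2 d2. \<lbrakk>c1 \<in> carrier C; d1 \<in> carrier D; c2 \<in> carrier C; d2 \<in> carrier D\<rbrakk> \<Longrightarrow>
      (\<lambda>y. f y c1 d1 c2 d2) \<in> linear_maps K Y U"
  shows "(\<lambda>y. sweedler2 K C D U (f y) c d) \<in> linear_maps K Y U"
  unfolding sweedler2_def by (intro sweedler_param mods2 assms(1-3,5) outer2 inner2 f)

lemma sweedler2_cong:
  assumes "c \<in> carrier C" "d \<in> carrier D" "f \<in> quadlinear_maps K C D U"
    and "\<And>c1 d1 c2 d2. \<lbrakk>c1 \<in> carrier C; d1 \<in> carrier D; c2 \<in> carrier C; d2 \<in> carrier D\<rbrakk> \<Longrightarrow>
      f c1 d1 c2 d2 = g c1 d1 c2 d2"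
  shows "sweedler2 K C D U f c d = sweedler2 K C D U g c d"
  unfolding sweedler2_def
  by (rule sweedler_cong[OF C U assms(1) outer2[OF assms(3,2)]],
      rule sweedler_cong[OF D U assms(2) inner2(1)[OF assms(3)]])
     (use assms(4) in auto)

lemma linear_map_sweedler2:
  assumes "module K U'" "\<phi> \<in> linear_maps K U U'" "f \<in> quadlinear_maps K C D U"
    "c \<in> carrier C" "d \<in> carrier D"
  shows "\<phi> (sweedler2 K C D U f c d) =
    sweedler2 K C D U' (\<lambda>c1 d1 c2 d2. \<phi> (f c1 d1 c2 d2)) c d"
  unfolding sweedler2_def
  unfolding linear_map_sweedler[OF C U assms(1,2) outer2[OF assms(3,5)] assms(4)]
proof (rule sweedler_cong[OF C assms(1,4)])
  show "(\<lambda>y z. \<phi> (sweedler K D U (\<lambda>d1 d2. f y d1 z d2) d)) \<in> bilinear_maps K C C U'"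
    by (intro bilinear_mapsI lin_compose[OF assms(2)] bilin_left[OF outer2[OF assms(3,5)]]
        bilin_right[OF outer2[OF assms(3,5)]] lin_id)
  show "\<phi> (sweedler K D U (\<lambda>d1 d2. f y d1 z d2) d) = sweedler K D U' (\<lambda>d1 d2. \<phi> (f y d1 z d2)) d"
    if "y \<in> carrier C" "z \<in> carrier C" for y z
    by (rule linear_map_sweedler[OF D U assms(1,2) inner2(1)[OF assms(3) that] assms(5)])
qed

lemma sweedler_sweedler2_swap:
  fixes E :: "('k, 'e, 'r) hopf_scheme"
  assumes E: "coalgebra K E" and "c \<in> carrier C" "d \<in> carrier D" "e \<in> carrier E"
    and f: "\<And>e1 e2. \<lbrakk>e1 \<in> carrier E; e2 \<in> carrier E\<rbrakk> \<Longrightarrow> f e1 e2 \<in> quadlinear_maps K C D U"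
    and f': "\<And>c1 d1 c2 d2. \<lbrakk>c1 \<in> carrier C; d1 \<in> carrier D; c2 \<in> carrier C; d2 \<in> carrier D\<rbrakk> \<Longrightarrow>
      (\<lambda>e1 e2. f e1 e2 c1 d1 c2 d2) \<in> bilinear_maps K E E U"
  shows "sweedler2 K C D U (\<lambda>c1 d1 c2 d2. sweedler K E U (\<lambda>e1 e2. f e1 e2 c1 d1 c2 d2) e) c d =
    sweedler K E U (\<lambda>e1 e2. sweedler2 K C D U (f e1 e2) c d) e"
proof -
  interpret E: coalgebra K E by (fact E)
  note f'' = bilin_left[OF f' _ lin_id] bilin_right[OF f' _ lin_id]
  have q: "(\<lambda>c1 d1 c2 d2. sweedler K E U (\<lambda>e1 e2. f e1 e2 c1 d1 c2 d2) e) \<in> quadlinear_maps K C D U"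
    by (intro quadlinear_mapsI sweedler_param E.module_axioms mods2 E assms(2-4) f' quadlinear_mapsD[OF f])
  have "sweedler K D U (\<lambda>d1 d2. sweedler K E U (\<lambda>e1 e2. f e1 e2 c1 d1 c2 d2) e) d =
      sweedler K E U (\<lambda>e1 e2. sweedler K D U (\<lambda>d1 d2. f e1 e2 c1 d1 c2 d2) d) e"
    if "c1 \<in> carrier C" "c2 \<in> carrier C" for c1 c2
    by (rule sweedler_swap[OF D U E assms(3,4)]) (assumption | intro f' inner2[OF f] that)+
  then have "sweedler2 K C D U (\<lambda>c1 d1 c2 d2. sweedler K E U (\<lambda>e1 e2. f e1 e2 c1 d1 c2 d2) e) c d =
    sweedler K C U (\<lambda>c1 c2. sweedler K E U (\<lambda>e1 e2. sweedler K D U (\<lambda>d1 d2. f e1 e2 c1 d1 c2 d2) d) e) c"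
    unfolding sweedler2_def by (intro sweedler_cong[OF C U assms(2) outer2[OF q assms(3)]])
  also have "\<dots> = sweedler K E U (\<lambda>e1 e2. sweedler K C U (\<lambda>c1 c2. sweedler K D U (\<lambda>d1 d2. f e1 e2 c1 d1 c2 d2) d) c) e"
    by (rule sweedler_swap[OF C U E assms(2,4)])
       (assumption | intro outer2 f assms(3) bilinear_mapsI sweedler_param E.module_axioms mods2 f'' inner2(1)[OF f])+
  finally show ?thesis by (simp add: sweedler2_def)
qed

lemma sweedler2_counit_left:
  assumes f: "f \<in> bilinear_maps K C D U" and "c \<in> carrier C" "d \<in> carrier D"
  shows "sweedler2 K C D U (\<lambda>c1 d1 c2 d2. (counit C c1 \<otimes>\<^bsub>K\<^esub> counit D d1) \<odot>\<^bsub>U\<^esub> f c2 d2) c d = f c d"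
proof -
  interpret U: module K U by (fact U)
  note epsC = C.counit_closed and epsD = D.counit_closed
    and lC = C.counit_scale_linear[OF U] and lD = D.counit_scale_linear[OF U]
  note fl = bilin_left[OF f _ lin_id] bilin_right[OF f _ lin_id]
    bilin_closed[OF f]
  have "sweedler K D U (\<lambda>d1 d2. (counit C c1 \<otimes>\<^bsub>K\<^esub> counit D d1) \<odot>\<^bsub>U\<^esub> f c2 d2) d = counit C c1 \<odot>\<^bsub>U\<^esub> f c2 d"
    if c: "c1 \<in> carrier C" "c2 \<in> carrier C" for c1 c2
  proof -
    have "sweedler K D U (\<lambda>d1 d2. (counit C c1 \<otimes>\<^bsub>K\<^esub> counit D d1) \<odot>\<^bsub>U\<^esub> f c2 d2) d =
        sweedler K D U (\<lambda>d1 d2. counit D d1 \<odot>\<^bsub>U\<^esub> (counit C c1 \<odot>\<^bsub>U\<^esub> f c2 d2)) d"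
      by (rule sweedler_cong[symmetric, OF D U assms(3)])
         (assumption | intro bilinear_mapsI lD lin_scale U epsD epsC fl U.smult_closed c |
           simp add: U.smult_assoc1[symmetric] epsC epsD c fl C.m_comm)+
    also have "\<dots> = counit C c1 \<odot>\<^bsub>U\<^esub> f c2 d"
      by (rule sweedler_counit_left[OF D U]) (intro lin_scale U epsC fl c assms(3))+
    finally show ?thesis .
  qed
  then have "sweedler2 K C D U (\<lambda>c1 d1 c2 d2. (counit C c1 \<otimes>\<^bsub>K\<^esub> counit D d1) \<odot>\<^bsub>U\<^esub> f c2 d2) c d =
    sweedler K C U (\<lambda>c1 c2. counit C c1 \<odot>\<^bsub>U\<^esub> f c2 d) c"
    unfolding sweedler2_def
    by (intro sweedler_cong[symmetric, OF C U assms(2)])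
       (assumption | intro bilinear_mapsI lC lin_scale U epsC fl assms(3) | simp)+
  also have "\<dots> = f c d"
    by (rule sweedler_counit_left[OF C U]) (intro fl assms)+
  finally show ?thesis .
qed

lemma sweedler2_counit_right:
  assumes f: "f \<in> bilinear_maps K C D U" and "c \<in> carrier C" "d \<in> carrier D"
  shows "sweedler2 K C D U (\<lambda>c1 d1 c2 d2. (counit C c2 \<otimes>\<^bsub>K\<^esub> counit D d2) \<odot>\<^bsub>U\<^esub> f c1 d1) c d = f c d"
proof -
  interpret U: module K U by (fact U)
  note epsC = C.counit_closed and epsD = D.counit_closed
    and lC = C.counit_scale_linear[OF U] and lD = D.counit_scale_linear[OF U]
  note fl = bilin_left[OF f _ lin_id] bilin_right[OF f _ lin_id]
    bilin_closed[OF f]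
  have "sweedler K D U (\<lambda>d1 d2. (counit C c2 \<otimes>\<^bsub>K\<^esub> counit D d2) \<odot>\<^bsub>U\<^esub> f c1 d1) d = counit C c2 \<odot>\<^bsub>U\<^esub> f c1 d"
    if c: "c1 \<in> carrier C" "c2 \<in> carrier C" for c1 c2
  proof -
    have "sweedler K D U (\<lambda>d1 d2. (counit C c2 \<otimes>\<^bsub>K\<^esub> counit D d2) \<odot>\<^bsub>U\<^esub> f c1 d1) d =
        sweedler K D U (\<lambda>d1 d2. counit D d2 \<odot>\<^bsub>U\<^esub> (counit C c2 \<odot>\<^bsub>U\<^esub> f c1 d1)) d"
      by (rule sweedler_cong[symmetric, OF D U assms(3)])
         (assumption | intro bilinear_mapsI lD lin_scale U epsD epsC fl U.smult_closed c |
           simp add: U.smult_assoc1[symmetric] epsC epsD c fl C.m_comm)+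
    also have "\<dots> = counit C c2 \<odot>\<^bsub>U\<^esub> f c1 d"
      by (rule sweedler_counit_right[OF D U]) (intro lin_scale U epsC fl c assms(3))+
    finally show ?thesis .
  qed
  then have "sweedler2 K C D U (\<lambda>c1 d1 c2 d2. (counit C c2 \<otimes>\<^bsub>K\<^esub> counit D d2) \<odot>\<^bsub>U\<^esub> f c1 d1) c d =
    sweedler K C U (\<lambda>c1 c2. counit C c2 \<odot>\<^bsub>U\<^esub> f c1 d) c"
    unfolding sweedler2_def
    by (intro sweedler_cong[symmetric, OF C U assms(2)])
       (assumption | intro bilinear_mapsI lC lin_scale U epsC fl assms(3) | simp)+
  also have "\<dots> = f c d"
    by (rule sweedler_counit_right[OF C U]) (intro fl assms)+
  finally show ?thesis .
qed

text \<open>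
  The sums over \<open>C\<close> and \<open>D\<close> are interchanged until both splittings of \<open>c\<close> are outermost, then
  the coassociativity of \<open>C\<close> and of \<open>D\<close> apply one after the other.
\<close>

lemma sweedler2_coassoc:
  assumes c: "c \<in> carrier C" and d: "d \<in> carrier D"
    and f: "\<And>c1 d1. \<lbrakk>c1 \<in> carrier C; d1 \<in> carrier D\<rbrakk> \<Longrightarrow>
        (\<lambda>c2 d2 c3 d3. f c1 d1 c2 d2 c3 d3) \<in> quadlinear_maps K C D U"
    and g: "\<And>c3 d3. \<lbrakk>c3 \<in> carrier C; d3 \<in> carrier D\<rbrakk> \<Longrightarrow>
        (\<lambda>c1 d1 c2 d2. f c1 d1 c2 d2 c3 d3) \<in> quadlinear_maps K C D U"
  shows "sweedler2 K C D U (\<lambda>c1 d1 c3 d3. sweedler2 K C D U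
      (\<lambda>c1 d1 c2 d2. f c1 d1 c2 d2 c3 d3) c1 d1) c d =
    sweedler2 K C D U (\<lambda>c1 d1 c2 d2. sweedler2 K C D U
      (\<lambda>c2 d2 c3 d3. f c1 d1 c2 d2 c3 d3) c2 d2) c d"
proof -
  note lins = quadlinear_mapsD(1-4)[OF f] quadlinear_mapsD(1-4)[OF g]
  note rules = bilinear_mapsI sweedler_param sweedler_linear lins lin_id mods2
  let ?D = "sweedler K D U" and ?C = "sweedler K C U"
  have L: "?D (\<lambda>d1 d3. ?C (\<lambda>c1 c2. ?D (\<lambda>d1 d2. f c1 d1 c2 d2 c3 d3) d1) c1) d =
      ?C (\<lambda>c1 c2. ?D (\<lambda>d1 d3. ?D (\<lambda>d1 d2. f c1 d1 c2 d2 c3 d3) d1) d) c1"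
    if "c1 \<in> carrier C" "c3 \<in> carrier C" for c1 c3
    by (rule sweedler_swap[OF D U C d that(1)]) (assumption | rule that | rule rules)+
  have R: "?D (\<lambda>d1 d2. ?C (\<lambda>c2 c3. ?D (\<lambda>d2 d3. f c1 d1 c2 d2 c3 d3) d2) c2) d =
      ?C (\<lambda>c2 c3. ?D (\<lambda>d1 d2. ?D (\<lambda>d2 d3. f c1 d1 c2 d2 c3 d3) d2) d) c2"
    if "c1 \<in> carrier C" "c2 \<in> carrier C" for c1 c2
    by (rule sweedler_swap[OF D U C d that(2)]) (assumption | rule that | rule rules)+
  have M: "?D (\<lambda>d1 d3. ?D (\<lambda>d1 d2. f c1 d1 c2 d2 c3 d3) d1) d =
      ?D (\<lambda>d1 d2. ?D (\<lambda>d2 d3. f c1 d1 c2 d2 c3 d3) d2) d"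
    if "c1 \<in> carrier C" "c2 \<in> carrier C" "c3 \<in> carrier C" for c1 c2 c3
    by (rule sweedler_coassoc[OF D U d]) (assumption | rule that | rule rules)+
  have "sweedler2 K C D U (\<lambda>c1 d1 c3 d3. sweedler2 K C D U
      (\<lambda>c1 d1 c2 d2. f c1 d1 c2 d2 c3 d3) c1 d1) c d =
    ?C (\<lambda>c1 c3. ?C (\<lambda>c1 c2. ?D (\<lambda>d1 d3. ?D (\<lambda>d1 d2. f c1 d1 c2 d2 c3 d3) d1) d) c1) c"
    unfolding sweedler2_def
    by (rule sweedler_cong[OF C U c _ L]) (assumption | rule d | rule rules)+
  also have "\<dots> = ?C (\<lambda>c1 c2. ?C (\<lambda>c2 c3. ?D (\<lambda>d1 d3. ?D (\<lambda>d1 d2. f c1 d1 c2 d2 c3 d3) d1) d) c2) c"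
    by (rule sweedler_coassoc[OF C U c]) (assumption | rule d | rule rules)+
  also have "\<dots> = ?C (\<lambda>c1 c2. ?C (\<lambda>c2 c3. ?D (\<lambda>d1 d2. ?D (\<lambda>d2 d3. f c1 d1 c2 d2 c3 d3) d2) d) c2) c"
    by (rule sweedler_cong[OF C U c], (assumption | rule d | rule rules)+, rule sweedler_cong[OF C U])
       (assumption | rule d M | rule rules)+
  also have "\<dots> = ?C (\<lambda>c1 c2. ?D (\<lambda>d1 d2. ?C (\<lambda>c2 c3. ?D (\<lambda>d2 d3. f c1 d1 c2 d2 c3 d3) d2) c2) d) c"
    by (rule sweedler_cong[OF C U c _ R[symmetric]]) (assumption | rule d | rule rules)+
  finally show ?thesis unfolding sweedler2_def .
qed

end

text \<open>
  The hypothesis on \<open>comult\<close> says that \<open>p\<close>, as a map from \<open>C \<otimes> D\<close> to \<open>E\<close>, is comultiplicative at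
  \<open>c \<otimes> d\<close>. The multiplication of a bialgebra and both actions of a matched pair are of this kind.
\<close>

lemma sweedler_comult:
  assumes C: "coalgebra K C" and D: "coalgebra K D" and E: "coalgebra K E" and U: "module K U"
    and f: "f \<in> bilinear_maps K E E U" and p: "p \<in> bilinear_maps K C D E"
    and c: "c \<in> carrier C" and d: "d \<in> carrier D"
    and comult: "comult E x = sweedler2 K C D (tensor K E E)
      (\<lambda>c1 d1 c2 d2. pure K E E (p c1 d1) (p c2 d2)) c d"
  shows "sweedler K E U f x = sweedler2 K C D U (\<lambda>c1 d1 c2 d2. f (p c1 d1) (p c2 d2)) c d"
proof -
  interpret E: coalgebra K E by (fact E)
  note mE = E.module_axioms
  note EE = module_tensor[OF mE mE]
  note pl = bilin_left[OF p _ lin_id] bilin_right[OF p _ lin_id]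
    bilin_closed[OF p]
  note P = pure_bilinear[OF mE mE]
  note rules = quadlinear_mapsI bilin_left[OF f] bilin_right[OF f]
    bilin_left[OF P] bilin_right[OF P] pl C D E U EE
  have "sweedler K E U f x = sweedler2 K C D U
      (\<lambda>c1 d1 c2 d2. tensor_lift K U f (pure K E E (p c1 d1) (p c2 d2))) c d"
    unfolding sweedler_def comult
    by (rule linear_map_sweedler2[OF C D EE U tensor_lift_linear[OF mE mE U f] _ c d]) (assumption | rule rules)+
  also have "\<dots> = sweedler2 K C D U (\<lambda>c1 d1 c2 d2. f (p c1 d1) (p c2 d2)) c d"
    by (rule sweedler2_cong[symmetric, OF C D U c d], (assumption | rule rules)+)
       (simp add: tensor_lift_pure[OF mE mE U f] pl)
  finally show ?thesis .
qed

section \<open>Matched pairs of Hopf algebras\<close>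

lemma (in assoc_algebra) bilinear_mult: "bilinear_mult K A"
  by (intro bilinear_mapsI linear_mapsI)
     (simp_all add: r_distr l_distr smult_mult_left smult_mult_right)

lemma (in bialgebra) sweedler_mult:
  assumes U: "module K U" and f: "f \<in> bilinear_maps K H H U" and x: "x \<in> carrier H" and y: "y \<in> carrier H"
  shows "sweedler K H U f (x \<otimes> y) =
    sweedler K H U (\<lambda>x1 x2. sweedler K H U (\<lambda>y1 y2. f (x1 \<otimes> y1) (x2 \<otimes> y2)) y) x"
  unfolding sweedler2_def[symmetric]
  by (rule sweedler_comult[OF coalgebra_axioms coalgebra_axioms coalgebra_axioms U f bilinear_mult x y])
     (simp add: comult_mult x y tensor_alg_def Let_def sweedler2_def sweedler_def)

lemma (in bialgebra) sweedler_one: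
  assumes U: "module K U" and f: "f \<in> bilinear_maps K H H U"
  shows "sweedler K H U f \<one> = f \<one> \<one>"
  by (simp add: sweedler_def comult_one tensor_alg_def Let_def
      tensor_lift_pure[OF module_axioms module_axioms U f])

context matched_pair_hopf
begin

abbreviation "T \<equiv> tensor K B H"

abbreviation "S2 U \<equiv> sweedler2 K H B U"

text \<open>
  \<open>cross h b\<close> is the product \<open>(1 \<otimes> h)(b \<otimes> 1)\<close> of the double crossproduct; the linear map that it
  induces is the required \<open>R\<close>.
\<close>

definition "cross h b = S2 T (\<lambda>h1 b1 h2 b2. pure K B H (h1 \<triangleright> b1) (h2 \<triangleleft> b2)) h b"

text \<open>
  Right multiplication by \<open>b \<otimes> 1\<close> in the double crossproduct: \<open>(c \<otimes> g)(b \<otimes> 1) = c\<cdot>cross g b\<close>. Together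
  with \<open>rmul_H\<close>, right multiplication by \<open>1 \<otimes> h\<close>, it generates all right multiplications, and
  associativity of the product turns into rules for composing these operators.
\<close>

definition "rmul_B b y = tensor_lift K T (\<lambda>c g. mult_left_factor K B H c (cross g b)) y"

abbreviation "rmul_H \<equiv> mult_right_factor K B H"
abbreviation "lmul_B \<equiv> mult_left_factor K B H"

lemmas mB = B.module_axioms
lemmas mH = H.module_axioms
lemmas coB = B.coalgebra_axioms
lemmas coH = H.coalgebra_axioms
lemmas T = module_tensor[OF mB mH]
lemmas HB = module_tensor[OF mH mB]

lemmas lmul_B_bilinear = mult_left_factor_bilinear[OF mB mH B.bilinear_mult H.bilinear_mult]
lemmas rmul_H_bilinear = mult_right_factor_bilinear[OF mB mH B.bilinear_mult H.bilinear_mult]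
lemmas lmul_B_pure = mult_left_factor_pure[OF mB mH B.bilinear_mult H.bilinear_mult]
lemmas rmul_H_pure = mult_right_factor_pure[OF mB mH B.bilinear_mult H.bilinear_mult]

text \<open>
  Syntax-directed rules that prove an expression in the operations of \<open>B\<close> and \<open>H\<close> linear in a
  variable, or a member of its carrier. They discharge the side conditions of the Sweedler calculus.
\<close>

lemmas multilinear_rules = bilinear_mapsI quadlinear_mapsI lin_id
  mB mH T HB coB coH
  bilin_left[OF pure_bilinear[OF mB mH]] bilin_right[OF pure_bilinear[OF mB mH]]
  bilin_left[OF pure_bilinear[OF mH mB]] bilin_right[OF pure_bilinear[OF mH mB]]
  pure_closed[OF mB mH] pure_closed[OF mH mB]
  bilin_left[OF B.bilinear_mult] bilin_right[OF B.bilinear_mult] B.m_closed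
  bilin_left[OF H.bilinear_mult] bilin_right[OF H.bilinear_mult] H.m_closed
  B.one_closed H.one_closed
  bilin_left[OF L.lact_bilinear] bilin_right[OF L.lact_bilinear]
  bilin_closed[OF L.lact_bilinear]
  bilin_left[OF R.ract_bilinear] bilin_right[OF R.ract_bilinear]
  bilin_closed[OF R.ract_bilinear]
  lin_compose[OF B.antipode_linear] lin_closed[OF B.antipode_linear]
  lin_compose[OF H.antipode_linear] lin_closed[OF H.antipode_linear]
  bilin_left[OF lmul_B_bilinear] bilin_right[OF lmul_B_bilinear] bilin_closed[OF lmul_B_bilinear]
  bilin_left[OF rmul_H_bilinear] bilin_right[OF rmul_H_bilinear] bilin_closed[OF rmul_H_bilinear]
  sweedler_linear[OF coB] sweedler_param[OF coB] sweedler_closed[OF coB]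
  sweedler_linear[OF coH] sweedler_param[OF coH] sweedler_closed[OF coH]
  sweedler2_linear_left[OF coH coB] sweedler2_linear_right[OF coH coB]
  sweedler2_param[OF coH coB] sweedler2_closed[OF coH coB]
  tensor_lift_linear[OF mB mH] lin_compose[OF tensor_lift_linear[OF mB mH]]

lemma cross_bilinear: "cross \<in> bilinear_maps K H B T"
  unfolding cross_def by (assumption | rule multilinear_rules)+

lemma rmul_B_inner: "b \<in> carrier B \<Longrightarrow> (\<lambda>c g. lmul_B c (cross g b)) \<in> bilinear_maps K B H T"
  by (assumption | rule multilinear_rules bilin_left[OF cross_bilinear] bilin_closed[OF cross_bilinear])+

lemma rmul_B_bilinear: "rmul_B \<in> bilinear_maps K B T T"
proof (rule bilinear_mapsI)
  show "(\<lambda>y. rmul_B b y) \<in> linear_maps K T T" if "b \<in> carrier B" for b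
    unfolding rmul_B_def by (rule tensor_lift_linear[OF mB mH T rmul_B_inner[OF that]])
  show "(\<lambda>b. rmul_B b y) \<in> linear_maps K B T" if "y \<in> carrier T" for y
    unfolding rmul_B_def
    by (rule tensor_lift_param[OF mB mH T mB that rmul_B_inner])
       (assumption | rule multilinear_rules bilin_right[OF cross_bilinear])+
qed

lemmas lin = multilinear_rules
  bilin_left[OF cross_bilinear] bilin_right[OF cross_bilinear] bilin_closed[OF cross_bilinear]
  bilin_left[OF rmul_B_bilinear] bilin_right[OF rmul_B_bilinear] bilin_closed[OF rmul_B_bilinear]

lemma rmul_B_pure: "\<lbrakk>b \<in> carrier B; c \<in> carrier B; g \<in> carrier H\<rbrakk> \<Longrightarrow>
    rmul_B b (pure K B H c g) = lmul_B c (cross g b)"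
  unfolding rmul_B_def by (rule tensor_lift_pure[OF mB mH T rmul_B_inner])

lemma cross_quad: "(\<lambda>h1 b1 h2 b2. pure K B H (h1 \<triangleright> b1) (h2 \<triangleleft> b2)) \<in> quadlinear_maps K H B T"
  by (assumption | rule lin)+

lemma sweedler_lact:
  assumes "module K U" "f \<in> bilinear_maps K B B U" "h \<in> carrier H" "b \<in> carrier B"
  shows "sweedler K B U f (h \<triangleright> b) = S2 U (\<lambda>h1 b1 h2 b2. f (h1 \<triangleright> b1) (h2 \<triangleright> b2)) h b"
  by (rule sweedler_comult[OF coH coB coB assms(1,2) L.lact_bilinear assms(3,4)])
     (simp add: L.lact_comult assms sweedler2_def)

lemma sweedler_ract:
  assumes "module K U" "f \<in> bilinear_maps K H H U" "h \<in> carrier H" "b \<in> carrier B"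
  shows "sweedler K H U f (h \<triangleleft> b) = S2 U (\<lambda>h1 b1 h2 b2. f (h1 \<triangleleft> b1) (h2 \<triangleleft> b2)) h b"
  by (rule sweedler_comult[OF coH coB coH assms(1,2) R.ract_bilinear assms(3,4)])
     (simp add: R.ract_comult assms sweedler2_def)

text \<open>
  The compatibility law of a matched pair, with an arbitrary bilinear map in place of the tensor
  product.
\<close>

lemma exchange:
  assumes U: "module K U" and f: "f \<in> bilinear_maps K H B U" and h: "h \<in> carrier H" and b: "b \<in> carrier B"
  shows "S2 U (\<lambda>h1 b1 h2 b2. f (h2 \<triangleleft> b2) (h1 \<triangleright> b1)) h b =
    S2 U (\<lambda>h1 b1 h2 b2. f (h1 \<triangleleft> b1) (h2 \<triangleright> b2)) h b"
proof -
  let ?HB = "tensor K H B"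
  note f' = bilin_left[OF f] bilin_right[OF f]
  note P = tensor_lift_pure[OF mH mB U f]
  have "S2 U (\<lambda>h1 b1 h2 b2. f (h2 \<triangleleft> b2) (h1 \<triangleright> b1)) h b =
    S2 U (\<lambda>h1 b1 h2 b2. tensor_lift K U f (pure K H B (h2 \<triangleleft> b2) (h1 \<triangleright> b1))) h b"
    by (rule sweedler2_cong[OF coH coB U h b], (assumption | rule f' lin)+) (simp add: P lin)
  also have "\<dots> = tensor_lift K U f (S2 ?HB (\<lambda>h1 b1 h2 b2. pure K H B (h2 \<triangleleft> b2) (h1 \<triangleright> b1)) h b)"
    by (rule linear_map_sweedler2[symmetric, OF coH coB HB U tensor_lift_linear[OF mH mB U f] _ h b])
       (assumption | rule f' lin)+
  also have "\<dots> = tensor_lift K U f (S2 ?HB (\<lambda>h1 b1 h2 b2. pure K H B (h1 \<triangleleft> b1) (h2 \<triangleright> b2)) h b)"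
    using act_exchange[OF h b] by (simp add: sweedler2_def)
  also have "\<dots> = S2 U (\<lambda>h1 b1 h2 b2. tensor_lift K U f (pure K H B (h1 \<triangleleft> b1) (h2 \<triangleright> b2))) h b"
    by (rule linear_map_sweedler2[OF coH coB HB U tensor_lift_linear[OF mH mB U f] _ h b])
       (assumption | rule f' lin)+
  also have "\<dots> = S2 U (\<lambda>h1 b1 h2 b2. f (h1 \<triangleleft> b1) (h2 \<triangleright> b2)) h b"
    by (rule sweedler2_cong[symmetric, OF coH coB U h b], (assumption | rule f' lin)+) (simp add: P lin)
  finally show ?thesis .
qed

lemma linear_map_cross:
  assumes U: "module K U" and \<phi>: "\<phi> \<in> linear_maps K T U" and h: "h \<in> carrier H" and b: "b \<in> carrier B"
  shows "\<phi> (cross h b) = S2 U (\<lambda>h1 b1 h2 b2. \<phi> (pure K B H (h1 \<triangleright> b1) (h2 \<triangleleft> b2))) h b"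
  unfolding cross_def by (rule linear_map_sweedler2[OF coH coB T U \<phi> cross_quad h b])

lemma tensor_lift_cross:
  assumes U: "module K U" and f: "f \<in> bilinear_maps K B H U" and h: "h \<in> carrier H" and b: "b \<in> carrier B"
  shows "tensor_lift K U f (cross h b) = S2 U (\<lambda>h1 b1 h2 b2. f (h1 \<triangleright> b1) (h2 \<triangleleft> b2)) h b"
proof -
  note f' = bilin_left[OF f] bilin_right[OF f]
  show ?thesis
    unfolding linear_map_cross[OF U tensor_lift_linear[OF mB mH U f] h b]
    by (rule sweedler2_cong[symmetric, OF coH coB U h b], (assumption | rule f' lin)+)
       (simp add: tensor_lift_pure[OF mB mH U f] lin)
qed

lemma cross_lact:
  assumes h: "h \<in> carrier H" and g: "g \<in> carrier H" and b: "b \<in> carrier B"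
  shows "cross h (g \<triangleright> b) = sweedler K H T (\<lambda>h1 h2.
    S2 T (\<lambda>p a q c. pure K B H (h1 \<triangleright> (p \<triangleright> a)) (h2 \<triangleleft> (q \<triangleright> c))) g b) h"
  unfolding cross_def sweedler2_def[of _ _ _ _ _ h]
  by (rule sweedler_cong[OF coH T h], (assumption | rule g b lin)+)
     (rule sweedler_lact[OF T _ g b], (assumption | rule lin)+)

lemma cross_ract:
  assumes h: "h \<in> carrier H" and a: "a \<in> carrier B" and b: "b \<in> carrier B"
  shows "cross (h \<triangleleft> a) b = S2 T (\<lambda>p x q y.
    sweedler K B T (\<lambda>u v. pure K B H ((p \<triangleleft> x) \<triangleright> u) ((q \<triangleleft> y) \<triangleleft> v)) b) h a"
  unfolding cross_def sweedler2_def[of _ _ _ _ _ "h \<triangleleft> a"]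
  by (rule sweedler_ract[OF T _ h a], (assumption | rule b lin)+)

text \<open>
  The first quasitriangularity identity on elements. By the product rule for \<open>(hg) \<triangleleft> b\<close>, the left side
  sums \<open>h\<^sub>1 \<triangleright> (g\<^sub>1 \<triangleright> b\<^sub>1) \<otimes> (h\<^sub>2 \<triangleleft> (g\<^sub>2 \<triangleright> b\<^sub>2))(g\<^sub>3 \<triangleleft> b\<^sub>3)\<close>, where the last two parts arise by
  splitting the second one. The right side gives the same terms, but there the first two parts arise by
  splitting the first one because \<open>\<triangleright>\<close> is comultiplicative; coassociativity makes them equal.
\<close>

lemma cross_mult_left:
  assumes h: "h \<in> carrier H" and g: "g \<in> carrier H" and b: "b \<in> carrier B"
  shows "cross (h \<otimes>\<^bsub>H\<^esub> g) b = S2 T (\<lambda>g1 b1 g2 b2. rmul_H (g2 \<triangleleft> b2) (cross h (g1 \<triangleright> b1))) g b"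
proof -
  let ?\<Phi> = "\<lambda>h1 h2 g1 b1 g2 b2 g3 b3. pure K B H (h1 \<triangleright> (g1 \<triangleright> b1)) ((h2 \<triangleleft> (g2 \<triangleright> b2)) \<otimes>\<^bsub>H\<^esub> (g3 \<triangleleft> b3))"
  have inner: "pure K B H ((h1 \<otimes>\<^bsub>H\<^esub> g1) \<triangleright> b1) ((h2 \<otimes>\<^bsub>H\<^esub> g2) \<triangleleft> b2) =
      S2 T (\<lambda>p a q c. ?\<Phi> h1 h2 g1 b1 p a q c) g2 b2"
    if "h1 \<in> carrier H" "h2 \<in> carrier H" "g1 \<in> carrier H" "g2 \<in> carrier H" "b1 \<in> carrier B" "b2 \<in> carrier B"
    for h1 h2 g1 g2 b1 b2
    unfolding ract_prod[OF that(2,4,6)] L.lact_mult[OF that(1,3,5)] sweedler2_def[symmetric]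
    by (rule linear_map_sweedler2[OF coH coB mH T _ _ that(4,6)]) (assumption | rule that lin)+
  have "cross (h \<otimes>\<^bsub>H\<^esub> g) b = sweedler K H T (\<lambda>h1 h2. S2 T (\<lambda>g1 b1 g2 b2.
      pure K B H ((h1 \<otimes>\<^bsub>H\<^esub> g1) \<triangleright> b1) ((h2 \<otimes>\<^bsub>H\<^esub> g2) \<triangleleft> b2)) g b) h"
    unfolding cross_def sweedler2_def
    by (rule H.sweedler_mult[OF T _ h g]) (assumption | rule b lin)+
  also have "\<dots> = sweedler K H T (\<lambda>h1 h2. S2 T (\<lambda>g1 b1 g2 b2.
      S2 T (\<lambda>p a q c. ?\<Phi> h1 h2 g1 b1 p a q c) g2 b2) g b) h"
    by (rule sweedler_cong[OF coH T h], (assumption | rule g b lin)+)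
       (rule sweedler2_cong[OF coH coB T g b _ inner], (assumption | rule lin)+)
  also have "\<dots> = sweedler K H T (\<lambda>h1 h2. S2 T (\<lambda>g1 b1 g2 b2.
      S2 T (\<lambda>p a q c. ?\<Phi> h1 h2 p a q c g2 b2) g1 b1) g b) h"
    by (rule sweedler_cong[OF coH T h], (assumption | rule g b lin)+)
       (rule sweedler2_coassoc[symmetric, OF coH coB T g b], (assumption | rule lin)+)
  also have "\<dots> = S2 T (\<lambda>g1 b1 g2 b2. sweedler K H T (\<lambda>h1 h2.
      S2 T (\<lambda>p a q c. ?\<Phi> h1 h2 p a q c g2 b2) g1 b1) h) g b"
    by (rule sweedler_sweedler2_swap[symmetric, OF coH coB T coH g b h]) (assumption | rule lin)+
  also have "\<dots> = S2 T (\<lambda>g1 b1 g2 b2. rmul_H (g2 \<triangleleft> b2) (cross h (g1 \<triangleright> b1))) g b"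
  proof (rule sweedler2_cong[symmetric, OF coH coB T g b])
    fix g1 b1 g2 b2 assume c: "g1 \<in> carrier H" "b1 \<in> carrier B" "g2 \<in> carrier H" "b2 \<in> carrier B"
    have "rmul_H (g2 \<triangleleft> b2) (cross h (g1 \<triangleright> b1)) = sweedler K H T (\<lambda>h1 h2. rmul_H (g2 \<triangleleft> b2)
      (S2 T (\<lambda>p a q c. pure K B H (h1 \<triangleright> (p \<triangleright> a)) (h2 \<triangleleft> (q \<triangleright> c))) g1 b1)) h"
      unfolding cross_lact[OF h c(1,2)]
      by (rule linear_map_sweedler[OF coH T T _ _ h]) (assumption | rule c lin)+
    also have "\<dots> = sweedler K H T (\<lambda>h1 h2.
      (S2 T (\<lambda>p a q c. rmul_H (g2 \<triangleleft> b2) (pure K B H (h1 \<triangleright> (p \<triangleright> a)) (h2 \<triangleleft> (q \<triangleright> c)))) g1 b1)) h"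
      by (rule sweedler_cong[OF coH T h], (assumption | rule c lin)+,
          rule linear_map_sweedler2[OF coH coB T T _ _ c(1,2)]) (assumption | rule c lin)+
    also have "\<dots> = sweedler K H T (\<lambda>h1 h2. S2 T (\<lambda>p a q c. ?\<Phi> h1 h2 p a q c g2 b2) g1 b1) h"
      by (rule sweedler_cong[OF coH T h], (assumption | rule c lin)+,
          rule sweedler2_cong[OF coH coB T c(1,2)], (assumption | rule c lin)+,
          rule rmul_H_pure) (assumption | rule c lin)+
    finally show "rmul_H (g2 \<triangleleft> b2) (cross h (g1 \<triangleright> b1)) =
      sweedler K H T (\<lambda>h1 h2. S2 T (\<lambda>p a q c. ?\<Phi> h1 h2 p a q c g2 b2) g1 b1) h" .
  qed (assumption | rule h lin)+
  finally show ?thesis .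
qed

text \<open>
  The second identity, dually: the product rule for \<open>h \<triangleright> (ab)\<close> and the comultiplicativity of \<open>\<triangleleft>\<close> lead
  to the same sum up to coassociativity.
\<close>

lemma cross_mult_right:
  assumes h: "h \<in> carrier H" and a: "a \<in> carrier B" and b: "b \<in> carrier B"
  shows "cross h (a \<otimes>\<^bsub>B\<^esub> b) = S2 T (\<lambda>h1 a1 h2 a2. lmul_B (h1 \<triangleright> a1) (cross (h2 \<triangleleft> a2) b)) h a"
proof -
  let ?\<Psi> = "\<lambda>u v h1 a1 h2 a2 h3 a3. pure K B H ((h1 \<triangleright> a1) \<otimes>\<^bsub>B\<^esub> ((h2 \<triangleleft> a2) \<triangleright> u)) ((h3 \<triangleleft> a3) \<triangleleft> v)"
  have inner: "pure K B H (h1 \<triangleright> (a1 \<otimes>\<^bsub>B\<^esub> u)) (h2 \<triangleleft> (a2 \<otimes>\<^bsub>B\<^esub> v)) =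
      S2 T (\<lambda>p x q y. ?\<Psi> u v p x q y h2 a2) h1 a1"
    if "h1 \<in> carrier H" "h2 \<in> carrier H" "a1 \<in> carrier B" "a2 \<in> carrier B" "u \<in> carrier B" "v \<in> carrier B"
    for h1 h2 a1 a2 u v
    unfolding lact_prod[OF that(1,3,5)] R.ract_mult[OF that(2,4,6)] sweedler2_def[symmetric]
    by (rule linear_map_sweedler2[OF coH coB mB T _ _ that(1,3)]) (assumption | rule that lin)+
  have "cross h (a \<otimes>\<^bsub>B\<^esub> b) = sweedler K H T (\<lambda>h1 h2. sweedler K B T (\<lambda>a1 a2. sweedler K B T (\<lambda>u v.
      pure K B H (h1 \<triangleright> (a1 \<otimes>\<^bsub>B\<^esub> u)) (h2 \<triangleleft> (a2 \<otimes>\<^bsub>B\<^esub> v))) b) a) h"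
    unfolding cross_def sweedler2_def
    by (rule sweedler_cong[OF coH T h], (assumption | rule a b lin)+)
       (rule B.sweedler_mult[OF T _ a b], (assumption | rule lin)+)
  also have "\<dots> = S2 T (\<lambda>h1 a1 h2 a2. sweedler K B T (\<lambda>u v.
      pure K B H (h1 \<triangleright> (a1 \<otimes>\<^bsub>B\<^esub> u)) (h2 \<triangleleft> (a2 \<otimes>\<^bsub>B\<^esub> v))) b) h a"
    unfolding sweedler2_def ..
  also have "\<dots> = S2 T (\<lambda>h1 a1 h2 a2. sweedler K B T (\<lambda>u v.
      S2 T (\<lambda>p x q y. ?\<Psi> u v p x q y h2 a2) h1 a1) b) h a"
    by (rule sweedler2_cong[OF coH coB T h a], (assumption | rule b lin)+)
       (rule sweedler_cong[OF coB T b _ inner], (assumption | rule lin)+)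
  also have "\<dots> = sweedler K B T (\<lambda>u v. S2 T (\<lambda>h1 a1 h2 a2.
      S2 T (\<lambda>p x q y. ?\<Psi> u v p x q y h2 a2) h1 a1) h a) b"
    by (rule sweedler_sweedler2_swap[OF coH coB T coB h a b]) (assumption | rule lin)+
  also have "\<dots> = sweedler K B T (\<lambda>u v. S2 T (\<lambda>h1 a1 h2 a2.
      S2 T (\<lambda>p x q y. ?\<Psi> u v h1 a1 p x q y) h2 a2) h a) b"
    by (rule sweedler_cong[OF coB T b], (assumption | rule h a lin)+)
       (rule sweedler2_coassoc[OF coH coB T h a], (assumption | rule lin)+)
  also have "\<dots> = S2 T (\<lambda>h1 a1 h2 a2. sweedler K B T (\<lambda>u v.
      S2 T (\<lambda>p x q y. ?\<Psi> u v h1 a1 p x q y) h2 a2) b) h a"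
    by (rule sweedler_sweedler2_swap[symmetric, OF coH coB T coB h a b]) (assumption | rule lin)+
  also have "\<dots> = S2 T (\<lambda>h1 a1 h2 a2. lmul_B (h1 \<triangleright> a1) (cross (h2 \<triangleleft> a2) b)) h a"
  proof (rule sweedler2_cong[symmetric, OF coH coB T h a])
    fix h1 a1 h2 a2 assume c: "h1 \<in> carrier H" "a1 \<in> carrier B" "h2 \<in> carrier H" "a2 \<in> carrier B"
    have "lmul_B (h1 \<triangleright> a1) (cross (h2 \<triangleleft> a2) b) = S2 T (\<lambda>p x q y. lmul_B (h1 \<triangleright> a1)
      (sweedler K B T (\<lambda>u v. pure K B H ((p \<triangleleft> x) \<triangleright> u) ((q \<triangleleft> y) \<triangleleft> v)) b)) h2 a2"
      unfolding cross_ract[OF c(3,4) b]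
      by (rule linear_map_sweedler2[OF coH coB T T _ _ c(3,4)]) (assumption | rule b c lin)+
    also have "\<dots> = S2 T (\<lambda>p x q y. sweedler K B T (\<lambda>u v. lmul_B (h1 \<triangleright> a1)
      (pure K B H ((p \<triangleleft> x) \<triangleright> u) ((q \<triangleleft> y) \<triangleleft> v))) b) h2 a2"
      by (rule sweedler2_cong[OF coH coB T c(3,4)], (assumption | rule b c lin)+,
          rule linear_map_sweedler[OF coB T T _ _ b]) (assumption | rule c lin)+
    also have "\<dots> = S2 T (\<lambda>p x q y. sweedler K B T (\<lambda>u v. ?\<Psi> u v h1 a1 p x q y) b) h2 a2"
      by (rule sweedler2_cong[OF coH coB T c(3,4)], (assumption | rule b c lin)+,
          rule sweedler_cong[OF coB T b], (assumption | rule c lin)+,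
          rule lmul_B_pure) (assumption | rule c lin)+
    also have "\<dots> = sweedler K B T (\<lambda>u v. S2 T (\<lambda>p x q y. ?\<Psi> u v h1 a1 p x q y) h2 a2) b"
      by (rule sweedler_sweedler2_swap[OF coH coB T coB c(3,4) b]) (assumption | rule c lin)+
    finally show "lmul_B (h1 \<triangleright> a1) (cross (h2 \<triangleleft> a2) b) =
      sweedler K B T (\<lambda>u v. S2 T (\<lambda>p x q y. ?\<Psi> u v h1 a1 p x q y) h2 a2) b" .
  qed (assumption | rule b lin)+
  finally show ?thesis .
qed

lemma cross_one_left:
  assumes b: "b \<in> carrier B"
  shows "cross \<one>\<^bsub>H\<^esub> b = pure K B H b \<one>\<^bsub>H\<^esub>"
proof -
  have "cross \<one>\<^bsub>H\<^esub> b = sweedler K B T (\<lambda>b1 b2. pure K B H (\<one>\<^bsub>H\<^esub> \<triangleright> b1) (\<one>\<^bsub>H\<^esub> \<triangleleft> b2)) b"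
    unfolding cross_def sweedler2_def
    by (rule H.sweedler_one[OF T]) (assumption | rule b lin)+
  also have "\<dots> = sweedler K B T (\<lambda>b1 b2. counit B b2 \<odot>\<^bsub>T\<^esub> pure K B H b1 \<one>\<^bsub>H\<^esub>) b"
    by (rule sweedler_cong[OF coB T b], (assumption | rule lin)+)
       (simp add: ract_unit L.lact_one lin_smult[OF bilin_right[OF
         pure_bilinear[OF mB mH] _ lin_id]] B.counit_closed)
  also have "\<dots> = pure K B H b \<one>\<^bsub>H\<^esub>"
    by (rule sweedler_counit_right[OF coB T _ b]) (assumption | rule lin)+
  finally show ?thesis .
qed

lemma cross_one_right:
  assumes h: "h \<in> carrier H"
  shows "cross h \<one>\<^bsub>B\<^esub> = pure K B H \<one>\<^bsub>B\<^esub> h"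
proof -
  have "cross h \<one>\<^bsub>B\<^esub> = sweedler K H T (\<lambda>h1 h2. pure K B H (h1 \<triangleright> \<one>\<^bsub>B\<^esub>) (h2 \<triangleleft> \<one>\<^bsub>B\<^esub>)) h"
    unfolding cross_def sweedler2_def
    by (rule sweedler_cong[OF coH T h], (assumption | rule lin)+,
        rule B.sweedler_one[OF T]) (assumption | rule lin)+
  also have "\<dots> = sweedler K H T (\<lambda>h1 h2. counit H h1 \<odot>\<^bsub>T\<^esub> pure K B H \<one>\<^bsub>B\<^esub> h2) h"
    by (rule sweedler_cong[OF coH T h], (assumption | rule lin)+)
       (simp add: lact_unit R.ract_one lin_smult[OF bilin_left[OF
         pure_bilinear[OF mB mH] _ lin_id]] H.counit_closed)
  also have "\<dots> = pure K B H \<one>\<^bsub>B\<^esub> h"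
    by (rule sweedler_counit_left[OF coH T _ h]) (assumption | rule lin)+
  finally show ?thesis .
qed

end

section \<open>Bijectivity of the crossing map\<close>

context matched_pair_hopf
begin

abbreviation "e \<equiv> pure K B H \<one>\<^bsub>B\<^esub> \<one>\<^bsub>H\<^esub>"

lemma e_closed: "e \<in> carrier T"
  by (rule lin)+

lemma lmul_B_lmul_B:
  assumes a: "a \<in> carrier B" and c: "c \<in> carrier B" and y: "y \<in> carrier T"
  shows "lmul_B a (lmul_B c y) = lmul_B (a \<otimes>\<^bsub>B\<^esub> c) y"
  by (rule tensor_ext[OF mB mH T _ _ _ y, where f = "\<lambda>y. lmul_B a (lmul_B c y)"])
     (assumption | rule a c lin | simp add: lmul_B_pure a c B.m_assoc)+

lemma rmul_H_rmul_H:
  assumes g: "g \<in> carrier H" and h: "h \<in> carrier H" and y: "y \<in> carrier T"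
  shows "rmul_H g (rmul_H h y) = rmul_H (h \<otimes>\<^bsub>H\<^esub> g) y"
  by (rule tensor_ext[OF mB mH T _ _ _ y, where f = "\<lambda>y. rmul_H g (rmul_H h y)"])
     (assumption | rule g h lin | simp add: rmul_H_pure g h H.m_assoc)+

lemma lmul_B_rmul_H:
  assumes a: "a \<in> carrier B" and h: "h \<in> carrier H" and y: "y \<in> carrier T"
  shows "lmul_B a (rmul_H h y) = rmul_H h (lmul_B a y)"
  by (rule tensor_ext[OF mB mH T _ _ _ y, where f = "\<lambda>y. lmul_B a (rmul_H h y)"])
     (assumption | rule a h lin | simp add: rmul_H_pure lmul_B_pure a h)+

lemma rmul_B_lmul_B:
  assumes a: "a \<in> carrier B" and b: "b \<in> carrier B" and y: "y \<in> carrier T"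
  shows "rmul_B b (lmul_B a y) = lmul_B a (rmul_B b y)"
proof (rule tensor_ext[OF mB mH T _ _ _ y, where f = "\<lambda>y. rmul_B b (lmul_B a y)"])
  fix c g assume c: "c \<in> carrier B" and g: "g \<in> carrier H"
  show "rmul_B b (lmul_B a (pure K B H c g)) = lmul_B a (rmul_B b (pure K B H c g))"
    unfolding lmul_B_pure[OF a c g] rmul_B_pure[OF b c g] rmul_B_pure[OF b B.m_closed[OF a c] g]
    by (rule lmul_B_lmul_B[symmetric, OF a c bilin_closed[OF cross_bilinear g b]])
qed (assumption | rule a b lin)+

lemma cross_mult_left': "\<lbrakk>h \<in> carrier H; g \<in> carrier H; b \<in> carrier B\<rbrakk> \<Longrightarrow>
    cross (h \<otimes>\<^bsub>H\<^esub> g) b = tensor_lift K T (\<lambda>c g'. rmul_H g' (cross h c)) (cross g b)"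
  by (subst cross_mult_left, assumption+, rule tensor_lift_cross[symmetric, OF T]; (assumption | rule lin)+)

lemma cross_mult_right': "\<lbrakk>h \<in> carrier H; a \<in> carrier B; b \<in> carrier B\<rbrakk> \<Longrightarrow>
    cross h (a \<otimes>\<^bsub>B\<^esub> b) = rmul_B b (cross h a)"
  unfolding rmul_B_def
  by (subst cross_mult_right, assumption+, rule tensor_lift_cross[symmetric, OF T]; (assumption | rule lin)+)

lemma rmul_B_rmul_B:
  assumes b: "b \<in> carrier B" and b': "b' \<in> carrier B" and y: "y \<in> carrier T"
  shows "rmul_B b' (rmul_B b y) = rmul_B (b \<otimes>\<^bsub>B\<^esub> b') y"
proof (rule tensor_ext[OF mB mH T _ _ _ y, where f = "\<lambda>y. rmul_B b' (rmul_B b y)"])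
  fix c g assume c: "c \<in> carrier B" and g: "g \<in> carrier H"
  show "rmul_B b' (rmul_B b (pure K B H c g)) = rmul_B (b \<otimes>\<^bsub>B\<^esub> b') (pure K B H c g)"
    unfolding rmul_B_pure[OF b c g] rmul_B_pure[OF B.m_closed[OF b b'] c g]
      rmul_B_lmul_B[OF c b' bilin_closed[OF cross_bilinear g b]] cross_mult_right'[OF g b b'] ..
qed (assumption | rule b b' lin)+

text \<open>
  Right multiplication by \<open>hb\<close>, where \<open>hb\<close> is written as \<open>(h\<^sub>1 \<triangleright> b\<^sub>1)(h\<^sub>2 \<triangleleft> b\<^sub>2)\<close>.
\<close>

lemma rmul_B_rmul_H:
  assumes b: "b \<in> carrier B" and h: "h \<in> carrier H" and y: "y \<in> carrier T"
  shows "rmul_B b (rmul_H h y) = S2 T (\<lambda>h1 b1 h2 b2. rmul_H (h2 \<triangleleft> b2) (rmul_B (h1 \<triangleright> b1) y)) h b"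
proof (rule tensor_ext[OF mB mH T _ _ _ y, where f = "\<lambda>y. rmul_B b (rmul_H h y)"])
  fix c g assume c: "c \<in> carrier B" and g: "g \<in> carrier H"
  have "rmul_B b (rmul_H h (pure K B H c g)) = lmul_B c (S2 T (\<lambda>g1 b1 g2 b2. rmul_H (g2 \<triangleleft> b2) (cross g (g1 \<triangleright> b1))) h b)"
    unfolding rmul_H_pure[OF h c g] rmul_B_pure[OF b c H.m_closed[OF g h]] cross_mult_left[OF g h b] ..
  also have "\<dots> = S2 T (\<lambda>g1 b1 g2 b2. lmul_B c (rmul_H (g2 \<triangleleft> b2) (cross g (g1 \<triangleright> b1)))) h b"
    by (rule linear_map_sweedler2[OF coH coB T T _ _ h b]) (assumption | rule c g lin)+
  also have "\<dots> = S2 T (\<lambda>h1 b1 h2 b2. rmul_H (h2 \<triangleleft> b2) (rmul_B (h1 \<triangleright> b1) (pure K B H c g))) h b"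
    by (rule sweedler2_cong[OF coH coB T h b], (assumption | rule c g lin)+)
       (simp add: lmul_B_rmul_H rmul_B_pure c g lin)
  finally show "rmul_B b (rmul_H h (pure K B H c g)) =
    S2 T (\<lambda>h1 b1 h2 b2. rmul_H (h2 \<triangleleft> b2) (rmul_B (h1 \<triangleright> b1) (pure K B H c g))) h b" .
qed (assumption | rule b h lin)+

lemma rmul_B_one: "y \<in> carrier T \<Longrightarrow> rmul_B \<one>\<^bsub>B\<^esub> y = y"
  by (rule tensor_ext[OF mB mH T, where f = "\<lambda>y. rmul_B \<one>\<^bsub>B\<^esub> y"])
     (assumption | rule lin | simp add: rmul_B_pure cross_one_right lmul_B_pure)+

lemma rmul_H_one: "y \<in> carrier T \<Longrightarrow> rmul_H \<one>\<^bsub>H\<^esub> y = y"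
  by (rule tensor_ext[OF mB mH T, where f = "\<lambda>y. rmul_H \<one>\<^bsub>H\<^esub> y"])
     (assumption | rule lin | simp add: rmul_H_pure)+

lemma rmul_B_rmul_H_e: "\<lbrakk>b \<in> carrier B; h \<in> carrier H\<rbrakk> \<Longrightarrow> rmul_B b (rmul_H h e) = cross h b"
  using lmul_B_pure[OF B.one_closed] tensor_ext[OF mB mH T, where f = "lmul_B \<one>\<^bsub>B\<^esub>" and g = "\<lambda>y. y"]
  by (simp add: rmul_H_pure rmul_B_pure lin bilin_right[OF lmul_B_bilinear _ lin_id, of "\<one>\<^bsub>B\<^esub>"])

lemma rmul_H_rmul_B_e: "\<lbrakk>b \<in> carrier B; h \<in> carrier H\<rbrakk> \<Longrightarrow> rmul_H h (rmul_B b e) = pure K B H b h"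
  by (simp add: rmul_B_pure cross_one_left lmul_B_pure rmul_H_pure)

text \<open>The counit of the coalgebra \<open>H \<otimes> B\<close>.\<close>

abbreviation "eps h b \<equiv> counit H h \<otimes>\<^bsub>K\<^esub> counit B b"

lemma eps_closed: "\<lbrakk>h \<in> carrier H; b \<in> carrier B\<rbrakk> \<Longrightarrow> eps h b \<in> carrier K"
  by (simp add: H.counit_closed B.counit_closed)

text \<open>
  The action \<open>\<triangleright>\<close> is a morphism of coalgebras, so this is the antipode law of \<open>B\<close> at \<open>h \<triangleright> b\<close>.
\<close>

lemma antipode_lact:
  assumes h: "h \<in> carrier H" and b: "b \<in> carrier B"
  shows "S2 B (\<lambda>h1 b1 h2 b2. antipode B (h1 \<triangleright> b1) \<otimes>\<^bsub>B\<^esub> (h2 \<triangleright> b2)) h b = eps h b \<odot>\<^bsub>B\<^esub> \<one>\<^bsub>B\<^esub>"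
  using sweedler_lact[OF mB _ h b, of "\<lambda>y z. antipode B y \<otimes>\<^bsub>B\<^esub> z"]
    B.antipode_left[of "h \<triangleright> b"] L.lact_counit[OF h b] bilin_closed[OF L.lact_bilinear h b]
  by (simp add: bilinear_mapsI lin)

lemma antipode_ract:
  assumes h: "h \<in> carrier H" and b: "b \<in> carrier B"
  shows "S2 H (\<lambda>h1 b1 h2 b2. antipode H (h1 \<triangleleft> b1) \<otimes>\<^bsub>H\<^esub> (h2 \<triangleleft> b2)) h b = eps h b \<odot>\<^bsub>H\<^esub> \<one>\<^bsub>H\<^esub>"
  using sweedler_ract[OF mH _ h b, of "\<lambda>y z. antipode H y \<otimes>\<^bsub>H\<^esub> z"]
    H.antipode_left[of "h \<triangleleft> b"] R.ract_counit[OF h b] bilin_closed[OF R.ract_bilinear h b]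
  by (simp add: bilinear_mapsI lin)

text \<open>
  The antipode of the double crossproduct at the element \<open>hb = (h\<^sub>1 \<triangleright> b\<^sub>1)(h\<^sub>2 \<triangleleft> b\<^sub>2)\<close>. As antipodes
  reverse products, it should be \<open>S(b)S(h)\<close>.
\<close>

definition "antipode_cross h b = S2 T (\<lambda>h1 b1 h2 b2. cross (antipode H (h2 \<triangleleft> b2)) (antipode B (h1 \<triangleright> b1))) h b"

lemma antipode_cross_bilinear: "antipode_cross \<in> bilinear_maps K H B T"
  unfolding antipode_cross_def by (assumption | rule lin)+

lemmas lin_cross = lin bilin_left[OF antipode_cross_bilinear] bilin_right[OF antipode_cross_bilinear]
  bilin_closed[OF antipode_cross_bilinear]

text \<open>
  After the exchange law the part \<open>h\<^sub>2 \<triangleright> b\<^sub>2\<close>, which is multiplied on last, comes from the second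
  half of the splitting, next to the factor \<open>h\<^sub>3 \<triangleright> b\<^sub>3\<close> with which it has to cancel.
\<close>

lemma antipode_cross_eq:
  assumes h: "h \<in> carrier H" and b: "b \<in> carrier B"
  shows "antipode_cross h b = S2 T (\<lambda>h1 b1 h2 b2. rmul_B (antipode B (h2 \<triangleright> b2)) (rmul_H (antipode H (h1 \<triangleleft> b1)) e)) h b"
proof -
  have "antipode_cross h b = S2 T (\<lambda>h1 b1 h2 b2. cross (antipode H (h1 \<triangleleft> b1)) (antipode B (h2 \<triangleright> b2))) h b"
    unfolding antipode_cross_def by (rule exchange[OF T _ h b]) (assumption | rule lin)+
  also have "\<dots> = S2 T (\<lambda>h1 b1 h2 b2. rmul_B (antipode B (h2 \<triangleright> b2)) (rmul_H (antipode H (h1 \<triangleleft> b1)) e)) h b"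
    by (rule sweedler2_cong[OF coH coB T h b], (assumption | rule lin)+) (simp add: rmul_B_rmul_H_e lin)
  finally show ?thesis .
qed

lemma cancel_lact:
  assumes h: "h \<in> carrier H" and b: "b \<in> carrier B" and z: "z \<in> carrier H" and y: "y \<in> carrier T"
  shows "S2 T (\<lambda>h1 b1 h2 b2. rmul_H z (rmul_B (h2 \<triangleright> b2) (rmul_B (antipode B (h1 \<triangleright> b1)) y))) h b =
    eps h b \<odot>\<^bsub>T\<^esub> rmul_H z y"
proof -
  have "S2 T (\<lambda>h1 b1 h2 b2. rmul_H z (rmul_B (h2 \<triangleright> b2) (rmul_B (antipode B (h1 \<triangleright> b1)) y))) h b =
    S2 T (\<lambda>h1 b1 h2 b2. rmul_H z (rmul_B (antipode B (h1 \<triangleright> b1) \<otimes>\<^bsub>B\<^esub> (h2 \<triangleright> b2)) y)) h b"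
    by (rule sweedler2_cong[OF coH coB T h b], (assumption | rule z y lin)+) (simp add: rmul_B_rmul_B y lin)
  also have "\<dots> = rmul_H z (rmul_B (S2 B (\<lambda>h1 b1 h2 b2. antipode B (h1 \<triangleright> b1) \<otimes>\<^bsub>B\<^esub> (h2 \<triangleright> b2)) h b) y)"
    by (rule linear_map_sweedler2[symmetric, OF coH coB mB T _ _ h b, where \<phi> = "\<lambda>w. rmul_H z (rmul_B w y)"])
       (assumption | rule z y lin)+
  also have "\<dots> = eps h b \<odot>\<^bsub>T\<^esub> rmul_H z (rmul_B \<one>\<^bsub>B\<^esub> y)"
    unfolding antipode_lact[OF h b]
    by (rule lin_smult[where f = "\<lambda>w. rmul_H z (rmul_B w y)"]) (assumption | rule z y h b eps_closed lin)+
  finally show ?thesis by (simp add: rmul_B_one y)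
qed

lemma cancel_ract:
  assumes h: "h \<in> carrier H" and b: "b \<in> carrier B"
  shows "S2 T (\<lambda>h1 b1 h2 b2. rmul_H (h2 \<triangleleft> b2) (rmul_H (antipode H (h1 \<triangleleft> b1)) e)) h b = eps h b \<odot>\<^bsub>T\<^esub> e"
proof -
  have "S2 T (\<lambda>h1 b1 h2 b2. rmul_H (h2 \<triangleleft> b2) (rmul_H (antipode H (h1 \<triangleleft> b1)) e)) h b =
    S2 T (\<lambda>h1 b1 h2 b2. rmul_H (antipode H (h1 \<triangleleft> b1) \<otimes>\<^bsub>H\<^esub> (h2 \<triangleleft> b2)) e) h b"
    by (rule sweedler2_cong[OF coH coB T h b], (assumption | rule lin)+) (simp add: rmul_H_rmul_H lin)
  also have "\<dots> = rmul_H (S2 H (\<lambda>h1 b1 h2 b2. antipode H (h1 \<triangleleft> b1) \<otimes>\<^bsub>H\<^esub> (h2 \<triangleleft> b2)) h b) e"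
    by (rule linear_map_sweedler2[symmetric, OF coH coB mH T _ _ h b, where \<phi> = "\<lambda>w. rmul_H w e"])
       (assumption | rule lin)+
  also have "\<dots> = eps h b \<odot>\<^bsub>T\<^esub> rmul_H \<one>\<^bsub>H\<^esub> e"
    unfolding antipode_ract[OF h b]
    by (rule lin_smult[where f = "\<lambda>w. rmul_H w e"]) (assumption | rule h b eps_closed lin)+
  finally show ?thesis by (simp add: rmul_H_one e_closed)
qed

text \<open>
  \<open>antipode_cross\<close> is a left inverse of \<open>cross\<close> under convolution:
  \<open>S(h\<^sub>1 \<triangleleft> b\<^sub>1) S(h\<^sub>2 \<triangleright> b\<^sub>2) (h\<^sub>3 \<triangleright> b\<^sub>3) (h\<^sub>4 \<triangleleft> b\<^sub>4)\<close> collapses from the middle.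
\<close>

lemma antipode_cross_cancel:
  assumes h: "h \<in> carrier H" and b: "b \<in> carrier B"
  shows "S2 T (\<lambda>h1 b1 h2 b2. rmul_B b2 (rmul_H h2 (antipode_cross h1 b1))) h b = eps h b \<odot>\<^bsub>T\<^esub> e"
proof -
  let ?\<Phi> = "\<lambda>h1 b1 h2 b2 h3 b3 h4 b4. rmul_H (h4 \<triangleleft> b4) (rmul_B (h3 \<triangleright> b3)
    (rmul_B (antipode B (h2 \<triangleright> b2)) (rmul_H (antipode H (h1 \<triangleleft> b1)) e)))"
  have inner: "rmul_B b2 (rmul_H h2 (antipode_cross h1 b1)) =
      S2 T (\<lambda>h1 b1 h1' b1'. S2 T (\<lambda>h3 b3 h4 b4. ?\<Phi> h1 b1 h1' b1' h3 b3 h4 b4) h2 b2) h1 b1"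
    if c: "h1 \<in> carrier H" "b1 \<in> carrier B" "h2 \<in> carrier H" "b2 \<in> carrier B" for h1 b1 h2 b2
  proof -
    have "rmul_B b2 (rmul_H h2 (antipode_cross h1 b1)) = S2 T (\<lambda>h1 b1 h1' b1'. rmul_B b2 (rmul_H h2
        (rmul_B (antipode B (h1' \<triangleright> b1')) (rmul_H (antipode H (h1 \<triangleleft> b1)) e)))) h1 b1"
      unfolding antipode_cross_eq[OF c(1,2)]
      by (rule linear_map_sweedler2[OF coH coB T T _ _ c(1,2), where \<phi> = "\<lambda>w. rmul_B b2 (rmul_H h2 w)"])
         (assumption | rule c lin)+
    also have "\<dots> = S2 T (\<lambda>h1 b1 h1' b1'. S2 T (\<lambda>h3 b3 h4 b4. ?\<Phi> h1 b1 h1' b1' h3 b3 h4 b4) h2 b2) h1 b1"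
      by (rule sweedler2_cong[OF coH coB T c(1,2)], (assumption | rule c lin)+,
          rule rmul_B_rmul_H[OF c(4,3)]) (assumption | rule lin)+
    finally show ?thesis .
  qed
  have "S2 T (\<lambda>h1 b1 h2 b2. rmul_B b2 (rmul_H h2 (antipode_cross h1 b1))) h b =
    S2 T (\<lambda>h1 b1 h3 b3. S2 T (\<lambda>h1 b1 h2 b2. S2 T (\<lambda>h3 b3 h4 b4.
      ?\<Phi> h1 b1 h2 b2 h3 b3 h4 b4) h3 b3) h1 b1) h b"
    by (rule sweedler2_cong[OF coH coB T h b _ inner]) (assumption | rule lin_cross)+
  also have "\<dots> = S2 T (\<lambda>h1 b1 h2 b2. S2 T (\<lambda>h2 b2 h3 b3. S2 T (\<lambda>h3 b3 h4 b4.
      ?\<Phi> h1 b1 h2 b2 h3 b3 h4 b4) h3 b3) h2 b2) h b"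
    by (rule sweedler2_coassoc[OF coH coB T h b]) (assumption | rule lin)+
  also have "\<dots> = S2 T (\<lambda>h1 b1 h2 b2. S2 T (\<lambda>h2 b2 h4 b4. S2 T (\<lambda>h2 b2 h3 b3.
      ?\<Phi> h1 b1 h2 b2 h3 b3 h4 b4) h2 b2) h2 b2) h b"
    by (rule sweedler2_cong[OF coH coB T h b], (assumption | rule lin)+,
        rule sweedler2_coassoc[symmetric, OF coH coB T]) (assumption | rule lin)+
  also have "\<dots> = S2 T (\<lambda>h1 b1 h2 b2. S2 T (\<lambda>h2 b2 h4 b4. eps h2 b2 \<odot>\<^bsub>T\<^esub>
      rmul_H (h4 \<triangleleft> b4) (rmul_H (antipode H (h1 \<triangleleft> b1)) e)) h2 b2) h b"
    by (rule sweedler2_cong[OF coH coB T h b], (assumption | rule lin)+,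
        rule sweedler2_cong[OF coH coB T], (assumption | rule lin)+,
        rule cancel_lact) (assumption | rule lin)+
  also have "\<dots> = S2 T (\<lambda>h1 b1 h2 b2. rmul_H (h2 \<triangleleft> b2) (rmul_H (antipode H (h1 \<triangleleft> b1)) e)) h b"
    by (rule sweedler2_cong[symmetric, OF coH coB T h b], (assumption | rule lin)+,
        rule sweedler2_counit_left[symmetric, OF coH coB T]) (assumption | rule lin)+
  finally show ?thesis unfolding cancel_ract[OF h b] .
qed

text \<open>
  \<open>S(b)S(h)\<close> is a right inverse of \<open>hb\<close> under convolution, multiplied on any \<open>y\<close> from the right.
\<close>

lemma cancel_right:
  assumes h: "h \<in> carrier H" and b: "b \<in> carrier B" and y: "y \<in> carrier T"
  shows "S2 T (\<lambda>h1 b1 h2 b2. rmul_H (antipode H h2) (rmul_B (antipode B b2) (rmul_B b1 (rmul_H h1 y)))) h b = eps h b \<odot>\<^bsub>T\<^esub> y"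
proof -
  interpret T: module K T by (rule T)
  have 1: "sweedler K B T (\<lambda>b1 b2. rmul_H (antipode H h2) (rmul_B (antipode B b2) (rmul_B b1 (rmul_H h1 y)))) b =
      counit B b \<odot>\<^bsub>T\<^esub> rmul_H (antipode H h2) (rmul_H h1 y)"
    if c: "h1 \<in> carrier H" "h2 \<in> carrier H" for h1 h2
  proof -
    let ?\<phi> = "\<lambda>w. rmul_H (antipode H h2) (rmul_B w (rmul_H h1 y))"
    have \<phi>: "?\<phi> \<in> linear_maps K B T" by (assumption | rule c y lin)+
    have "sweedler K B T (\<lambda>b1 b2. rmul_H (antipode H h2) (rmul_B (antipode B b2) (rmul_B b1 (rmul_H h1 y)))) b =
      sweedler K B T (\<lambda>b1 b2. ?\<phi> (b1 \<otimes>\<^bsub>B\<^esub> antipode B b2)) b"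
      by (rule sweedler_cong[OF coB T b], (assumption | rule c y lin)+) (simp add: rmul_B_rmul_B c y lin)
    also have "\<dots> = ?\<phi> (sweedler K B B (\<lambda>b1 b2. b1 \<otimes>\<^bsub>B\<^esub> antipode B b2) b)"
      by (rule linear_map_sweedler[symmetric, OF coB mB T \<phi> _ b]) (assumption | rule lin)+
    also have "\<dots> = counit B b \<odot>\<^bsub>T\<^esub> ?\<phi> \<one>\<^bsub>B\<^esub>"
      unfolding B.antipode_right[OF b]
      by (rule lin_smult[OF \<phi> B.counit_closed[OF b] B.one_closed])
    finally show ?thesis by (simp add: rmul_B_one c y lin)
  qed
  let ?\<psi> = "\<lambda>w. counit B b \<odot>\<^bsub>T\<^esub> rmul_H w y"
  have \<psi>: "?\<psi> \<in> linear_maps K H T"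
    by (intro lin_scale T B.counit_closed b bilin_left[OF rmul_H_bilinear y lin_id])
  have "S2 T (\<lambda>h1 b1 h2 b2. rmul_H (antipode H h2) (rmul_B (antipode B b2) (rmul_B b1 (rmul_H h1 y)))) h b =
    sweedler K H T (\<lambda>h1 h2. counit B b \<odot>\<^bsub>T\<^esub> rmul_H (antipode H h2) (rmul_H h1 y)) h"
    unfolding sweedler2_def
    by (rule sweedler_cong[OF coH T h _ 1]) (assumption | rule b y lin)+
  also have "\<dots> = sweedler K H T (\<lambda>h1 h2. ?\<psi> (h1 \<otimes>\<^bsub>H\<^esub> antipode H h2)) h"
    by (rule sweedler_cong[OF coH T h],
        (assumption | rule b y lin lin_scale[OF T] B.counit_closed)+) (simp add: rmul_H_rmul_H y lin)
  also have "\<dots> = ?\<psi> (sweedler K H H (\<lambda>h1 h2. h1 \<otimes>\<^bsub>H\<^esub> antipode H h2) h)"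
    by (rule linear_map_sweedler[symmetric, OF coH mH T \<psi> _ h]) (assumption | rule lin)+
  also have "\<dots> = counit H h \<odot>\<^bsub>T\<^esub> ?\<psi> \<one>\<^bsub>H\<^esub>"
    unfolding H.antipode_right[OF h]
    by (rule lin_smult[OF \<psi> H.counit_closed[OF h] H.one_closed])
  finally show ?thesis
    by (simp add: rmul_H_one y T.smult_assoc1 H.counit_closed B.counit_closed h b)
qed

text \<open>
  A left and a right inverse under convolution coincide: insert \<open>h\<^sub>2b\<^sub>2\<cdot>S(b\<^sub>3)S(h\<^sub>3)\<close> behind
  \<open>antipode_cross h\<^sub>1 b\<^sub>1\<close>, regroup, and cancel the first two factors.
\<close>

lemma antipode_cross_eq_antipodes:
  assumes h: "h \<in> carrier H" and b: "b \<in> carrier B"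
  shows "antipode_cross h b = pure K B H (antipode B b) (antipode H h)"
proof -
  interpret T: module K T by (rule T)
  let ?\<Phi> = "\<lambda>h1 b1 h2 b2 h3 b3. rmul_H (antipode H h3) (rmul_B (antipode B b3) (rmul_B b2 (rmul_H h2 (antipode_cross h1 b1))))"
  have "antipode_cross h b = S2 T (\<lambda>h1 b1 h2 b2. eps h2 b2 \<odot>\<^bsub>T\<^esub> antipode_cross h1 b1) h b"
    by (rule sweedler2_counit_right[symmetric, OF coH coB T antipode_cross_bilinear h b])
  also have "\<dots> = S2 T (\<lambda>h1 b1 h2 b2. S2 T (\<lambda>h2 b2 h3 b3. ?\<Phi> h1 b1 h2 b2 h3 b3) h2 b2) h b"
    by (rule sweedler2_cong[symmetric, OF coH coB T h b], (assumption | rule lin_cross)+,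
        rule cancel_right) (assumption | rule lin_cross)+
  also have "\<dots> = S2 T (\<lambda>h1 b1 h3 b3. S2 T (\<lambda>h1 b1 h2 b2. ?\<Phi> h1 b1 h2 b2 h3 b3) h1 b1) h b"
    by (rule sweedler2_coassoc[symmetric, OF coH coB T h b]) (assumption | rule lin_cross)+
  also have "\<dots> = S2 T (\<lambda>h1 b1 h2 b2. eps h1 b1 \<odot>\<^bsub>T\<^esub> rmul_H (antipode H h2) (rmul_B (antipode B b2) e)) h b"
  proof (rule sweedler2_cong[OF coH coB T h b])
    fix h1 b1 h3 b3 assume c: "h1 \<in> carrier H" "b1 \<in> carrier B" "h3 \<in> carrier H" "b3 \<in> carrier B"
    let ?\<phi> = "\<lambda>w. rmul_H (antipode H h3) (rmul_B (antipode B b3) w)"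
    have \<phi>: "?\<phi> \<in> linear_maps K T T" by (assumption | rule c lin)+
    have "S2 T (\<lambda>h1 b1 h2 b2. ?\<Phi> h1 b1 h2 b2 h3 b3) h1 b1 =
      ?\<phi> (S2 T (\<lambda>h1 b1 h2 b2. rmul_B b2 (rmul_H h2 (antipode_cross h1 b1))) h1 b1)"
      by (rule linear_map_sweedler2[symmetric, OF coH coB T T \<phi> _ c(1,2)]) (assumption | rule lin_cross)+
    also have "\<dots> = eps h1 b1 \<odot>\<^bsub>T\<^esub> ?\<phi> e"
      unfolding antipode_cross_cancel[OF c(1,2)]
      by (rule lin_smult[OF \<phi> eps_closed[OF c(1,2)] e_closed])
    finally show "S2 T (\<lambda>h1 b1 h2 b2. ?\<Phi> h1 b1 h2 b2 h3 b3) h1 b1 = eps h1 b1 \<odot>\<^bsub>T\<^esub> ?\<phi> e" .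
  qed (assumption | rule lin_cross)+
  also have "\<dots> = rmul_H (antipode H h) (rmul_B (antipode B b) e)"
    by (rule sweedler2_counit_left[OF coH coB T _ h b]) (assumption | rule lin)+
  also have "\<dots> = pure K B H (antipode B b) (antipode H h)"
    by (rule rmul_H_rmul_B_e) (assumption | rule h b lin)+
  finally show ?thesis .
qed

definition "R = tensor_lift K T cross"

lemma R_linear: "R \<in> linear_maps K (tensor K H B) T"
  unfolding R_def by (rule tensor_lift_linear[OF mH mB T cross_bilinear])

lemma R_pure: "\<lbrakk>h \<in> carrier H; b \<in> carrier B\<rbrakk> \<Longrightarrow> R (pure K H B h b) = cross h b"
  unfolding R_def by (rule tensor_lift_pure[OF mH mB T cross_bilinear])

lemma R_quasitriangular: "quasitriangular K B H R"
proof (rule quasitriangularI[OF mB mH B.bilinear_mult H.bilinear_mult R_linear])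
  show "R (pure K H B (h \<otimes>\<^bsub>H\<^esub> g) b) =
      tensor_lift K T (\<lambda>c g'. rmul_H g' (R (pure K H B h c))) (R (pure K H B g b))"
    if c: "h \<in> carrier H" "g \<in> carrier H" "b \<in> carrier B" for h g b
    unfolding R_pure[OF H.m_closed[OF c(1,2)] c(3)] R_pure[OF c(2,3)] cross_mult_left'[OF c]
    by (rule tensor_lift_cong[OF mB mH T]) (assumption | rule c lin | simp add: R_pure c)+
  show "R (pure K H B h (a \<otimes>\<^bsub>B\<^esub> a')) =
      tensor_lift K T (\<lambda>c g. lmul_B c (R (pure K H B g a'))) (R (pure K H B h a))"
    if c: "h \<in> carrier H" "a \<in> carrier B" "a' \<in> carrier B" for h a a'
    unfolding R_pure[OF c(1) B.m_closed[OF c(2,3)]] R_pure[OF c(1,2)] cross_mult_right'[OF c] rmul_B_def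
    by (rule tensor_lift_cong[OF mB mH T]) (assumption | rule c lin | simp add: R_pure c)+
qed

lemma R_normal: "normal_map K B H R"
  by (simp add: normal_map_def R_pure cross_one_left cross_one_right)

end

text \<open>
  Applied to the antipodes when the inverse of \<open>R\<close> is constructed.
\<close>

lemma linear_maps_inv_into:
  assumes "module K V" "f \<in> linear_maps K V V" "bij_betw f (carrier V) (carrier V)"
  shows "inv_into (carrier V) f \<in> linear_maps K V V"
proof -
  interpret V: module K V by fact
  let ?g = "inv_into (carrier V) f"
  have cl: "?g x \<in> carrier V" and fg: "f (?g x) = x" if "x \<in> carrier V" for x
    using that assms(3) by (auto simp: bij_betw_def inv_into_into f_inv_into_f)
  have gf: "?g (f x) = x" if "x \<in> carrier V" for x
    using that assms(3) by (simp add: bij_betw_def)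
  show ?thesis
  proof (rule linear_mapsI)
    fix x y assume c: "x \<in> carrier V" "y \<in> carrier V"
    then have "f (?g x \<oplus>\<^bsub>V\<^esub> ?g y) = x \<oplus>\<^bsub>V\<^esub> y"
      by (simp add: lin_add[OF assms(2)] cl fg)
    then show "?g (x \<oplus>\<^bsub>V\<^esub> y) = ?g x \<oplus>\<^bsub>V\<^esub> ?g y"
      using gf[of "?g x \<oplus>\<^bsub>V\<^esub> ?g y"] c cl by simp
  next
    fix a x assume c: "a \<in> carrier K" "x \<in> carrier V"
    then have "f (a \<odot>\<^bsub>V\<^esub> ?g x) = a \<odot>\<^bsub>V\<^esub> x"
      by (simp add: lin_smult[OF assms(2)] cl fg)
    then show "?g (a \<odot>\<^bsub>V\<^esub> x) = a \<odot>\<^bsub>V\<^esub> ?g x"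
      using gf[of "a \<odot>\<^bsub>V\<^esub> ?g x"] c cl by simp
  qed (rule cl)
qed

context matched_pair_hopf
begin

text \<open>
  With \<open>\<sigma>(c \<otimes> g) = S(g) \<otimes> S(c)\<close> the previous computation reads \<open>R(\<sigma>(R(h \<otimes> b))) = S(b) \<otimes> S(h)\<close>. The right side
  is a bijective function of \<open>h \<otimes> b\<close>, with inverse \<open>\<tau>\<close> built from the inverse antipodes; so \<open>\<tau>\<close>
  provides both a left and a right inverse of \<open>R\<close>.
\<close>

lemma R_bij:
  assumes "invertible_antipode B" "invertible_antipode H"
  shows "bij_betw R (carrier (tensor K H B)) (carrier T)"
proof -
  let ?HB = "tensor K H B"
  have bB: "bij_betw (antipode B) (carrier B) (carrier B)"
    and bH: "bij_betw (antipode H) (carrier H) (carrier H)"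
    using assms by (simp_all add: invertible_antipode_def)
  define sB where "sB = inv_into (carrier B) (antipode B)"
  define sH where "sH = inv_into (carrier H) (antipode H)"
  have lB: "sB \<in> linear_maps K B B" and lH: "sH \<in> linear_maps K H H"
    unfolding sB_def sH_def
    by (intro linear_maps_inv_into mB mH B.antipode_linear H.antipode_linear bB bH)+
  have SB: "sB (antipode B x) = x" "antipode B (sB x) = x" if "x \<in> carrier B" for x
    using that bB by (simp_all add: sB_def bij_betw_def f_inv_into_f)
  have SH: "sH (antipode H x) = x" "antipode H (sH x) = x" if "x \<in> carrier H" for x
    using that bH by (simp_all add: sH_def bij_betw_def f_inv_into_f)
  note sl = lin_compose[OF lB] lin_compose[OF lH] lin_closed[OF lB]
    lin_closed[OF lH]
  define \<sigma> where "\<sigma> = tensor_lift K ?HB (\<lambda>c g. pure K H B (antipode H g) (antipode B c))"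
  define \<tau> where "\<tau> = tensor_lift K ?HB (\<lambda>c g. pure K H B (sH g) (sB c))"
  have \<sigma>_inner: "(\<lambda>c g. pure K H B (antipode H g) (antipode B c)) \<in> bilinear_maps K B H ?HB"
    and \<tau>_inner: "(\<lambda>c g. pure K H B (sH g) (sB c)) \<in> bilinear_maps K B H ?HB"
    by (assumption | rule lin sl)+
  have \<sigma>: "\<sigma> \<in> linear_maps K T ?HB" and \<tau>: "\<tau> \<in> linear_maps K T ?HB"
    unfolding \<sigma>_def \<tau>_def by (intro tensor_lift_linear[OF mB mH HB] \<sigma>_inner \<tau>_inner)+
  have \<sigma>_pure: "\<sigma> (pure K B H c g) = pure K H B (antipode H g) (antipode B c)"
    and \<tau>_pure: "\<tau> (pure K B H c g) = pure K H B (sH g) (sB c)"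
    if "c \<in> carrier B" "g \<in> carrier H" for c g
    unfolding \<sigma>_def \<tau>_def
    by (rule tensor_lift_pure[OF mB mH HB \<sigma>_inner that], rule tensor_lift_pure[OF mB mH HB \<tau>_inner that])
  have R\<sigma>R: "R (\<sigma> (R (pure K H B h b))) = pure K B H (antipode B b) (antipode H h)"
    if c: "h \<in> carrier H" "b \<in> carrier B" for h b
  proof -
    note l = lin_compose[OF R_linear \<sigma>]
    have "R (\<sigma> (R (pure K H B h b))) =
      S2 T (\<lambda>h1 b1 h2 b2. R (\<sigma> (pure K B H (h1 \<triangleright> b1) (h2 \<triangleleft> b2)))) h b"
      unfolding R_pure[OF c] by (rule linear_map_cross[OF T l c])
    also have "\<dots> = antipode_cross h b"
      unfolding antipode_cross_def
      by (rule sweedler2_cong[symmetric, OF coH coB T c], (assumption | rule lin)+)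
         (simp add: \<sigma>_pure R_pure lin)
    finally show ?thesis unfolding antipode_cross_eq_antipodes[OF c] .
  qed
  have left: "\<tau> (R (\<sigma> (R x))) = x" if x: "x \<in> carrier ?HB" for x
  proof (rule tensor_ext[OF mH mB HB _ _ _ x, where f = "\<lambda>x. \<tau> (R (\<sigma> (R x)))"])
    show "(\<lambda>x. \<tau> (R (\<sigma> (R x)))) \<in> linear_maps K ?HB ?HB"
      by (intro lin_compose[OF \<tau>] lin_compose[OF R_linear] lin_compose[OF \<sigma>] R_linear)
    show "\<tau> (R (\<sigma> (R (pure K H B h b)))) = pure K H B h b" if "h \<in> carrier H" "b \<in> carrier B" for h b
      by (simp add: R\<sigma>R \<tau>_pure that lin SB SH)
  qed (rule lin_id)
  have right: "R (\<sigma> (R (\<tau> y))) = y" if y: "y \<in> carrier T" for y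
  proof (rule tensor_ext[OF mB mH T _ _ _ y, where f = "\<lambda>y. R (\<sigma> (R (\<tau> y)))"])
    show "(\<lambda>y. R (\<sigma> (R (\<tau> y)))) \<in> linear_maps K T T"
      by (intro lin_compose[OF R_linear] lin_compose[OF \<sigma>] \<tau>)
    show "R (\<sigma> (R (\<tau> (pure K B H c g)))) = pure K B H c g" if "c \<in> carrier B" "g \<in> carrier H" for c g
      by (simp add: R\<sigma>R \<tau>_pure that sl SB SH)
  qed (rule lin_id)
  show ?thesis unfolding bij_betw_def
  proof
    show "inj_on R (carrier ?HB)" by (rule inj_onI) (metis left)
    show "R ` carrier ?HB = carrier T"
    proof
      show "R ` carrier ?HB \<subseteq> carrier T" using lin_closed[OF R_linear] by auto
      show "carrier T \<subseteq> R ` carrier ?HB"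
        using right lin_closed[OF \<sigma>] lin_closed[OF \<tau>] lin_closed[OF R_linear]
        by (metis imageI subsetI)
    qed
  qed
qed

lemma double_crossproduct_same_algebra:
  "same_algebra K (double_crossproduct K B H (\<triangleright>) (\<triangleleft>)) (smash_product K B H R)"
proof -
  have inner: "tensor_lift K T (\<lambda>u v. pure K B H (b \<otimes>\<^bsub>B\<^esub> u) (v \<otimes>\<^bsub>H\<^esub> g)) (R (pure K H B h c)) =
      sweedler K H T (\<lambda>h1 h2. sweedler K B T (\<lambda>c1 c2.
        pure K B H (b \<otimes>\<^bsub>B\<^esub> (h1 \<triangleright> c1)) ((h2 \<triangleleft> c2) \<otimes>\<^bsub>H\<^esub> g)) c) h"
    if "b \<in> carrier B" "h \<in> carrier H" "c \<in> carrier B" "g \<in> carrier H" for b h c g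
    unfolding R_pure[OF that(2,3)] sweedler2_def[symmetric]
    by (rule tensor_lift_cross[OF T _ that(2,3)]) (assumption | rule that lin)+
  have "double_cross_mult K B H (\<triangleright>) (\<triangleleft>) s t = tensor_lift K T (\<lambda>b h. tensor_lift K T (\<lambda>c g.
      tensor_lift K T (\<lambda>u v. pure K B H (b \<otimes>\<^bsub>B\<^esub> u) (v \<otimes>\<^bsub>H\<^esub> g)) (R (pure K H B h c))) t) s"
    if s: "s \<in> carrier T" and t: "t \<in> carrier T" for s t
    unfolding double_cross_mult_def Let_def
  proof (rule tensor_lift_cong[OF mB mH T s])
    show "tensor_lift K T (\<lambda>c g. sweedler K H T (\<lambda>h1 h2. sweedler K B T (\<lambda>c1 c2.
          pure K B H (b \<otimes>\<^bsub>B\<^esub> (h1 \<triangleright> c1)) ((h2 \<triangleleft> c2) \<otimes>\<^bsub>H\<^esub> g)) c) h) t =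
        tensor_lift K T (\<lambda>c g. tensor_lift K T (\<lambda>u v. pure K B H (b \<otimes>\<^bsub>B\<^esub> u) (v \<otimes>\<^bsub>H\<^esub> g))
          (R (pure K H B h c))) t"
      if "b \<in> carrier B" "h \<in> carrier H" for b h
      by (rule tensor_lift_cong[OF mB mH T t _ inner[symmetric]]) (assumption | rule that lin)+
    show "(\<lambda>b h. tensor_lift K T (\<lambda>c g. sweedler K H T (\<lambda>h1 h2. sweedler K B T (\<lambda>c1 c2.
          pure K B H (b \<otimes>\<^bsub>B\<^esub> (h1 \<triangleright> c1)) ((h2 \<triangleleft> c2) \<otimes>\<^bsub>H\<^esub> g)) c) h) t) \<in> bilinear_maps K B H T"
      by (assumption | rule t tensor_lift_param[OF mB mH] lin)+
  qed
  then show ?thesis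
    by (simp add: same_algebra_def double_crossproduct_def smash_product_def Let_def)
qed

lemma double_crossproduct_strong_smash:
  assumes "invertible_antipode B" "invertible_antipode H"
  shows "\<exists>R. strong_smash_map K B H R \<and>
    same_algebra K (double_crossproduct K B H (\<triangleright>) (\<triangleleft>)) (smash_product K B H R)"
  unfolding strong_smash_map_def
  using R_linear R_bij[OF assms] R_quasitriangular R_normal double_crossproduct_same_algebra by blast

end

section \<open>Group algebras\<close>

lemma group_algebra_sel [simp]:
  "carrier (group_algebra K G) = carrier (free_module K (carrier G))"
  "\<zero>\<^bsub>group_algebra K G\<^esub> = \<zero>\<^bsub>free_module K (carrier G)\<^esub>"
  "(\<oplus>\<^bsub>group_algebra K G\<^esub>) = (\<oplus>\<^bsub>free_module K (carrier G)\<^esub>)"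
  "(\<odot>\<^bsub>group_algebra K G\<^esub>) = (\<odot>\<^bsub>free_module K (carrier G)\<^esub>)"
  "\<one>\<^bsub>group_algebra K G\<^esub> = delta K \<one>\<^bsub>G\<^esub>"
  by (simp_all add: group_algebra_def)

lemma linear_maps_group_algebra:
  "linear_maps K (group_algebra K G) W = linear_maps K (free_module K (carrier G)) W"
  "linear_maps K V (group_algebra K G) = linear_maps K V (free_module K (carrier G))"
  by (simp_all add: linear_maps_def)

lemma module_group_algebra: "cring K \<Longrightarrow> module K (group_algebra K G)"
  by (rule module_if_same_operations[OF module_free_module]) simp_all

text \<open>
  The index set in the definition of the product depends on the supports of both factors and on \<open>z\<close>.
  A rectangular index set that may be enlarged freely makes bilinearity a matter of comparing summands.
\<close>

lemma group_algebra_mult_sum: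
  assumes K: "cring K" and f: "f \<in> carrier (group_algebra K G)" and f': "f' \<in> carrier (group_algebra K G)"
    and M: "finite M" "{x. f x \<noteq> \<zero>\<^bsub>K\<^esub>} \<subseteq> M" and N: "finite N" "{y. f' y \<noteq> \<zero>\<^bsub>K\<^esub>} \<subseteq> N"
  shows "(f \<otimes>\<^bsub>group_algebra K G\<^esub> f') z =
    (\<Oplus>\<^bsub>K\<^esub>p \<in> M \<times> N. if fst p \<otimes>\<^bsub>G\<^esub> snd p = z then f (fst p) \<otimes>\<^bsub>K\<^esub> f' (snd p) else \<zero>\<^bsub>K\<^esub>)"
proof -
  interpret K: cring K by fact
  have v: "f x \<in> carrier K" "f' x \<in> carrier K" for x
    using f f' by (simp_all add: free_module_in_carrier[OF K])
  have "(f \<otimes>\<^bsub>group_algebra K G\<^esub> f') z =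
    (\<Oplus>\<^bsub>K\<^esub>p \<in> {(x, y). f x \<noteq> \<zero>\<^bsub>K\<^esub> \<and> f' y \<noteq> \<zero>\<^bsub>K\<^esub> \<and> x \<otimes>\<^bsub>G\<^esub> y = z}. f (fst p) \<otimes>\<^bsub>K\<^esub> f' (snd p))"
    by (simp add: group_algebra_def)
  also have "\<dots> =
    (\<Oplus>\<^bsub>K\<^esub>p \<in> M \<times> N. if fst p \<otimes>\<^bsub>G\<^esub> snd p = z then f (fst p) \<otimes>\<^bsub>K\<^esub> f' (snd p) else \<zero>\<^bsub>K\<^esub>)"
    using M N v by (intro K.add.finprod_mono_neutral_cong_left) auto
  finally show ?thesis .
qed

lemma group_algebra_delta_mult:
  assumes K: "cring K" and g: "g \<in> carrier G" and h: "h \<in> carrier G"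
  shows "delta K g \<otimes>\<^bsub>group_algebra K G\<^esub> delta K h = delta K (g \<otimes>\<^bsub>G\<^esub> h)"
proof
  fix z
  interpret K: cring K by fact
  have "(delta K g \<otimes>\<^bsub>group_algebra K G\<^esub> delta K h) z =
    (\<Oplus>\<^bsub>K\<^esub>p \<in> {g} \<times> {h}. if fst p \<otimes>\<^bsub>G\<^esub> snd p = z
      then delta K g (fst p) \<otimes>\<^bsub>K\<^esub> delta K h (snd p) else \<zero>\<^bsub>K\<^esub>)"
    by (rule group_algebra_mult_sum[OF K]) (use K g h in \<open>auto simp: delta_def[of K]\<close>,
        use delta_closed[OF K g] delta_closed[OF K h] in \<open>auto simp: delta_def[of K]\<close>)
  then show "(delta K g \<otimes>\<^bsub>group_algebra K G\<^esub> delta K h) z = delta K (g \<otimes>\<^bsub>G\<^esub> h) z"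
    by (simp add: delta_def)
qed

lemma bilinear_mult_group_algebra:
  fixes K :: "('k, 'm) ring_scheme" and G :: "('g, 'n) monoid_scheme"
  assumes K: "cring K" and closed: "\<And>x y. \<lbrakk>x \<in> carrier G; y \<in> carrier G\<rbrakk> \<Longrightarrow> x \<otimes>\<^bsub>G\<^esub> y \<in> carrier G"
  shows "bilinear_mult K (group_algebra K G)"
proof -
  interpret K: cring K by fact
  interpret A: module K "group_algebra K G" by (rule module_group_algebra[OF K])
  let ?A = "group_algebra K G"
  note S = group_algebra_mult_sum[OF K]
  note supp = free_module_finite_support[where K = K and S = "carrier G", folded group_algebra_sel(1)]
  have v: "f x \<in> carrier K" if "f \<in> carrier ?A" for f x
    using that by (simp add: free_module_in_carrier[OF K])
  have ops: "f \<oplus>\<^bsub>?A\<^esub> g = (\<lambda>s. f s \<oplus>\<^bsub>K\<^esub> g s)" "c \<odot>\<^bsub>?A\<^esub> f = (\<lambda>s. c \<otimes>\<^bsub>K\<^esub> f s)" for f g c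
    by (simp_all)
  have sum_add: "(\<Oplus>\<^bsub>K\<^esub>p \<in> I. a p) = (\<Oplus>\<^bsub>K\<^esub>p \<in> I. b p) \<oplus>\<^bsub>K\<^esub> (\<Oplus>\<^bsub>K\<^esub>p \<in> I. c p)"
    if "\<And>p. a p = b p \<oplus>\<^bsub>K\<^esub> c p" "\<And>p. b p \<in> carrier K" "\<And>p. c p \<in> carrier K"
    for I :: "('g \<times> 'g) set" and a b c
    unfolding that(1) by (rule K.finsum_addf) (use that in auto)
  let ?s = "\<lambda>f. {x. f x \<noteq> \<zero>\<^bsub>K\<^esub>}"
  have mult_closed: "f \<otimes>\<^bsub>?A\<^esub> f' \<in> carrier ?A" if f: "f \<in> carrier ?A" and f': "f' \<in> carrier ?A" for f f'
    unfolding group_algebra_sel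
  proof (rule free_moduleI[where T = "(\<lambda>p. fst p \<otimes>\<^bsub>G\<^esub> snd p) ` (?s f \<times> ?s f')"])
    show "(f \<otimes>\<^bsub>?A\<^esub> f') s \<in> carrier K" for s
      unfolding S[OF f f' supp(1)[OF f] subset_refl supp(1)[OF f'] subset_refl]
      using v[OF f] v[OF f'] by (intro K.finsum_closed) auto
    show "s \<in> (\<lambda>p. fst p \<otimes>\<^bsub>G\<^esub> snd p) ` (?s f \<times> ?s f')" if "(f \<otimes>\<^bsub>?A\<^esub> f') s \<noteq> \<zero>\<^bsub>K\<^esub>" for s
    proof (rule ccontr)
      assume "s \<notin> (\<lambda>p. fst p \<otimes>\<^bsub>G\<^esub> snd p) ` (?s f \<times> ?s f')"
      then have ne: "fst p \<otimes>\<^bsub>G\<^esub> snd p \<noteq> s" if "p \<in> ?s f \<times> ?s f'" for p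
        using that by blast
      have "(f \<otimes>\<^bsub>?A\<^esub> f') s = (\<Oplus>\<^bsub>K\<^esub>p \<in> ?s f \<times> ?s f'. \<zero>\<^bsub>K\<^esub>)"
        unfolding S[OF f f' supp(1)[OF f] subset_refl supp(1)[OF f'] subset_refl]
        by (rule K.finsum_cong'[OF refl _ if_not_P[OF ne]]) auto
      then show False using that by simp
    qed
    show "finite ((\<lambda>p. fst p \<otimes>\<^bsub>G\<^esub> snd p) ` (?s f \<times> ?s f'))" using supp(1)[OF f] supp(1)[OF f'] by simp
    show "(\<lambda>p. fst p \<otimes>\<^bsub>G\<^esub> snd p) ` (?s f \<times> ?s f') \<subseteq> carrier G"
      using subsetD[OF supp(2)[OF f]] subsetD[OF supp(2)[OF f']] by (auto intro!: closed)
  qed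
  show ?thesis
  proof (intro bilinear_mapsI linear_mapsI mult_closed)
    fix f g h assume f: "f \<in> carrier ?A" and g: "g \<in> carrier ?A" and h: "h \<in> carrier ?A"
    have fin: "finite (?s g \<union> ?s h)" "?s g \<subseteq> ?s g \<union> ?s h" "?s h \<subseteq> ?s g \<union> ?s h"
      "?s (g \<oplus>\<^bsub>?A\<^esub> h) \<subseteq> ?s g \<union> ?s h"
      using supp(1)[OF g] supp(1)[OF h] by (auto simp: ops)
    note gh = A.a_closed[OF g h]
    show "f \<otimes>\<^bsub>?A\<^esub> (g \<oplus>\<^bsub>?A\<^esub> h) = f \<otimes>\<^bsub>?A\<^esub> g \<oplus>\<^bsub>?A\<^esub> f \<otimes>\<^bsub>?A\<^esub> h"
      unfolding ops(1)[of "f \<otimes>\<^bsub>?A\<^esub> g"]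
      unfolding S[OF f gh supp(1)[OF f] subset_refl fin(1,4)]
        S[OF f g supp(1)[OF f] subset_refl fin(1,2)] S[OF f h supp(1)[OF f] subset_refl fin(1,3)]
      using v[OF f] v[OF g] v[OF h]
      by (intro ext sum_add) (auto simp: ops K.r_distr)
    show "(g \<oplus>\<^bsub>?A\<^esub> h) \<otimes>\<^bsub>?A\<^esub> f = g \<otimes>\<^bsub>?A\<^esub> f \<oplus>\<^bsub>?A\<^esub> h \<otimes>\<^bsub>?A\<^esub> f"
      unfolding ops(1)[of "g \<otimes>\<^bsub>?A\<^esub> f"]
      unfolding S[OF gh f fin(1,4) supp(1)[OF f] subset_refl]
        S[OF g f fin(1,2) supp(1)[OF f] subset_refl] S[OF h f fin(1,3) supp(1)[OF f] subset_refl]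
      using v[OF f] v[OF g] v[OF h]
      by (intro ext sum_add) (auto simp: ops K.l_distr)
  next
    fix f g c assume f: "f \<in> carrier ?A" and g: "g \<in> carrier ?A" and c: "c \<in> carrier K"
    have fin: "?s (c \<odot>\<^bsub>?A\<^esub> g) \<subseteq> ?s g" using c by (auto simp: ops)
    note cg = A.smult_closed[OF c g]
    note fs = supp(1)[OF f] subset_refl and gs = supp(1)[OF g] subset_refl
    show "f \<otimes>\<^bsub>?A\<^esub> (c \<odot>\<^bsub>?A\<^esub> g) = c \<odot>\<^bsub>?A\<^esub> (f \<otimes>\<^bsub>?A\<^esub> g)"
      unfolding ops(2)[of c "f \<otimes>\<^bsub>?A\<^esub> g"]
      unfolding S[OF f cg fs supp(1)[OF g] fin] S[OF f g fs gs]
      using v[OF f] v[OF g] c supp(1)[OF f] supp(1)[OF g]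
      by (intro ext, subst K.finsum_rdistr)
         (auto intro!: K.finsum_cong' simp: ops K.m_ac)
    show "(c \<odot>\<^bsub>?A\<^esub> g) \<otimes>\<^bsub>?A\<^esub> f = c \<odot>\<^bsub>?A\<^esub> (g \<otimes>\<^bsub>?A\<^esub> f)"
      unfolding ops(2)[of c "g \<otimes>\<^bsub>?A\<^esub> f"]
      unfolding S[OF cg f supp(1)[OF g] fin fs] S[OF g f gs fs]
      using v[OF f] v[OF g] c supp(1)[OF f] supp(1)[OF g]
      by (intro ext, subst K.finsum_rdistr)
         (auto intro!: K.finsum_cong' simp: ops K.m_ac)
  qed
qed

lemma group_algebra_ext:
  assumes "module K U" "f \<in> linear_maps K (group_algebra K G) U" "g \<in> linear_maps K (group_algebra K G) U"
    and "\<And>s. s \<in> carrier G \<Longrightarrow> f (delta K s) = g (delta K s)" "p \<in> carrier (group_algebra K G)"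
  shows "f p = g p"
  using free_module_ext[of K U f "carrier G" g p] assms by (simp add: linear_maps_group_algebra)

text \<open>
  The group elements form a basis of the group algebra, so trilinear maps may be compared on them.
\<close>

lemma group_algebra_trilinear_ext:
  fixes K :: "('k, 'm) ring_scheme"
    and G :: "('g, 'n) monoid_scheme" and L :: "('l, 'p) monoid_scheme" and M :: "('x, 'q) monoid_scheme"
  defines "A1 \<equiv> group_algebra K G" and "A2 \<equiv> group_algebra K L" and "A3 \<equiv> group_algebra K M"
  assumes U: "module K U"
    and eq: "\<And>x y z. \<lbrakk>x \<in> carrier G; y \<in> carrier L; z \<in> carrier M\<rbrakk> \<Longrightarrow>
      f (delta K x) (delta K y) (delta K z) = g (delta K x) (delta K y) (delta K z)"
    and 1: "\<And>b c. \<lbrakk>b \<in> carrier A2; c \<in> carrier A3\<rbrakk> \<Longrightarrow> (\<lambda>a. f a b c) \<in> linear_maps K A1 U"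
      "\<And>b c. \<lbrakk>b \<in> carrier A2; c \<in> carrier A3\<rbrakk> \<Longrightarrow> (\<lambda>a. g a b c) \<in> linear_maps K A1 U"
    and 2: "\<And>a. a \<in> carrier A1 \<Longrightarrow> f a \<in> bilinear_maps K A2 A3 U"
      "\<And>a. a \<in> carrier A1 \<Longrightarrow> g a \<in> bilinear_maps K A2 A3 U"
    and a: "a \<in> carrier A1" and b: "b \<in> carrier A2" and c: "c \<in> carrier A3"
  shows "f a b c = g a b c"
proof -
  have d: "delta K y \<in> carrier A2" "delta K z \<in> carrier A3" if "y \<in> carrier L" "z \<in> carrier M" for y z
    using module_cring[OF U] that by (simp_all add: A2_def A3_def)
  note ext1 = group_algebra_ext[OF U _ _ _ a[unfolded A1_def]]
    and ext2 = group_algebra_ext[OF U _ _ _ b[unfolded A2_def]]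
    and ext3 = group_algebra_ext[OF U _ _ _ c[unfolded A3_def]]
  have ab: "f a (delta K y) (delta K z) = g a (delta K y) (delta K z)" if "y \<in> carrier L" "z \<in> carrier M" for y z
    by (rule ext1[where f = "\<lambda>a. f a (delta K y) (delta K z)" and g = "\<lambda>a. g a (delta K y) (delta K z)"])
       (use 1[OF d(1)[OF that] d(2)[OF that]] eq that in \<open>simp_all add: A1_def\<close>)
  have "f a b (delta K z) = g a b (delta K z)" if "z \<in> carrier M" for z
    by (rule ext2[where f = "\<lambda>b. f a b (delta K z)"])
       (use bilin_left[OF 2(1)[OF a] _ lin_id] bilin_left[OF 2(2)[OF a] _ lin_id]
         that ab module_cring[OF U] in \<open>auto simp: A2_def A3_def\<close>)
  then show ?thesis
    by (intro ext3[where f = "f a b"])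
       (use bilin_right[OF 2(1)[OF a] b lin_id] bilin_right[OF 2(2)[OF a] b lin_id]
         in \<open>auto simp: A3_def\<close>)
qed

lemma tensor_group_algebra_ext:
  assumes K: "cring K" and U: "module K U"
    and f: "f \<in> linear_maps K (tensor K (group_algebra K G) (group_algebra K L)) U"
    and g: "g \<in> linear_maps K (tensor K (group_algebra K G) (group_algebra K L)) U"
    and eq: "\<And>x y. \<lbrakk>x \<in> carrier G; y \<in> carrier L\<rbrakk> \<Longrightarrow>
      f (pure K (group_algebra K G) (group_algebra K L) (delta K x) (delta K y)) =
      g (pure K (group_algebra K G) (group_algebra K L) (delta K x) (delta K y))"
    and s: "s \<in> carrier (tensor K (group_algebra K G) (group_algebra K L))"
  shows "f s = g s"
proof (rule tensor_ext[OF _ _ U f g _ s])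
  let ?A = "group_algebra K G" and ?B = "group_algebra K L"
  note A = module_group_algebra[OF K, of G] and B = module_group_algebra[OF K, of L]
  note pl = bilin_left[OF pure_bilinear[OF A B] _ lin_id]
    and pr = bilin_right[OF pure_bilinear[OF A B] _ lin_id]
  have d: "x \<in> carrier L \<Longrightarrow> delta K x \<in> carrier ?B" for x using K by simp
  show "f (pure K ?A ?B v w) = g (pure K ?A ?B v w)" if v: "v \<in> carrier ?A" and w: "w \<in> carrier ?B" for v w
  proof (rule group_algebra_ext[OF U _ _ _ w, where f = "\<lambda>w. f (pure K ?A ?B v w)"])
    fix y assume y: "y \<in> carrier L"
    show "f (pure K ?A ?B v (delta K y)) = g (pure K ?A ?B v (delta K y))"
      by (rule group_algebra_ext[OF U _ _ _ v, where f = "\<lambda>v. f (pure K ?A ?B v (delta K y))"])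
         (intro lin_compose[OF f] lin_compose[OF g] pl d v y eq; assumption)+
  qed (intro lin_compose[OF f] lin_compose[OF g] pr v)+
qed (intro module_group_algebra K)+

text \<open>
  The tensors of two group elements form a basis of the tensor product of group algebras;
  \<open>pair_lift\<close> extends a map linearly from this basis.
\<close>

definition pair_lift ::
  "('k, 'm) ring_scheme \<Rightarrow> ('k, 'u, 'q) module_scheme \<Rightarrow> ('g \<Rightarrow> 'l \<Rightarrow> 'u) \<Rightarrow>
   (('g \<Rightarrow> 'k) \<times> ('l \<Rightarrow> 'k) \<Rightarrow> 'k) set \<Rightarrow> 'u"
  where "pair_lift K U \<phi> =
    tensor_lift K U (\<lambda>f f'. free_lift K U (\<lambda>x. free_lift K U (\<lambda>y. \<phi> x y) f') f)"

context
  fixes K :: "('k, 'm) ring_scheme" and U :: "('k, 'u, 'q) module_scheme"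
    and G :: "('g, 'n) monoid_scheme" and L :: "('l, 'p) monoid_scheme" and \<phi> :: "'g \<Rightarrow> 'l \<Rightarrow> 'u"
  assumes K: "cring K" and U: "module K U"
    and \<phi>: "\<And>x y. \<lbrakk>x \<in> carrier G; y \<in> carrier L\<rbrakk> \<Longrightarrow> \<phi> x y \<in> carrier U"
begin

private lemma pair_lift_inner:
  "(\<lambda>f f'. free_lift K U (\<lambda>x. free_lift K U (\<lambda>y. \<phi> x y) f') f)
    \<in> bilinear_maps K (group_algebra K G) (group_algebra K L) U"
proof -
  have l: "free_lift K U (\<phi> x) \<in> linear_maps K (free_module K (carrier L)) U" if "x \<in> carrier G" for x
    by (rule free_lift_linear[OF U]) (use \<phi> that in auto)
  show ?thesis
  proof (rule bilinear_mapsI; unfold linear_maps_group_algebra group_algebra_sel(1))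
    show "(\<lambda>f. free_lift K U (\<lambda>x. free_lift K U (\<phi> x) f') f) \<in> linear_maps K (free_module K (carrier G)) U"
      if "f' \<in> carrier (free_module K (carrier L))" for f'
      by (rule free_lift_linear[OF U]) (use lin_closed[OF l that] in auto)
    show "(\<lambda>f'. free_lift K U (\<lambda>x. free_lift K U (\<phi> x) f') f) \<in> linear_maps K (free_module K (carrier L)) U"
      if f: "f \<in> carrier (free_module K (carrier G))" for f
      unfolding free_lift_def[of K U _ f]
      by (rule linear_maps_finsum_param[OF U])
         (use free_module_finite_support[OF f] in \<open>auto intro!: lin_scale[OF U] l
            free_module_in_carrier[OF K f]\<close>)
  qed
qed

lemma pair_lift_linear:
  "pair_lift K U \<phi> \<in> linear_maps K (tensor K (group_algebra K G) (group_algebra K L)) U"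
  unfolding pair_lift_def
  by (rule tensor_lift_linear[OF module_group_algebra[OF K] module_group_algebra[OF K] U pair_lift_inner])

lemma pair_lift_delta:
  assumes "x \<in> carrier G" "y \<in> carrier L"
  shows "pair_lift K U \<phi> (pure K (group_algebra K G) (group_algebra K L) (delta K x) (delta K y)) = \<phi> x y"
  unfolding pair_lift_def
  by (subst tensor_lift_pure[OF module_group_algebra[OF K] module_group_algebra[OF K] U pair_lift_inner])
     (simp_all add: K assms \<phi> free_lift_delta[OF U])

end

section \<open>Matched pairs of groups\<close>

context matched_pair_group
begin

text \<open>
  By the product rules \<open>x \<triangleright> 1\<close> and \<open>1 \<triangleleft> g\<close> are idempotent, and \<open>1\<close> is the only idempotent of a group.
\<close>

lemma lact_unit: "x \<in> carrier L \<Longrightarrow> x \<triangleright> \<one>\<^bsub>G\<^esub> = \<one>\<^bsub>G\<^esub>"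
  using lact_prod[of x "\<one>\<^bsub>G\<^esub>" "\<one>\<^bsub>G\<^esub>"] lact_closed[of x "\<one>\<^bsub>G\<^esub>"] by (simp add: ract_one)

lemma ract_unit: "g \<in> carrier G \<Longrightarrow> \<one>\<^bsub>L\<^esub> \<triangleleft> g = \<one>\<^bsub>L\<^esub>"
  using ract_prod[of "\<one>\<^bsub>L\<^esub>" "\<one>\<^bsub>L\<^esub>" g] ract_closed[of "\<one>\<^bsub>L\<^esub>" g] by (simp add: lact_one)

text \<open>
  In the bismash product \<open>yh = (y \<triangleright> h)(y \<triangleleft> h)\<close>. Inverting both sides gives
  \<open>h\<^sup>-\<^sup>1y\<^sup>-\<^sup>1 = (y \<triangleleft> h)\<^sup>-\<^sup>1(y \<triangleright> h)\<^sup>-\<^sup>1\<close>; this lemma and the next compare the components.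
\<close>

lemma lact_inv:
  assumes y: "y \<in> carrier L" and h: "h \<in> carrier G"
  shows "inv\<^bsub>L\<^esub> (y \<triangleleft> h) \<triangleright> inv\<^bsub>G\<^esub> (y \<triangleright> h) = inv\<^bsub>G\<^esub> h"
proof -
  note cl = lact_closed ract_closed y h
  have "(y \<triangleright> h) \<otimes>\<^bsub>G\<^esub> ((y \<triangleleft> h) \<triangleright> inv\<^bsub>G\<^esub> h) = \<one>\<^bsub>G\<^esub>"
    using lact_prod[OF y h G.inv_closed[OF h]] by (simp add: h lact_unit[OF y])
  then have 1: "inv\<^bsub>G\<^esub> (y \<triangleright> h) = (y \<triangleleft> h) \<triangleright> inv\<^bsub>G\<^esub> h"
    by (intro G.inv_solve_right'[THEN iffD1] G.inv_equality) (simp_all add: cl G.inv_comm)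
  show ?thesis
    unfolding 1 by (simp add: lact_mult[symmetric] lact_one cl)
qed

lemma ract_inv:
  assumes y: "y \<in> carrier L" and h: "h \<in> carrier G"
  shows "inv\<^bsub>L\<^esub> (y \<triangleleft> h) \<triangleleft> inv\<^bsub>G\<^esub> (y \<triangleright> h) = inv\<^bsub>L\<^esub> y"
proof -
  note cl = lact_closed ract_closed y h
  have "(inv\<^bsub>L\<^esub> y \<triangleleft> (y \<triangleright> h)) \<otimes>\<^bsub>L\<^esub> (y \<triangleleft> h) = \<one>\<^bsub>L\<^esub>"
    using ract_prod[OF L.inv_closed[OF y] y h] by (simp add: y ract_unit[OF h])
  then have 1: "inv\<^bsub>L\<^esub> (y \<triangleleft> h) = inv\<^bsub>L\<^esub> y \<triangleleft> (y \<triangleright> h)"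
    by (intro L.inv_equality) (simp_all add: cl)
  show ?thesis
    unfolding 1 by (simp add: ract_mult[symmetric] ract_one cl)
qed

text \<open>
  The components of the inverse of \<open>(x, g) \<mapsto> (x \<triangleright> g, x \<triangleleft> g)\<close>: the factorisation of \<open>gx\<close> as an
  element of \<open>L\<close> times an element of \<open>G\<close> is obtained by crossing \<open>x\<^sup>-\<^sup>1\<close> and \<open>g\<^sup>-\<^sup>1\<close> and inverting.
\<close>

definition "linv g x = inv\<^bsub>L\<^esub> (inv\<^bsub>L\<^esub> x \<triangleleft> inv\<^bsub>G\<^esub> g)"
definition "ginv g x = inv\<^bsub>G\<^esub> (inv\<^bsub>L\<^esub> x \<triangleright> inv\<^bsub>G\<^esub> g)"

lemma act_bij:
  assumes x: "x \<in> carrier L" and g: "g \<in> carrier G"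
  shows "linv g x \<in> carrier L" "ginv g x \<in> carrier G"
    "linv g x \<triangleright> ginv g x = g" "linv g x \<triangleleft> ginv g x = x"
    "linv (x \<triangleright> g) (x \<triangleleft> g) = x" "ginv (x \<triangleright> g) (x \<triangleleft> g) = g"
  using lact_inv[OF L.inv_closed[OF x] G.inv_closed[OF g]] ract_inv[OF L.inv_closed[OF x] G.inv_closed[OF g]]
    lact_inv[OF x g] ract_inv[OF x g]
  by (simp_all add: linv_def ginv_def lact_closed ract_closed x g)

end

locale matched_pair_group_cring = matched_pair_group G L lact ract + K: cring K
  for K :: "('k, 'm) ring_scheme"
    and G :: "('g, 'n) monoid_scheme" and L :: "('l, 'p) monoid_scheme"
    and lact :: "'l \<Rightarrow> 'g \<Rightarrow> 'g" (infixr \<open>\<triangleright>\<close> 75) and ract :: "'l \<Rightarrow> 'g \<Rightarrow> 'l" (infixl \<open>\<triangleleft>\<close> 75)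
begin

abbreviation "A \<equiv> group_algebra K G"
abbreviation "B \<equiv> group_algebra K L"
abbreviation "T \<equiv> tensor K A B"
abbreviation "BA \<equiv> tensor K B A"
abbreviation "d \<equiv> delta K"
abbreviation "mr \<equiv> mult_right_factor K A B"
abbreviation "ml \<equiv> mult_left_factor K A B"

lemmas mA = module_group_algebra[OF K.is_cring, of G]
lemmas mB = module_group_algebra[OF K.is_cring, of L]
lemmas T = module_tensor[OF mA mB]
lemmas BA = module_tensor[OF mB mA]

lemma multA: "bilinear_mult K A" and multB: "bilinear_mult K B"
  by (rule bilinear_mult_group_algebra[OF K.is_cring], simp)+

lemma d_closed: "g \<in> carrier G \<Longrightarrow> d g \<in> carrier A" "x \<in> carrier L \<Longrightarrow> d x \<in> carrier B"
  by (simp_all add: K.is_cring)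

lemmas dA = group_algebra_delta_mult[OF K.is_cring, of _ G]
lemmas dB = group_algebra_delta_mult[OF K.is_cring, of _ L]

definition "R = pair_lift K T (\<lambda>x g. pure K A B (d (x \<triangleright> g)) (d (x \<triangleleft> g)))"

lemma R_target: "\<lbrakk>x \<in> carrier L; g \<in> carrier G\<rbrakk> \<Longrightarrow> pure K A B (d (x \<triangleright> g)) (d (x \<triangleleft> g)) \<in> carrier T"
  by (intro pure_closed mA mB d_closed lact_closed ract_closed)

lemma R_linear: "R \<in> linear_maps K BA T"
  unfolding R_def by (rule pair_lift_linear[OF K.is_cring T R_target])

lemma R_delta: "\<lbrakk>x \<in> carrier L; g \<in> carrier G\<rbrakk> \<Longrightarrow>
    R (pure K B A (d x) (d g)) = pure K A B (d (x \<triangleright> g)) (d (x \<triangleleft> g))"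
  unfolding R_def by (rule pair_lift_delta[OF K.is_cring T R_target])

lemma R_bij: "bij_betw R (carrier BA) (carrier T)"
proof -
  define R' where "R' = pair_lift K BA (\<lambda>g x. pure K B A (d (linv g x)) (d (ginv g x)))"
  have t: "pure K B A (d (linv g x)) (d (ginv g x)) \<in> carrier BA" if "g \<in> carrier G" "x \<in> carrier L" for g x
    by (intro pure_closed mA mB d_closed act_bij that)
  have R': "R' \<in> linear_maps K T BA"
    unfolding R'_def by (rule pair_lift_linear[OF K.is_cring BA t])
  have R'_delta: "R' (pure K A B (d g) (d x)) = pure K B A (d (linv g x)) (d (ginv g x))"
    if "g \<in> carrier G" "x \<in> carrier L" for g x
    unfolding R'_def by (rule pair_lift_delta[OF K.is_cring BA t that])
  have l: "R' (R s) = s" if "s \<in> carrier BA" for s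
    by (rule tensor_group_algebra_ext[OF K.is_cring BA lin_compose[OF R' R_linear] lin_id _ that])
       (simp add: R_delta R'_delta act_bij lact_closed ract_closed)
  have r: "R (R' s) = s" if "s \<in> carrier T" for s
    by (rule tensor_group_algebra_ext[OF K.is_cring T lin_compose[OF R_linear R'] lin_id _ that])
       (simp add: R_delta R'_delta act_bij)
  show ?thesis
    by (rule bij_betw_byWitness[where f' = R'])
       (use l r lin_closed[OF R'] lin_closed[OF R_linear] in auto)
qed

lemmas ml_bil = mult_left_factor_bilinear[OF mA mB multA multB]
lemmas mr_bil = mult_right_factor_bilinear[OF mA mB multA multB]
lemmas ml_pure = mult_left_factor_pure[OF mA mB multA multB]
lemmas mr_pure = mult_right_factor_pure[OF mA mB multA multB]

lemmas lin = bilinear_mapsI lin_id mA mB T BA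
  bilin_left[OF pure_bilinear[OF mA mB]] bilin_right[OF pure_bilinear[OF mA mB]]
  bilin_left[OF pure_bilinear[OF mB mA]] bilin_right[OF pure_bilinear[OF mB mA]]
  pure_closed[OF mA mB] pure_closed[OF mB mA]
  bilin_left[OF multA] bilin_right[OF multA] bilin_closed[OF multA]
  bilin_left[OF multB] bilin_right[OF multB] bilin_closed[OF multB]
  lin_compose[OF R_linear] lin_closed[OF R_linear]
  bilin_left[OF ml_bil] bilin_right[OF ml_bil] bilin_closed[OF ml_bil]
  bilin_left[OF mr_bil] bilin_right[OF mr_bil] bilin_closed[OF mr_bil]
  tensor_lift_param[OF mA mB T]
  lin_compose[OF tensor_lift_linear[OF mA mB T]]
  lin_closed[OF tensor_lift_linear[OF mA mB T]]
  d_closed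

lemmas lift_pure = tensor_lift_pure[OF mA mB T]

lemma R_quasitriangular: "quasitriangular K A B R"
proof (rule quasitriangularI[OF mA mB multA multB R_linear])
  fix h g a assume c: "h \<in> carrier B" "g \<in> carrier B" "a \<in> carrier A"
  let ?l = "\<lambda>h g a. R (pure K B A (h \<otimes>\<^bsub>B\<^esub> g) a)"
  let ?r = "\<lambda>h g a. tensor_lift K T (\<lambda>c g'. mr g' (R (pure K B A h c))) (R (pure K B A g a))"
  have i: "(\<lambda>c g'. mr g' (R (pure K B A h c))) \<in> bilinear_maps K A B T" if "h \<in> carrier B" for h
    by (assumption | rule that lin)+
  have 1: "?l (d x) (d y) (d z) = ?r (d x) (d y) (d z)"
    if x: "x \<in> carrier L" and y: "y \<in> carrier L" and z: "z \<in> carrier G" for x y z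
  proof -
    note cl = x y z lact_closed ract_closed L.m_closed
    show ?thesis
      unfolding dB[OF x y] R_delta[OF L.m_closed[OF x y] z] R_delta[OF y z]
        lift_pure[OF i[OF d_closed(2)[OF x]] d_closed(1)[OF lact_closed[OF y z]] d_closed(2)[OF ract_closed[OF y z]]]
        R_delta[OF x lact_closed[OF y z]]
      by (subst mr_pure) (simp_all add: dB cl d_closed[simplified] lact_mult ract_prod K.is_cring)
  qed
  show "?l h g a = ?r h g a"
    by (rule group_algebra_trilinear_ext[where f = ?l and g = ?r, OF T 1 _ _ _ _ c])
       (assumption | rule lin)+
next
  fix h a a' assume c: "h \<in> carrier B" "a \<in> carrier A" "a' \<in> carrier A"
  let ?l = "\<lambda>h a a'. R (pure K B A h (a \<otimes>\<^bsub>A\<^esub> a'))"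
  let ?r = "\<lambda>h a a'. tensor_lift K T (\<lambda>c g. ml c (R (pure K B A g a'))) (R (pure K B A h a))"
  have i: "(\<lambda>c g. ml c (R (pure K B A g a'))) \<in> bilinear_maps K A B T" if "a' \<in> carrier A" for a'
    by (assumption | rule that lin)+
  have 1: "?l (d x) (d y) (d z) = ?r (d x) (d y) (d z)"
    if x: "x \<in> carrier L" and y: "y \<in> carrier G" and z: "z \<in> carrier G" for x y z
  proof -
    note cl = x y z lact_closed ract_closed G.m_closed
    show ?thesis
      unfolding dA[OF y z] R_delta[OF x G.m_closed[OF y z]] R_delta[OF x y]
        lift_pure[OF i[OF d_closed(1)[OF z]] d_closed(1)[OF lact_closed[OF x y]] d_closed(2)[OF ract_closed[OF x y]]]
        R_delta[OF ract_closed[OF x y] z]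
      by (subst ml_pure) (simp_all add: dA cl d_closed[simplified] ract_mult lact_prod K.is_cring)
  qed
  show "?l h a a' = ?r h a a'"
    by (rule group_algebra_trilinear_ext[where f = ?l and g = ?r, OF T 1 _ _ _ _ c])
       (assumption | rule lin)+
qed

lemma R_normal: "normal_map K A B R"
  unfolding normal_map_def group_algebra_sel(5)
proof (intro conjI ballI)
  show "R (pure K B A (d \<one>\<^bsub>L\<^esub>) a) = pure K A B a (d \<one>\<^bsub>L\<^esub>)" if "a \<in> carrier A" for a
    by (rule group_algebra_ext[OF T _ _ _ that, where f = "\<lambda>a. R (pure K B A (d \<one>\<^bsub>L\<^esub>) a)"])
       (assumption | rule lin L.one_closed | simp add: R_delta lact_one ract_unit)+
  show "R (pure K B A b (d \<one>\<^bsub>G\<^esub>)) = pure K A B (d \<one>\<^bsub>G\<^esub>) b" if "b \<in> carrier B" for b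
    by (rule group_algebra_ext[OF T _ _ _ that, where f = "\<lambda>b. R (pure K B A b (d \<one>\<^bsub>G\<^esub>))"])
       (assumption | rule lin G.one_closed | simp add: R_delta ract_one lact_unit)+
qed

abbreviation "smash \<equiv> smash_product K A B R"

lemma smash_inner: "\<lbrakk>a \<in> carrier A; b' \<in> carrier B\<rbrakk> \<Longrightarrow>
    (\<lambda>u v. pure K A B (a \<otimes>\<^bsub>A\<^esub> u) (v \<otimes>\<^bsub>B\<^esub> b')) \<in> bilinear_maps K A B T"
  by (assumption | rule lin)+

lemma smash_middle: "\<lbrakk>a \<in> carrier A; b \<in> carrier B\<rbrakk> \<Longrightarrow>
    (\<lambda>a' b'. tensor_lift K T (\<lambda>u v. pure K A B (a \<otimes>\<^bsub>A\<^esub> u) (v \<otimes>\<^bsub>B\<^esub> b')) (R (pure K B A b a')))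
      \<in> bilinear_maps K A B T"
  by (assumption | rule lin)+

lemma smash_outer: "t \<in> carrier T \<Longrightarrow>
    (\<lambda>a b. tensor_lift K T (\<lambda>a' b'. tensor_lift K T (\<lambda>u v. pure K A B (a \<otimes>\<^bsub>A\<^esub> u) (v \<otimes>\<^bsub>B\<^esub> b'))
      (R (pure K B A b a'))) t) \<in> bilinear_maps K A B T"
  by (assumption | rule lin)+

lemma smash_mult: "s \<otimes>\<^bsub>smash\<^esub> t = tensor_lift K T (\<lambda>a b. tensor_lift K T (\<lambda>a' b'.
    tensor_lift K T (\<lambda>u v. pure K A B (a \<otimes>\<^bsub>A\<^esub> u) (v \<otimes>\<^bsub>B\<^esub> b')) (R (pure K B A b a'))) t) s"
  by (simp add: smash_product_def Let_def)

lemma smash_mult_bilinear: "(\<lambda>s t. s \<otimes>\<^bsub>smash\<^esub> t) \<in> bilinear_maps K T T T"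
  unfolding smash_mult
proof (rule bilinear_mapsI)
  show "(\<lambda>t. tensor_lift K T (\<lambda>a b. tensor_lift K T (\<lambda>a' b'.
      tensor_lift K T (\<lambda>u v. pure K A B (a \<otimes>\<^bsub>A\<^esub> u) (v \<otimes>\<^bsub>B\<^esub> b')) (R (pure K B A b a'))) t) s)
    \<in> linear_maps K T T" if "s \<in> carrier T" for s
    by (rule tensor_lift_param[OF mA mB T T that smash_outer])
       (assumption | rule tensor_lift_linear[OF mA mB T] smash_middle)+
  show "(\<lambda>s. tensor_lift K T (\<lambda>a b. tensor_lift K T (\<lambda>a' b'.
      tensor_lift K T (\<lambda>u v. pure K A B (a \<otimes>\<^bsub>A\<^esub> u) (v \<otimes>\<^bsub>B\<^esub> b')) (R (pure K B A b a'))) t) s)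
    \<in> linear_maps K T T" if "t \<in> carrier T" for t
    by (rule tensor_lift_linear[OF mA mB T smash_outer[OF that]])
qed

lemma smash_mult_delta:
  assumes "g \<in> carrier G" "x \<in> carrier L" "g' \<in> carrier G" "x' \<in> carrier L"
  shows "pure K A B (d g) (d x) \<otimes>\<^bsub>smash\<^esub> pure K A B (d g') (d x') =
    pure K A B (d (g \<otimes>\<^bsub>G\<^esub> (x \<triangleright> g'))) (d ((x \<triangleleft> g') \<otimes>\<^bsub>L\<^esub> x'))"
proof -
  note c = d_closed(1)[OF assms(1)] d_closed(2)[OF assms(2)] d_closed(1)[OF assms(3)] d_closed(2)[OF assms(4)]
  note c' = lact_closed[OF assms(2,3)] ract_closed[OF assms(2,3)]
  show ?thesis
    unfolding smash_mult lift_pure[OF smash_outer[OF pure_closed[OF mA mB c(3,4)]] c(1,2)]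
      lift_pure[OF smash_middle[OF c(1,2)] c(3,4)] R_delta[OF assms(2,3)]
      lift_pure[OF smash_inner[OF c(1,4)] d_closed(1)[OF c'(1)] d_closed(2)[OF c'(2)]]
      dA[OF assms(1) c'(1)] dB[OF c'(2) assms(4)] ..
qed

abbreviation "GL \<equiv> bismash_product G L (\<triangleright>) (\<triangleleft>)"
abbreviation "C \<equiv> group_algebra K GL"

lemma GL_sel: "carrier GL = carrier G \<times> carrier L" "\<one>\<^bsub>GL\<^esub> = (\<one>\<^bsub>G\<^esub>, \<one>\<^bsub>L\<^esub>)"
  "(g, x) \<otimes>\<^bsub>GL\<^esub> (g', x') = (g \<otimes>\<^bsub>G\<^esub> (x \<triangleright> g'), (x \<triangleleft> g') \<otimes>\<^bsub>L\<^esub> x')"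
  by (simp_all add: bismash_product_def)

lemmas mC = module_group_algebra[OF K.is_cring, of GL]

lemma multC: "bilinear_mult K C"
  by (rule bilinear_mult_group_algebra[OF K.is_cring])
     (auto simp: GL_sel lact_closed ract_closed)

abbreviation "P \<equiv> group_algebra_pairing K G L"

lemma pairing_inner: "(\<lambda>f f' (g, x). f g \<otimes>\<^bsub>K\<^esub> f' x) \<in> bilinear_maps K A B C"
proof -
  have v: "f g \<in> carrier K" if "f \<in> carrier A" for f g
    using that by (simp add: free_module_in_carrier[OF K.is_cring])
  have v': "f g \<in> carrier K" if "f \<in> carrier B" for f g
    using that by (simp add: free_module_in_carrier[OF K.is_cring])
  have cl: "(\<lambda>(g, x). f g \<otimes>\<^bsub>K\<^esub> f' x) \<in> carrier C" if f: "f \<in> carrier A" and f': "f' \<in> carrier B" for f f'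
    unfolding group_algebra_sel GL_sel
  proof (rule free_moduleI[where T = "{g. f g \<noteq> \<zero>\<^bsub>K\<^esub>} \<times> {x. f' x \<noteq> \<zero>\<^bsub>K\<^esub>}"])
    show "(case s of (g, x) \<Rightarrow> f g \<otimes>\<^bsub>K\<^esub> f' x) \<in> carrier K" for s
      using v[OF f] v'[OF f'] by (cases s) simp
    show "s \<in> {g. f g \<noteq> \<zero>\<^bsub>K\<^esub>} \<times> {x. f' x \<noteq> \<zero>\<^bsub>K\<^esub>}" if "(case s of (g, x) \<Rightarrow> f g \<otimes>\<^bsub>K\<^esub> f' x) \<noteq> \<zero>\<^bsub>K\<^esub>" for s
      using that v[OF f] v'[OF f'] by (cases s) auto
    show "finite ({g. f g \<noteq> \<zero>\<^bsub>K\<^esub>} \<times> {x. f' x \<noteq> \<zero>\<^bsub>K\<^esub>})"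
      using free_module_finite_support(1)[of f K "carrier G"] free_module_finite_support(1)[of f' K "carrier L"] f f'
      by simp
    show "{g. f g \<noteq> \<zero>\<^bsub>K\<^esub>} \<times> {x. f' x \<noteq> \<zero>\<^bsub>K\<^esub>} \<subseteq> carrier G \<times> carrier L"
      using free_module_finite_support(2)[of f K "carrier G"] free_module_finite_support(2)[of f' K "carrier L"] f f'
      by auto
  qed
  show ?thesis
    by (intro bilinear_mapsI linear_mapsI cl)
       (auto simp: fun_eq_iff v v' K.r_distr K.l_distr K.m_ac simp del: group_algebra_sel(1))
qed

text \<open>
  The group algebra of the bismash product differs from the free module on the pairs only in its
  multiplication and unit, which a finite sum does not see.
\<close>

lemma pairing_eq: "P = tensor_lift K C (\<lambda>f f' (g, x). f g \<otimes>\<^bsub>K\<^esub> f' x)"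
  unfolding group_algebra_pairing_def tensor_lift_def
  by (simp add: finsum_def GL_sel)

lemma pairing_linear: "P \<in> linear_maps K T C"
  unfolding pairing_eq by (rule tensor_lift_linear[OF mA mB mC pairing_inner])

lemma pairing_delta:
  assumes "g \<in> carrier G" "x \<in> carrier L"
  shows "P (pure K A B (d g) (d x)) = d (g, x)"
  unfolding pairing_eq
  by (subst tensor_lift_pure[OF mA mB mC pairing_inner d_closed(1)[OF assms(1)] d_closed(2)[OF assms(2)]])
     (auto simp: delta_def fun_eq_iff)

lemma pairing_bij: "bij_betw P (carrier T) (carrier C)"
proof -
  define P' where "P' = free_lift K T (\<lambda>(g, x). pure K A B (d g) (d x))"
  have cl: "(\<lambda>(g, x). pure K A B (d g) (d x)) \<in> carrier GL \<rightarrow> carrier T"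
    by (auto simp: GL_sel intro!: pure_closed mA mB d_closed[simplified])
  have P': "P' \<in> linear_maps K C T"
    unfolding P'_def linear_maps_group_algebra by (rule free_lift_linear[OF T cl])
  have P'_delta: "P' (d (g, x)) = pure K A B (d g) (d x)" if "g \<in> carrier G" "x \<in> carrier L" for g x
    unfolding P'_def
    using free_lift_delta[OF T, of "\<lambda>(g, x). pure K A B (d g) (d x)" "(g, x)"]
      pure_closed[OF mA mB d_closed(1)[OF that(1)] d_closed(2)[OF that(2)]] by simp
  have l: "P' (P s) = s" if "s \<in> carrier T" for s
    by (rule tensor_group_algebra_ext[OF K.is_cring T lin_compose[OF P' pairing_linear] lin_id _ that])
       (simp add: pairing_delta P'_delta)
  have r: "P (P' p) = p" if "p \<in> carrier C" for p
    by (rule group_algebra_ext[OF mC lin_compose[OF pairing_linear P'] lin_id _ that])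
       (auto simp: pairing_delta P'_delta GL_sel)
  show ?thesis
    by (rule bij_betw_byWitness[where f' = P'])
       (use l r lin_closed[OF P'] lin_closed[OF pairing_linear] in auto)
qed

text \<open>
  Both sides are bilinear, and on group elements both give the group element
  \<open>(g(x \<triangleright> g'), (x \<triangleleft> g')x')\<close>.
\<close>

lemma pairing_mult:
  assumes s: "s \<in> carrier T" and t: "t \<in> carrier T"
  shows "P (s \<otimes>\<^bsub>smash\<^esub> t) = P s \<otimes>\<^bsub>C\<^esub> P t"
proof -
  note Pc = lin_closed[OF pairing_linear]
  note sl = bilin_left[OF smash_mult_bilinear _ lin_id]
    bilin_right[OF smash_mult_bilinear _ lin_id]
  note ms = bilin_left[OF multC _ pairing_linear] bilin_right[OF multC _ pairing_linear]
  note pl = lin_compose[OF pairing_linear]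
  have dd: "pure K A B (d g) (d x) \<in> carrier T" if "g \<in> carrier G" "x \<in> carrier L" for g x
    by (intro pure_closed mA mB d_closed that)
  have 1: "P (pure K A B (d g) (d x) \<otimes>\<^bsub>smash\<^esub> pure K A B (d g') (d x')) =
      P (pure K A B (d g) (d x)) \<otimes>\<^bsub>C\<^esub> P (pure K A B (d g') (d x'))"
    if "g \<in> carrier G" "x \<in> carrier L" "g' \<in> carrier G" "x' \<in> carrier L" for g x g' x'
    using that
    by (simp add: smash_mult_delta pairing_delta lact_closed ract_closed
        group_algebra_delta_mult[OF K.is_cring] GL_sel)
  have 2: "P (s \<otimes>\<^bsub>smash\<^esub> pure K A B (d g') (d x')) = P s \<otimes>\<^bsub>C\<^esub> P (pure K A B (d g') (d x'))"
    if c: "g' \<in> carrier G" "x' \<in> carrier L" for g' x'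
    by (rule tensor_group_algebra_ext[where f = "\<lambda>s. P (s \<otimes>\<^bsub>smash\<^esub> pure K A B (d g') (d x'))"
          and g = "\<lambda>s. P s \<otimes>\<^bsub>C\<^esub> P (pure K A B (d g') (d x'))", OF K.is_cring mC _ _ 1[OF _ _ c] s])
       (intro pl sl ms Pc dd c; assumption)+
  show ?thesis
    by (rule tensor_group_algebra_ext[where f = "\<lambda>t. P (s \<otimes>\<^bsub>smash\<^esub> t)"
          and g = "\<lambda>t. P s \<otimes>\<^bsub>C\<^esub> P t", OF K.is_cring mC _ _ 2 t])
       (intro pl sl ms Pc s; assumption)+
qed

lemma smash_sel: "carrier smash = carrier T" "(\<oplus>\<^bsub>smash\<^esub>) = (\<oplus>\<^bsub>T\<^esub>)" "(\<odot>\<^bsub>smash\<^esub>) = (\<odot>\<^bsub>T\<^esub>)"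
  "\<one>\<^bsub>smash\<^esub> = pure K A B (d \<one>\<^bsub>G\<^esub>) (d \<one>\<^bsub>L\<^esub>)"
  by (simp_all add: smash_product_def Let_def)

lemma pairing_iso: "P \<in> algebra_iso K smash C"
proof -
  have "P \<in> linear_maps K smash C"
    using pairing_linear by (simp add: linear_maps_def smash_sel)
  moreover have "P \<in> ring_iso smash C"
    unfolding ring_iso_def ring_hom_def
    using lin_closed[OF pairing_linear] lin_add[OF pairing_linear] pairing_mult pairing_bij
    by (auto simp: smash_sel pairing_delta GL_sel)
  ultimately show ?thesis by (simp add: algebra_iso_def)
qed

lemma group_strong_smash:
  "\<exists>R. strong_smash_map K A B R \<and> P \<in> algebra_iso K (smash_product K A B R) C"
  unfolding strong_smash_map_def
  using R_linear R_bij R_quasitriangular R_normal pairing_iso by blast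

end

theorem proposition5p2:
  fixes K :: "('k, 'm) ring_scheme"
    and B :: "('k, 'b, 'n) hopf_scheme" and H :: "('k, 'h, 'p) hopf_scheme"
    and lactB :: "'h \<Rightarrow> 'b \<Rightarrow> 'b" and ractH :: "'h \<Rightarrow> 'b \<Rightarrow> 'h"
    and G :: "('g, 'q) monoid_scheme" and L :: "('l, 'r) monoid_scheme"
    and lactG :: "'l \<Rightarrow> 'g \<Rightarrow> 'g" and ractL :: "'l \<Rightarrow> 'g \<Rightarrow> 'l"
  assumes "field K"
    and "\<exists>\<iota>. \<iota> \<in> ring_hom (ring_of_type_algebra :: rat ring) K"
  shows "(matched_pair_hopf K B H lactB ractH \<and> invertible_antipode B \<and> invertible_antipode H \<longrightarrow>
           (\<exists>R. strong_smash_map K B H R \<and>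
                same_algebra K (double_crossproduct K B H lactB ractH) (smash_product K B H R))) \<and>
         (matched_pair_group G L lactG ractL \<longrightarrow>
           (\<exists>R. strong_smash_map K (group_algebra K G) (group_algebra K L) R \<and>
                group_algebra_pairing K G L \<in>
                  algebra_iso K
                    (smash_product K (group_algebra K G) (group_algebra K L) R)
                    (group_algebra K (bismash_product G L lactG ractL))))"
  using matched_pair_hopf.double_crossproduct_strong_smash[of K B H lactB ractH]
    matched_pair_group_cring.group_strong_smash[of K G L lactG ractL]
    fieldE(1)[OF assms(1)]
  by (auto simp: matched_pair_group_cring_def)

end
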